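(* Let $p$ be a prime number and let $K/\mathbf{Q}_p$ be a finite tamely ramified Galois extension, with ramification index $e$ and residue field of cardinality $q$. Then for all $n\in\mathbf{N}$ we have \[w_{\mathcal{O}_K}^{\mathbf{Q}_p}(n)=\left\lfloor \frac{w_q(n)}{e}\right\rfloor.\] In particular, $w_{\mathcal{O}_K}^{\mathbf{Q}_p}(n)$ only depends on $n$, $q$ and $e$.
   Context: For a finite extension $K/\mathbf{Q}_p$, $\mathcal{O}_K$ denotes the valuation ring of $K$ and $\mathrm{Int}_{\mathbf{Q}_p}(\mathcal{O}_K):=\{f\in\mathbf{Q}_p[X]\mid f(\mathcal{O}_K)\subseteq\mathcal{O}_K\}$. Tamely ramified means $p\nmid e$. For $n\in\mathbf{N}$ ($0$ included), the characteristic ideal $\mathfrak{I}_n(\mathrm{Int}_{\mathbf{Q}_p}(\mathcal{O}_K))$ is the $\mathbf{Z}_p$-submodule of $\mathbf{Q}_p$ generated by the leading coefficients of all polynomials in $\mathrm{Int}_{\mathbf{Q}_p}(\mathcal{O}_K)$ of degree exactly $n$; it is a nonzero fractional ideal of $\mathbf{Z}_p$. Let $v_p$ be the $p$-adic valuation with $v_p(p)=1$, and for a fractional ideal put $v_p(p^m\mathbf{Z}_p)=m$. Define $w_{\mathcal{O}_K}^{\mathbf{Q}_p}(n):=-v_p\left(\mathfrak{I}_n(\mathrm{Int}_{\mathbf{Q}_p}(\mathcal{O}_K))\right)$ and $w_q(n):=\sum_{j\geq 1}\left\lfloor\frac{n}{q^j}\right\rfloor$. *)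

theory Defs
  imports
    Complex_Main
    "HOL-Library.Extended_Real"
    "HOL-Computational_Algebra.Polynomial"
    "HOL-Computational_Algebra.Fraction_Field"
    "HOL-Computational_Algebra.Normalized_Fraction"
    "Berlekamp_Zassenhaus.Finite_Field"
begin

text \<open>
  The prime \<open>p\<close> is \<open>CARD('p)\<close> for a type variable \<open>'p :: prime_card\<close>, so that the rings depending
  on \<open>p\<close> are types. The ring \<open>\<int>\<^sub>p\<close> is the inverse limit of the rings \<open>\<int>/p^n\<close>: the component
  \<open>f n\<close> is the representative in \<open>{0..<p^n}\<close> of a class modulo \<open>p^n\<close>.
\<close>

typedef (overloaded) ('p::prime_card) padic_int =
  "{f :: nat \<Rightarrow> int. \<forall>n. f n \<in> {0..<int CARD('p) ^ n} \<and> f (Suc n) mod int CARD('p) ^ n = f n}"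
proof
  have "0 < CARD('p)" using prime_card[where 'a='p] prime_gt_0_nat by blast
  then show "(\<lambda>_. 0) \<in> {f :: nat \<Rightarrow> int. \<forall>n. f n \<in> {0..<int CARD('p) ^ n}
      \<and> f (Suc n) mod int CARD('p) ^ n = f n}"
    by simp
qed

setup_lifting type_definition_padic_int

lemma prime_card_pos: "0 < int CARD('p::prime_card) ^ n"
  using prime_card[where 'a='p] prime_gt_0_nat by simp

lemma padic_int_reduce:
  fixes g :: "nat \<Rightarrow> int"
  assumes "g (Suc n) mod int CARD('p::prime_card) ^ n = g n mod int CARD('p) ^ n"
  shows "g n mod int CARD('p) ^ n \<in> {0..<int CARD('p) ^ n}
    \<and> g (Suc n) mod int CARD('p) ^ Suc n mod int CARD('p) ^ n = g n mod int CARD('p) ^ n"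
proof -
  have "g (Suc n) mod int CARD('p) ^ Suc n mod int CARD('p) ^ n = g (Suc n) mod int CARD('p) ^ n"
    by (rule mod_mod_cancel) simp
  then show ?thesis
    using assms prime_card_pos[where 'p='p, of n] by simp
qed

instantiation padic_int :: (prime_card) comm_ring_1
begin

lift_definition zero_padic_int :: "'a padic_int" is "\<lambda>_. 0"
  using prime_card_pos[where 'p='a] by simp

lift_definition one_padic_int :: "'a padic_int" is "\<lambda>n. 1 mod int CARD('a) ^ n"
  by (rule padic_int_reduce[where g="\<lambda>_. 1"]) simp

lift_definition plus_padic_int :: "'a padic_int \<Rightarrow> 'a padic_int \<Rightarrow> 'a padic_int"
  is "\<lambda>f g n. (f n + g n) mod int CARD('a) ^ n"
  by (rule padic_int_reduce[where g="\<lambda>n. f n + g n" for f g]) (metis mod_add_eq)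

lift_definition minus_padic_int :: "'a padic_int \<Rightarrow> 'a padic_int \<Rightarrow> 'a padic_int"
  is "\<lambda>f g n. (f n - g n) mod int CARD('a) ^ n"
  by (rule padic_int_reduce[where g="\<lambda>n. f n - g n" for f g]) (metis mod_diff_eq)

lift_definition uminus_padic_int :: "'a padic_int \<Rightarrow> 'a padic_int"
  is "\<lambda>f n. (- f n) mod int CARD('a) ^ n"
  by (rule padic_int_reduce[where g="\<lambda>n. - f n" for f]) (metis mod_minus_eq)

lift_definition times_padic_int :: "'a padic_int \<Rightarrow> 'a padic_int \<Rightarrow> 'a padic_int"
  is "\<lambda>f g n. (f n * g n) mod int CARD('a) ^ n"
  by (rule padic_int_reduce[where g="\<lambda>n. f n * g n" for f g]) (metis mod_mult_eq)

instance
proof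
  fix a b c :: "'a padic_int"
  show "a * b * c = a * (b * c)" by transfer (auto simp: mod_simps algebra_simps)
  show "a * b = b * a" by transfer (auto simp: algebra_simps)
  show "1 * a = a" by transfer (auto simp: mod_simps)
  show "a + b + c = a + (b + c)" by transfer (auto simp: mod_simps algebra_simps)
  show "a + b = b + a" by transfer (auto simp: algebra_simps)
  show "0 + a = a" by transfer auto
  show "- a + a = 0" by transfer (auto simp: mod_simps)
  show "a - b = a + - b" by transfer (auto simp: mod_simps)
  show "(a + b) * c = a * c + b * c" by transfer (auto simp: mod_simps algebra_simps)
  show "(0::'a padic_int) \<noteq> 1"
  proof transfer
    have "1 < CARD('a)" using prime_card[where 'a='a] prime_gt_1_nat by blast
    then have "(1::int) mod int CARD('a) ^ 1 = 1" by simp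
    then show "(\<lambda>_. 0) \<noteq> (\<lambda>n. (1::int) mod int CARD('a) ^ n)" by (metis zero_neq_one)
  qed
qed

end

lemma padic_int_coherent:
  fixes f :: "nat \<Rightarrow> int"
  assumes f: "\<forall>n. f n \<in> {0..<int CARD('p::prime_card) ^ n} \<and> f (Suc n) mod int CARD('p) ^ n = f n"
    and "n \<le> m"
  shows "f m mod int CARD('p) ^ n = f n"
  using \<open>n \<le> m\<close>
proof (induction m rule: dec_induct)
  case base
  then show ?case using f by simp
next
  case (step m)
  have "f (Suc m) mod int CARD('p) ^ n = f (Suc m) mod int CARD('p) ^ m mod int CARD('p) ^ n"
    by (rule mod_mod_cancel[symmetric]) (use step in \<open>simp add: le_imp_power_dvd\<close>)
  then show ?case using f step by simp
qed

instance padic_int :: (prime_card) idom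
proof
  fix a b :: "'a padic_int"
  assume "a \<noteq> 0" "b \<noteq> 0"
  then show "a * b \<noteq> 0"
  proof transfer
    let ?p = "int CARD('a)"
    fix f g :: "nat \<Rightarrow> int"
    assume f: "\<forall>n. f n \<in> {0..<?p ^ n} \<and> f (Suc n) mod ?p ^ n = f n"
      and g: "\<forall>n. g n \<in> {0..<?p ^ n} \<and> g (Suc n) mod ?p ^ n = g n"
      and nz: "f \<noteq> (\<lambda>_. 0)" "g \<noteq> (\<lambda>_. 0)"
    from nz obtain i j where ij: "f i \<noteq> 0" "g j \<noteq> 0" by (meson ext)
    have f': "\<not> ?p ^ i dvd f (i + j)"
      using padic_int_coherent[OF f, of i "i + j"] ij by (auto simp: dvd_eq_mod_eq_0)
    have g': "\<not> ?p ^ j dvd g (i + j)"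
      using padic_int_coherent[OF g, of j "i + j"] ij by (auto simp: dvd_eq_mod_eq_0)
    have p: "prime_elem ?p" using prime_card[where 'a='a] by simp
    have "\<not> ?p ^ (i + j) dvd f (i + j) * g (i + j)"
    proof
      assume "?p ^ (i + j) dvd f (i + j) * g (i + j)"
      then obtain k l where kl: "k + l = i + j" "?p ^ k dvd f (i + j)" "?p ^ l dvd g (i + j)"
        using prime_elem_power_dvd_prod[OF _ p] by metis
      then have "i \<le> k \<or> j \<le> l" by linarith
      with kl f' g' show False by (meson dvd_trans le_imp_power_dvd)
    qed
    then show "(\<lambda>n. f n * g n mod ?p ^ n) \<noteq> (\<lambda>_. 0)"
      by (metis dvd_eq_mod_eq_0)
  qed
qed

text \<open>\<open>\<rat>\<^sub>p\<close> is the field of fractions of \<open>\<int>\<^sub>p\<close>.\<close>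

type_synonym 'p padic = "'p padic_int fract"

text \<open>\<open>v\<^sub>p x\<close> is the greatest integer \<open>k\<close> with \<open>x \<in> p^k \<int>\<^sub>p\<close>.\<close>

definition padic_val :: "'p::prime_card padic \<Rightarrow> ereal" where
  "padic_val x = (if x = 0 then \<infinity>
     else ereal (of_int (GREATEST k::int. \<exists>a. x = of_nat CARD('p) powi k * to_fract a)))"

text \<open>
  A field extension is given by its embedding \<open>\<iota>\<close> of the base field; the base field is then the
  subfield \<open>range \<iota>\<close>.
\<close>

definition finite_extension :: "('f::field \<Rightarrow> 'k::field) \<Rightarrow> bool" where
  "finite_extension \<iota> \<longleftrightarrow> field_hom \<iota> \<and>
     (\<exists>B. finite B \<and> module.span (\<lambda>a x. \<iota> a * x) B = (UNIV :: 'k set))"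

definition automorphisms_over :: "('f::field \<Rightarrow> 'k::field) \<Rightarrow> ('k \<Rightarrow> 'k) set" where
  "automorphisms_over \<iota> = {\<sigma>. field_hom \<sigma> \<and> bij \<sigma> \<and> (\<forall>a. \<sigma> (\<iota> a) = \<iota> a)}"

definition finite_galois_extension :: "('f::field \<Rightarrow> 'k::field) \<Rightarrow> bool" where
  "finite_galois_extension \<iota> \<longleftrightarrow> finite_extension \<iota> \<and>
     {x. \<forall>\<sigma>\<in>automorphisms_over \<iota>. \<sigma> x = x} = range \<iota>"

definition valuation :: "('k::field \<Rightarrow> ereal) \<Rightarrow> bool" where
  "valuation v \<longleftrightarrow> (\<forall>x. v x \<noteq> -\<infinity>) \<and> (\<forall>x. v x = \<infinity> \<longleftrightarrow> x = 0) \<and>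
     (\<forall>x y. v (x * y) = v x + v y) \<and> (\<forall>x y. min (v x) (v y) \<le> v (x + y))"

text \<open>
  The definitions below are meant for finite extensions of \<open>\<rat>\<^sub>p\<close>, where the valuation extending
  \<open>v\<^sub>p\<close> exists and is unique; it is normalised by \<open>v(p) = 1\<close>.
\<close>

definition ext_val :: "('p::prime_card padic \<Rightarrow> 'k::field) \<Rightarrow> 'k \<Rightarrow> ereal" where
  "ext_val \<iota> = (THE v. valuation v \<and> (\<forall>a. v (\<iota> a) = padic_val a))"

definition valuation_ring :: "('p::prime_card padic \<Rightarrow> 'k::field) \<Rightarrow> 'k set" where
  "valuation_ring \<iota> = {x. 0 \<le> ext_val \<iota> x}"

definition maximal_ideal :: "('p::prime_card padic \<Rightarrow> 'k::field) \<Rightarrow> 'k set" where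
  "maximal_ideal \<iota> = {x. 0 < ext_val \<iota> x}"

definition residue_field :: "('p::prime_card padic \<Rightarrow> 'k::field) \<Rightarrow> 'k set set" where
  "residue_field \<iota> = valuation_ring \<iota> // {(x, y). x - y \<in> maximal_ideal \<iota>}"

text \<open>The index of the value group of \<open>v\<^sub>p\<close> in the value group of its extension.\<close>

definition ramification_index :: "('p::prime_card padic \<Rightarrow> 'k::field) \<Rightarrow> nat" where
  "ramification_index \<iota> =
     card (ext_val \<iota> ` (- {0}) // {(a, b). a - b \<in> (padic_val :: 'p padic \<Rightarrow> ereal) ` (- {0})})"

definition tamely_ramified :: "('p::prime_card padic \<Rightarrow> 'k::field) \<Rightarrow> bool" where
  "tamely_ramified \<iota> \<longleftrightarrow> \<not> CARD('p) dvd ramification_index \<iota>"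

definition int_valued_polys :: "('p::prime_card padic \<Rightarrow> 'k::field) \<Rightarrow> 'p padic poly set" where
  "int_valued_polys \<iota> = {f. poly (map_poly \<iota> f) ` valuation_ring \<iota> \<subseteq> valuation_ring \<iota>}"

text \<open>The condition \<open>f \<noteq> 0\<close> matters for \<open>n = 0\<close>, since \<open>degree 0 = 0\<close>.\<close>

definition characteristic_ideal ::
    "('p::prime_card padic \<Rightarrow> 'k::field) \<Rightarrow> nat \<Rightarrow> 'p padic set" where
  "characteristic_ideal \<iota> n = module.span (\<lambda>a x. to_fract a * x)
     {lead_coeff f | f. f \<in> int_valued_polys \<iota> \<and> f \<noteq> 0 \<and> degree f = n}"

definition fractional_ideal_val :: "'p::prime_card padic set \<Rightarrow> int" where
  "fractional_ideal_val I =
     (THE m. I = range (\<lambda>a. of_nat CARD('p) powi m * to_fract a))"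

definition w_ext :: "('p::prime_card padic \<Rightarrow> 'k::field) \<Rightarrow> nat \<Rightarrow> int" where
  "w_ext \<iota> n = - fractional_ideal_val (characteristic_ideal \<iota> n)"

definition wq :: "nat \<Rightarrow> nat \<Rightarrow> nat" where
  "wq q n = (\<Sum>j. n div q ^ Suc j)"

end

theory Submission
  imports Defs "HOL-Library.Diagonal_Subsequence" "HOL-Algebra.Sylow"
begin

text \<open>
  Existence of the extended valuation: fix a basis of \<open>K\<close> and let \<open>\<bar>x\<bar>\<close> be the least valuation of
  a coordinate of \<open>x\<close>. As \<open>\<int>\<^sub>p\<close> is compact, \<open>v\<^sub>p(N x) / [K : \<rat>\<^sub>p]\<close> differs from \<open>\<bar>x\<bar>\<close> by a bounded
  amount only, and passing to large powers of \<open>x\<close> removes this error: it yields the ultrametric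
  inequality and, likewise, uniqueness.

  Upper bound for the leading coefficients: Lagrange interpolation at points \<open>a 0, \<dots>, a n\<close> built
  from \<open>q\<close>-adic digits, which are equidistributed modulo every power of the maximal ideal.

  Lower bound: \<open>g = p\<^sup>-\<^sup>m (X - a 0) \<cdots> (X - a (n - 1))\<close> with \<open>m = \<lfloor>w\<^sub>q(n) / e\<rfloor>\<close> is integer-valued on
  \<open>\<O>\<^sub>K\<close>, and so is its trace \<open>\<Sum>\<sigma>. \<sigma>(\<alpha> g)\<close>, which has coefficients in \<open>\<rat>\<^sub>p\<close> and leading coefficient
  \<open>Tr(\<alpha>) p\<^sup>-\<^sup>m\<close>. In the tame case \<open>\<alpha> \<in> \<O>\<^sub>K\<close> can be chosen with \<open>Tr(\<alpha>)\<close> a unit: otherwise \<open>p\<close> divides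
  the order of the inertia group, and a subgroup of order \<open>p\<close> in it would be trivial.
\<close>

subsection \<open>The ring of p-adic integers\<close>

text \<open>Since \<open>K\<close> is an abstract field with an embedding and \<open>ext_val\<close>
  is a definite description, nothing can be said about \<open>\<O>\<^sub>K\<close>, \<open>e\<close>
  or \<open>q\<close> before a valuation has been constructed and shown to be unique. Norm and trace
  are products and sums over the Galois group; they descend to \<open>\<rat>\<^sub>p\<close> because
  \<open>range \<iota>\<close> is its fixed field. The floor arises because leading coefficients lie
  in \<open>\<rat>\<^sub>p\<close>, where normalised orders are multiples of \<open>e\<close>. In
  the tame step neither the order of the inertia group nor the formula n = e f is computed. Modulo
  the maximal ideal the trace is a sum of distinct automorphisms of the residue field with class
  sizes as multiplicities, so by independence its vanishing forces p to divide the size of the class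
  of the identity, which is the inertia group. A subgroup P of order p in it is killed by density:
  the norm to the fixed field of P multiplies orders by p and raises residues to the p-th power. As
  p is prime to \<open>e\<close>, the order of p itself, and Frobenius permutes the finite residue
  field, the fixed field meets every order and every residue.\<close>

lemma padic_int_eq_iff: "a = b \<longleftrightarrow> (\<forall>n. Rep_padic_int a n = Rep_padic_int b n)"
  by (metis Rep_padic_int_inject ext)

lemma Rep_padic_int_bounds:
  "0 \<le> Rep_padic_int (a::'p::prime_card padic_int) n" "Rep_padic_int a n < int CARD('p) ^ n"
  using Rep_padic_int[of a] by auto

lemma Rep_padic_int_mod:
  "n \<le> m \<Longrightarrow> Rep_padic_int (a::'p::prime_card padic_int) m mod int CARD('p) ^ n = Rep_padic_int a n"
  using Rep_padic_int[of a] by (intro padic_int_coherent) auto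

lemma Rep_padic_int_of_nat:
  "Rep_padic_int (of_nat k :: 'p::prime_card padic_int) n = int k mod int CARD('p) ^ n"
  by (induction k)
     (simp_all add: zero_padic_int.rep_eq one_padic_int.rep_eq plus_padic_int.rep_eq mod_simps)

lemma Rep_padic_int_prime_power:
  "Rep_padic_int (of_nat CARD('p) ^ k :: 'p::prime_card padic_int) n
     = int CARD('p) ^ k mod int CARD('p) ^ n"
  using Rep_padic_int_of_nat[of "CARD('p) ^ k" n, where 'p='p] by simp

text \<open>Dividing by \<open>p ^ n\<close> costs n digits, so component m of the quotient has to
  be read off from component n + m of \<open>a\<close>.\<close>

lemma prime_power_dvd_padic_int_iff:
  fixes a :: "'p::prime_card padic_int"
  shows "of_nat CARD('p) ^ n dvd a \<longleftrightarrow> Rep_padic_int a n = 0"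
proof
  assume "of_nat CARD('p) ^ n dvd a"
  then obtain b where "a = of_nat CARD('p) ^ n * b" by auto
  then show "Rep_padic_int a n = 0"
    by (simp only: times_padic_int.rep_eq Rep_padic_int_prime_power) simp
next
  let ?p = "int CARD('p)"
  assume a0: "Rep_padic_int a n = 0"
  define f where "f m = Rep_padic_int a (n + m) div ?p ^ n" for m
  have p0: "?p > 0" using prime_card_pos[where 'p='p, of 1] by simp
  have f: "\<forall>m. f m \<in> {0..<?p ^ m} \<and> f (Suc m) mod ?p ^ m = f m"
  proof
    fix m
    have "f m \<ge> 0" using Rep_padic_int_bounds(1)[of a] p0
      by (auto simp: f_def pos_imp_zdiv_nonneg_iff)
    moreover have "f m < ?p ^ m" unfolding f_def
    proof (rule ccontr)
      assume "\<not> Rep_padic_int a (n + m) div ?p ^ n < ?p ^ m"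
      then have "?p ^ m * ?p ^ n \<le> Rep_padic_int a (n + m) div ?p ^ n * ?p ^ n"
        using p0 by (intro mult_right_mono) auto
      also have "\<dots> \<le> Rep_padic_int a (n + m)"
        using p0 by (simp add: minus_mod_eq_div_mult [symmetric])
      finally show False
        using Rep_padic_int_bounds(2)[of a "n + m"] by (simp add: power_add mult.commute)
    qed
    moreover have "f (Suc m) mod ?p ^ m = f m"
    proof -
      have "f (Suc m) mod ?p ^ m = Rep_padic_int a (n + Suc m) mod (?p ^ n * ?p ^ m) div ?p ^ n"
        unfolding f_def using p0 by (simp add: zmod_zmult2_eq)
      also have "Rep_padic_int a (n + Suc m) mod (?p ^ n * ?p ^ m) = Rep_padic_int a (n + m)"
        using Rep_padic_int_mod[of "n + m" "n + Suc m" a] by (simp add: power_add)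
      finally show ?thesis by (simp add: f_def)
    qed
    ultimately show "f m \<in> {0..<?p ^ m} \<and> f (Suc m) mod ?p ^ m = f m" by auto
  qed
  define b :: "'p padic_int" where "b = Abs_padic_int f"
  have Rb: "Rep_padic_int b = f" unfolding b_def using f by (intro Abs_padic_int_inverse) auto
  have "a = of_nat CARD('p) ^ n * b"
    unfolding padic_int_eq_iff
  proof
    fix m
    have "?p ^ n dvd Rep_padic_int a (n + m)"
      using Rep_padic_int_mod[of n "n + m" a] a0 by (auto simp: dvd_eq_mod_eq_0)
    then have "?p ^ n * f m = Rep_padic_int a (n + m)" by (simp add: f_def)
    then show "Rep_padic_int a m = Rep_padic_int (of_nat CARD('p) ^ n * b) m"
      using Rep_padic_int_mod[of m "n + m" a]
      by (simp only: times_padic_int.rep_eq Rep_padic_int_prime_power Rb) (simp add: mod_mult_left_eq)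
  qed
  then show "of_nat CARD('p) ^ n dvd a" by auto
qed

text \<open>If p does not divide \<open>a\<close>, every component is coprime to
  \<open>p ^ n\<close> and has an inverse by Bezout. Uniqueness of inverses modulo
  \<open>p ^ n\<close> makes these inverses coherent.\<close>

lemma padic_int_unit_iff:
  fixes a :: "'p::prime_card padic_int"
  shows "a dvd 1 \<longleftrightarrow> \<not> of_nat CARD('p) dvd a"
proof
  assume "a dvd 1"
  show "\<not> of_nat CARD('p) dvd a"
  proof
    assume "of_nat CARD('p) dvd a"
    with \<open>a dvd 1\<close> have "of_nat CARD('p) ^ 1 dvd (1 :: 'p padic_int)" by (simp add: dvd_trans)
    then have "Rep_padic_int (1 :: 'p padic_int) 1 = 0"
      by (simp only: prime_power_dvd_padic_int_iff)
    then show False using prime_card[where 'a='p] prime_gt_1_nat[of "CARD('p)"]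
      by (simp add: one_padic_int.rep_eq)
  qed
next
  let ?p = "int CARD('p)"
  assume nd: "\<not> of_nat CARD('p) dvd a"
  then have R1: "Rep_padic_int a 1 \<noteq> 0"
    using prime_power_dvd_padic_int_iff[of 1 a] by simp
  have pp: "prime ?p" using prime_card[where 'a='p] by simp
  have cop: "coprime (Rep_padic_int a n) (?p ^ n)" for n
  proof (cases "n = 0")
    case False
    have "\<not> ?p dvd Rep_padic_int a n"
      using Rep_padic_int_mod[of 1 n a] False R1 by (auto simp: dvd_eq_mod_eq_0)
    then have "coprime ?p (Rep_padic_int a n)" using pp prime_imp_coprime by blast
    then show ?thesis by (simp add: coprime_commute)
  qed auto
  have "\<exists>x. 0 \<le> x \<and> x < ?p ^ n \<and> Rep_padic_int a n * x mod ?p ^ n = 1 mod ?p ^ n" for n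
  proof -
    obtain u v where uv: "u * Rep_padic_int a n + v * ?p ^ n = 1"
      using cop[of n] by (metis bezout_int coprime_iff_gcd_eq_1)
    then have "Rep_padic_int a n * u = 1 - v * ?p ^ n" by (simp add: algebra_simps)
    then have "Rep_padic_int a n * (u mod ?p ^ n) mod ?p ^ n = 1 mod ?p ^ n"
      by (simp add: mod_mult_right_eq mod_diff_right_eq [symmetric, of _ "v * _"])
    then show ?thesis
      using prime_card_pos[where 'p='p, of n] by (intro exI[of _ "u mod ?p ^ n"]) auto
  qed
  then obtain f where f: "\<And>n. 0 \<le> f n" "\<And>n. f n < ?p ^ n"
      "\<And>n. Rep_padic_int a n * f n mod ?p ^ n = 1 mod ?p ^ n" by metis
  have coh: "f (Suc n) mod ?p ^ n = f n" for n
  proof -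
    have "?p ^ n dvd Rep_padic_int a (Suc n) * f (Suc n) - 1"
    proof (rule dvd_trans)
      show "?p ^ n dvd ?p ^ Suc n" by simp
      show "?p ^ Suc n dvd Rep_padic_int a (Suc n) * f (Suc n) - 1"
        using f(3)[of "Suc n"] by (simp only: mod_eq_dvd_iff)
    qed
    moreover have "?p ^ n dvd Rep_padic_int a (Suc n) - Rep_padic_int a n"
      using Rep_padic_int_mod[of n "Suc n" a] by (metis dvd_minus_mod le_SucI order_refl)
    ultimately have "?p ^ n dvd (Rep_padic_int a (Suc n) * f (Suc n) - 1)
        - (Rep_padic_int a (Suc n) - Rep_padic_int a n) * f (Suc n)"
      by (meson dvd_diff dvd_mult2)
    moreover have "?p ^ n dvd Rep_padic_int a n * f n - 1"
      using f(3)[of n] by (simp only: mod_eq_dvd_iff)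
    ultimately have "?p ^ n dvd ((Rep_padic_int a (Suc n) * f (Suc n) - 1)
        - (Rep_padic_int a (Suc n) - Rep_padic_int a n) * f (Suc n)) - (Rep_padic_int a n * f n - 1)"
      by (rule dvd_diff)
    then have "?p ^ n dvd Rep_padic_int a n * (f (Suc n) - f n)" by (simp add: algebra_simps)
    then have "?p ^ n dvd f (Suc n) - f n"
      using cop[of n] by (metis coprime_commute coprime_dvd_mult_right_iff)
    then have "f (Suc n) mod ?p ^ n = f n mod ?p ^ n" by (simp only: mod_eq_dvd_iff)
    then show ?thesis using f(1,2)[of n] by simp
  qed
  define b :: "'p padic_int" where "b = Abs_padic_int f"
  have Rb: "Rep_padic_int b = f" unfolding b_def using f coh by (intro Abs_padic_int_inverse) auto
  have "a * b = 1"
    unfolding padic_int_eq_iff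
    by (simp add: times_padic_int.rep_eq one_padic_int.rep_eq Rb f(3))
  then show "a dvd 1" by (metis dvd_triv_left)
qed

lemma of_nat_prime_padic_int_nonzero [simp]: "of_nat CARD('p) \<noteq> (0 :: 'p::prime_card padic_int)"
proof
  assume "of_nat CARD('p) = (0 :: 'p padic_int)"
  then have "Rep_padic_int (of_nat CARD('p) :: 'p padic_int) 2 = 0"
    by (simp add: zero_padic_int.rep_eq)
  moreover have "1 < CARD('p)" using prime_card[where 'a='p] prime_gt_1_nat by blast
  then have "int CARD('p) < int CARD('p) ^ 2"
    by (metis of_nat_1 of_nat_less_iff one_less_numeral_iff power_one_right power_strict_increasing semiring_norm(76))
  ultimately show False using \<open>1 < CARD('p)\<close> by (simp only: Rep_padic_int_of_nat) simp
qed

lemma padic_int_decompose: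
  fixes a :: "'p::prime_card padic_int"
  assumes "a \<noteq> 0"
  obtains n u where "a = of_nat CARD('p) ^ n * u" "u dvd 1"
proof -
  have ex: "\<exists>n. Rep_padic_int a n \<noteq> 0"
    using assms by (metis padic_int_eq_iff zero_padic_int.rep_eq)
  define m where "m = (LEAST n. Rep_padic_int a n \<noteq> 0)"
  have m: "Rep_padic_int a m \<noteq> 0" unfolding m_def by (rule LeastI_ex[OF ex])
  \<comment> \<open>Component 0 is a residue modulo 1, so the first nonzero index is a successor
    \<open>Suc n\<close>, and \<open>n\<close> is the exact power of p in \<open>a\<close>.\<close>
  have "Rep_padic_int a 0 = 0" using Rep_padic_int_bounds[of a 0] by simp
  with m obtain n where n: "m = Suc n" by (cases m) auto
  have "Rep_padic_int a n = 0" using not_less_Least[of n "\<lambda>n. Rep_padic_int a n \<noteq> 0"] n m_def by auto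
  then obtain u where u: "a = of_nat CARD('p) ^ n * u"
    using prime_power_dvd_padic_int_iff by (metis dvdE)
  have "\<not> of_nat CARD('p) dvd u"
  proof
    assume "of_nat CARD('p) dvd u"
    then have "of_nat CARD('p) ^ Suc n dvd a" unfolding u by (simp add: mult.commute mult_dvd_mono)
    then show False using m n prime_power_dvd_padic_int_iff by blast
  qed
  then show ?thesis using that u padic_int_unit_iff by blast
qed

text \<open>Diagonal argument: each level n has finitely many residues for the finitely many indices
  in \<open>B\<close>, so the pigeonhole principle thins out the sequence until level n is constant.
  All indices are treated at once to obtain a single subsequence.\<close>

lemma padic_int_seq_compact:
  fixes X :: "nat \<Rightarrow> 'b \<Rightarrow> 'p::prime_card padic_int"
  assumes "finite B"
  obtains r c where "strict_mono r" "\<And>k b. b \<in> B \<Longrightarrow> of_nat CARD('p) ^ k dvd X (r k) b - c b"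
proof -
  define P where "P n s \<longleftrightarrow> (\<exists>f. \<forall>k. \<forall>b\<in>B. Rep_padic_int (X (s k) b) n = f b)"
    for n and s :: "nat \<Rightarrow> nat"
  interpret subseqs P
  proof
    fix n and s :: "nat \<Rightarrow> nat" assume "strict_mono s"
    define g where "g k = restrict (\<lambda>b. Rep_padic_int (X (s k) b) n) B" for k
    have "range g \<subseteq> (\<Pi>\<^sub>E b\<in>B. {0..<int CARD('p) ^ n})"
      unfolding g_def using Rep_padic_int_bounds[of "X _ _" n] by auto
    then have "finite (range g)"
      using assms finite_PiE[of B "\<lambda>_. {0..<int CARD('p) ^ n}"] finite_subset by blast
    then obtain k0 where "infinite {k. g k = g k0}"
      using pigeonhole_infinite[of UNIV g] by auto
    from infinite_enumerate[OF this] obtain r :: "nat \<Rightarrow> nat"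
      where r: "strict_mono r" "\<And>k. g (r k) = g k0" by auto
    have "Rep_padic_int (X (s (r k)) b) n = g k0 b" if "b \<in> B" for k b
      using r(2)[of k] that by (metis g_def restrict_apply')
    then have "P n (s \<circ> r)" unfolding P_def by (intro exI[of _ "g k0"]) auto
    then show "\<exists>r. strict_mono r \<and> P n (s \<circ> r)" using r by blast
  qed
  have "P n (diagseq \<circ> ((+) (Suc n)))" for n
    by (rule diagseq_holds) (auto simp: P_def)
  then have "\<exists>f. \<forall>k. \<forall>b\<in>B. Rep_padic_int (X (diagseq (Suc n + k)) b) n = f b" for n
    by (auto simp: P_def)
  then obtain F where F: "\<And>n k b. b \<in> B \<Longrightarrow> Rep_padic_int (X (diagseq (Suc n + k)) b) n = F n b"
    by metis
  define c :: "'b \<Rightarrow> 'p padic_int" where "c b = Abs_padic_int (\<lambda>n. F n b)" for b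
  have Rc: "Rep_padic_int (c b) = (\<lambda>n. F n b)" if b: "b \<in> B" for b
    unfolding c_def
  proof (intro Abs_padic_int_inverse CollectI allI conjI)
    fix n
    show "F n b \<in> {0..<int CARD('p) ^ n}"
      using F[OF b, of n 0] Rep_padic_int_bounds[of "X _ _" n] by (metis atLeastLessThan_iff)
    show "F (Suc n) b mod int CARD('p) ^ n = F n b"
      using F[OF b, of n 1] F[OF b, of "Suc n" 0] Rep_padic_int_mod[of n "Suc n" "X (diagseq (Suc (Suc n))) b"]
      by simp
  qed
  show ?thesis
  proof (rule that)
    \<comment> \<open>The diagonal sequence is constant on level n only from index
      \<open>Suc n\<close> on; the shift by \<open>Suc\<close> gives agreement modulo
      \<open>p ^ k\<close> already at index k.\<close>
    show "strict_mono (diagseq \<circ> Suc)"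
      using subseq_diagseq by (simp add: strict_mono_def)
    fix k b assume b: "b \<in> B"
    have "Rep_padic_int (X ((diagseq \<circ> Suc) k) b - c b) k = 0"
      using F[OF b, of k 0] Rc[OF b] by (simp add: minus_padic_int.rep_eq)
    then show "of_nat CARD('p) ^ k dvd X ((diagseq \<circ> Suc) k) b - c b"
      by (simp add: prime_power_dvd_padic_int_iff)
  qed
qed

subsection \<open>The valuation of the field of p-adic numbers\<close>

text \<open>Has the shape of the sets in \<open>fractional_ideal_val\<close>. As a membership
  predicate it also treats 0 uniformly, where no integer valuation is available.\<close>

definition padic_ideal :: "int \<Rightarrow> 'p::prime_card padic set" where
  "padic_ideal k = range (\<lambda>a. of_nat CARD('p) powi k * to_fract a)"

text \<open>Integer-valued companion of \<open>padic_val\<close>. No \<open>k\<close> fits x = 0, so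
  the value there is unspecified and the rules below exclude 0.\<close>

definition pval :: "'p::prime_card padic \<Rightarrow> int" where
  "pval x = (THE k. \<exists>u. u dvd 1 \<and> x = of_nat CARD('p) powi k * to_fract u)"

lemma to_fract_of_nat: "to_fract (of_nat n) = of_nat n"
  by (induction n) (simp_all add: to_fract_add)

lemma to_fract_power: "to_fract (a ^ n) = to_fract a ^ n"
  by (induction n) (simp_all add: to_fract_mult)

lemma of_nat_prime_padic_nonzero [simp]: "of_nat CARD('p) \<noteq> (0 :: 'p::prime_card padic)"
  using of_nat_prime_padic_int_nonzero[where 'p='p] unfolding to_fract_of_nat[symmetric] to_fract_eq_0_iff .

lemma padic_decompose:
  fixes x :: "'p::prime_card padic"
  assumes "x \<noteq> 0"
  obtains k u where "u dvd 1" "x = of_nat CARD('p) powi k * to_fract u"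
proof -
  obtain a b where ab: "x = Fract a b" "b \<noteq> 0" by (cases x) auto
  have x: "x = to_fract a / to_fract b" using ab by (simp add: Fract_conv_to_fract)
  have a: "a \<noteq> 0" using x assms by auto
  obtain n u where u: "a = of_nat CARD('p) ^ n * u" "u dvd 1" using padic_int_decompose[OF a] by blast
  obtain m w where w: "b = of_nat CARD('p) ^ m * w" "w dvd 1" using padic_int_decompose[OF ab(2)] by blast
  obtain w' where w': "1 = w * w'" using w(2) by (auto elim: dvdE)
  have "to_fract w * to_fract w' = 1" using w' by (metis to_fract_1 to_fract_mult)
  then have w'': "inverse (to_fract w) = to_fract w'" by (metis inverse_unique)
  then have "x = of_nat CARD('p) powi (int n - int m) * to_fract (u * w')"
    unfolding x u w by (simp add: to_fract_power to_fract_of_nat power_int_diff w''[symmetric] field_simps)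
  moreover have "u * w' dvd 1" using u(2) w' by (metis dvd_triv_right is_unit_mult_iff)
  ultimately show ?thesis using that by blast
qed

text \<open>Only \<open>u\<close> is a unit, \<open>a\<close> is arbitrary. Thus one inequality
  gives both the uniqueness of the exponent, when applied twice, and the description of
  \<open>padic_ideal\<close> by \<open>pval\<close>.\<close>

lemma padic_decompose_unique:
  fixes u w :: "'p::prime_card padic_int"
  assumes "of_nat CARD('p) powi k * to_fract a = of_nat CARD('p) powi l * to_fract u" "u dvd 1"
  shows "k \<le> l"
proof (rule ccontr)
  assume "\<not> k \<le> l"
  then obtain d where d: "k = l + 1 + int d" by (metis not_le zless_iff_Suc_zadd add.assoc of_nat_Suc)
  have "of_nat CARD('p) powi k = of_nat CARD('p) powi l * (of_nat CARD('p) ^ Suc d :: 'p padic)"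
    unfolding d by (simp add: power_int_add)
  then have "of_nat CARD('p) powi l * to_fract u
      = of_nat CARD('p) powi l * (of_nat CARD('p) ^ Suc d * to_fract a)"
    using assms(1) by (simp only: mult.assoc)
  then have "to_fract u = of_nat CARD('p) ^ Suc d * to_fract a"
    by (subst (asm) mult_left_cancel) auto
  also have "\<dots> = to_fract (of_nat CARD('p) ^ Suc d * a)"
    by (simp only: to_fract_mult to_fract_power to_fract_of_nat)
  finally have "u = of_nat CARD('p) ^ Suc d * a" by (simp only: to_fract_eq_iff)
  then have "of_nat CARD('p) dvd u" by simp
  then show False using assms(2) padic_int_unit_iff by blast
qed

lemma pval_eqI:
  assumes "x = of_nat CARD('p) powi k * to_fract u" "u dvd 1"
  shows "pval (x :: 'p::prime_card padic) = k"
  unfolding pval_def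
proof (rule the_equality)
  show "\<exists>u. u dvd 1 \<and> x = of_nat CARD('p) powi k * to_fract u" using assms by blast
  fix l assume "\<exists>u. u dvd 1 \<and> x = of_nat CARD('p) powi l * to_fract u"
  then show "l = k" using padic_decompose_unique assms by (metis order_antisym)
qed

lemma pval_decompose:
  fixes x :: "'p::prime_card padic"
  assumes "x \<noteq> 0"
  obtains u where "u dvd 1" "x = of_nat CARD('p) powi (pval x) * to_fract u"
  using padic_decompose[OF assms] pval_eqI by metis

lemma padic_ideal_iff: "x \<in> padic_ideal k \<longleftrightarrow> x = 0 \<or> k \<le> pval x"
  for x :: "'p::prime_card padic"
proof (cases "x = 0")
  case True
  then show ?thesis unfolding padic_ideal_def by (auto intro: range_eqI[of _ _ 0])
next
  case False
  then obtain u where u: "u dvd 1" "x = of_nat CARD('p) powi (pval x) * to_fract u"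
    by (rule pval_decompose)
  show ?thesis
  proof
    assume "x \<in> padic_ideal k"
    then obtain a where "x = of_nat CARD('p) powi k * to_fract a" by (auto simp: padic_ideal_def)
    then show "x = 0 \<or> k \<le> pval x" using padic_decompose_unique u by metis
  next
    assume "x = 0 \<or> k \<le> pval x"
    then obtain d where "pval x = k + int d" using False zle_iff_zadd by blast
    then have "x = of_nat CARD('p) powi k * to_fract (of_nat CARD('p) ^ d * u)"
      using u(2) by (simp add: power_int_add to_fract_power to_fract_of_nat mult.assoc)
    then show "x \<in> padic_ideal k" unfolding padic_ideal_def by blast
  qed
qed

lemma padic_ideal_add: "x \<in> padic_ideal k \<Longrightarrow> y \<in> padic_ideal k \<Longrightarrow> x + y \<in> padic_ideal k"
  for x y :: "'p::prime_card padic"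
proof -
  assume "x \<in> padic_ideal k" "y \<in> padic_ideal k"
  then obtain a b where "x = of_nat CARD('p) powi k * to_fract a" "y = of_nat CARD('p) powi k * to_fract b"
    by (auto simp: padic_ideal_def)
  then have "x + y = of_nat CARD('p) powi k * to_fract (a + b)"
    by (simp add: distrib_left)
  then show ?thesis unfolding padic_ideal_def by blast
qed

lemma padic_ideal_0 [simp]: "0 \<in> padic_ideal k"
  by (simp add: padic_ideal_iff)

lemma padic_ideal_mult:
  "x \<in> padic_ideal j \<Longrightarrow> y \<in> padic_ideal k \<Longrightarrow> x * y \<in> padic_ideal (j + k)"
  for x :: "'p::prime_card padic"
proof -
  assume "x \<in> padic_ideal j" "y \<in> padic_ideal k"
  then obtain a b where "x = of_nat CARD('p) powi j * to_fract a" "y = of_nat CARD('p) powi k * to_fract b"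
    by (auto simp: padic_ideal_def)
  then have "x * y = of_nat CARD('p) powi (j + k) * to_fract (a * b)"
    by (simp add: power_int_add)
  then show ?thesis unfolding padic_ideal_def by blast
qed

lemma to_fract_in_padic_ideal [simp]: "to_fract a \<in> padic_ideal 0"
  by (auto simp: padic_ideal_def)

lemma padic_ideal_antimono: "x \<in> padic_ideal j \<Longrightarrow> k \<le> j \<Longrightarrow> x \<in> padic_ideal k"
  by (auto simp: padic_ideal_iff)

lemma pval_mult: "x \<noteq> 0 \<Longrightarrow> y \<noteq> 0 \<Longrightarrow> pval (x * y) = pval x + pval y"
  for x y :: "'p::prime_card padic"
proof -
  assume "x \<noteq> 0" "y \<noteq> 0"
  then obtain u w where u: "u dvd 1" "x = of_nat CARD('p) powi (pval x) * to_fract u"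
    and w: "w dvd 1" "y = of_nat CARD('p) powi (pval y) * to_fract w"
    by (metis pval_decompose)
  have "x * y = (of_nat CARD('p) powi (pval x) * to_fract u) * (of_nat CARD('p) powi (pval y) * to_fract w)"
    using u(2) w(2) by simp
  also have "\<dots> = of_nat CARD('p) powi (pval x + pval y) * to_fract (u * w)"
    by (simp add: power_int_add)
  finally show ?thesis
    by (rule pval_eqI) (use u(1) w(1) in \<open>simp add: is_unit_mult_iff\<close>)
qed

lemma pval_1 [simp]: "pval 1 = 0"
  by (rule pval_eqI[of _ _ 1]) auto

lemma pval_power_int_prime [simp]: "pval (of_nat CARD('p) powi k :: 'p::prime_card padic) = k"
  by (rule pval_eqI[of _ _ 1]) auto

lemma pval_power: "x \<noteq> 0 \<Longrightarrow> pval (x ^ n) = int n * pval x"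
  by (induction n) (auto simp: pval_mult algebra_simps)

lemma padic_val_eq: "x \<noteq> 0 \<Longrightarrow> padic_val x = ereal (of_int (pval x))"
  for x :: "'p::prime_card padic"
proof -
  assume "x \<noteq> 0"
  have "(\<exists>a. x = of_nat CARD('p) powi k * to_fract a) \<longleftrightarrow> k \<le> pval x" for k
    using padic_ideal_iff[of x k] \<open>x \<noteq> 0\<close> unfolding padic_ideal_def by blast
  then have "(GREATEST k. \<exists>a. x = of_nat CARD('p) powi k * to_fract a) = pval x"
    by (intro Greatest_equality) auto
  then show ?thesis using \<open>x \<noteq> 0\<close> by (simp add: padic_val_def)
qed

text \<open>Makes the description in \<open>fractional_ideal_val\<close> unambiguous; the powers of
  p themselves distinguish the ideals.\<close>

lemma inj_padic_ideal: "padic_ideal j = (padic_ideal k :: 'p::prime_card padic set) \<longleftrightarrow> j = k"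
proof
  assume *: "padic_ideal j = (padic_ideal k :: 'p padic set)"
  have "(of_nat CARD('p) powi j :: 'p padic) \<in> padic_ideal j"
       "(of_nat CARD('p) powi k :: 'p padic) \<in> padic_ideal k"
    by (simp_all add: padic_ideal_iff)
  then have "(of_nat CARD('p) powi j :: 'p padic) \<in> padic_ideal k"
       "(of_nat CARD('p) powi k :: 'p padic) \<in> padic_ideal j"
    using * by auto
  then show "j = k" by (simp add: padic_ideal_iff)
qed auto

lemma fractional_ideal_val_padic_ideal: "fractional_ideal_val (padic_ideal k :: 'p::prime_card padic set) = k"
  unfolding fractional_ideal_val_def padic_ideal_def[symmetric] inj_padic_ideal by simp

subsection \<open>Lattices in a finite Galois extension\<close>

text \<open>Merges constants found separately for each basis vector or each automorphism into a
  single one.\<close>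

lemma finite_uniform_bound:
  fixes P :: "'a \<Rightarrow> int \<Rightarrow> bool"
  assumes "finite S" "\<And>x. x \<in> S \<Longrightarrow> \<exists>C. P x C"
    and mono: "\<And>x C D. P x C \<Longrightarrow> C \<le> D \<Longrightarrow> P x D"
  obtains C where "\<And>x. x \<in> S \<Longrightarrow> P x C"
proof -
  from assms(2) obtain c where c: "\<And>x. x \<in> S \<Longrightarrow> P x (c x)" by metis
  show ?thesis
  proof
    fix x assume "x \<in> S"
    then show "P x (Max (c ` S))" using c assms(1) by (intro mono[OF c]) auto
  qed
qed

locale padic_galois_extension =
  fixes \<iota> :: "'p::prime_card padic \<Rightarrow> 'k::field"
  assumes galois: "finite_galois_extension \<iota>"
begin

lemma field_hom_emb: "field_hom \<iota>"
  using galois by (simp add: finite_galois_extension_def finite_extension_def)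

sublocale emb: field_hom \<iota> by (rule field_hom_emb)

sublocale vs: vector_space "\<lambda>a x. \<iota> a * x"
  by unfold_locales (simp_all add: algebra_simps emb.hom_add emb.hom_mult)

lemma emb_eq_iff [simp]: "\<iota> a = \<iota> b \<longleftrightarrow> a = b"
  by (metis emb.hom_minus emb.hom_0_iff right_minus_eq)

lemma emb_power_int: "\<iota> (x powi k) = \<iota> x powi k"
  by (cases "k \<ge> 0") (simp_all add: power_int_def emb.hom_power emb.hom_inverse)

lemma of_nat_prime_nonzero [simp]: "of_nat CARD('p) \<noteq> (0 :: 'k)"
proof -
  have "\<iota> (of_nat CARD('p)) \<noteq> 0" by (simp del: emb.hom_of_nat)
  then show ?thesis by (simp add: emb.hom_of_nat)
qed

lemma ex_basis: "\<exists>B. finite B \<and> vs.independent B \<and> vs.span B = UNIV"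
proof -
  obtain A :: "'k set" where A: "finite A" "vs.span A = UNIV"
    using galois by (auto simp: finite_galois_extension_def finite_extension_def)
  obtain B where B: "B \<subseteq> A" "vs.independent B" "A \<subseteq> vs.span B"
    using vs.maximal_independent_subset[of A] by blast
  have "vs.span A \<subseteq> vs.span B" using B(3) by (intro vs.span_minimal vs.subspace_span)
  then have "vs.span B = UNIV" using A(2) by auto
  moreover have "finite B" using A(1) B(1) finite_subset by blast
  ultimately show ?thesis using B(2) by blast
qed

definition basis :: "'k set" where
  "basis = (SOME B. finite B \<and> vs.independent B \<and> vs.span B = UNIV)"

lemma basis: "finite basis" "vs.independent basis" "vs.span basis = UNIV"
  using someI_ex[OF ex_basis] unfolding basis_def by auto

definition coord :: "'k \<Rightarrow> 'k \<Rightarrow> 'p padic" where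
  "coord x b = vs.representation basis x b"

lemma coord_add: "coord (x + y) b = coord x b + coord y b"
  by (simp add: coord_def vs.representation_add basis)

lemma coord_diff: "coord (x - y) b = coord x b - coord y b"
  by (simp add: coord_def vs.representation_diff basis)

lemma coord_scale: "coord (\<iota> a * x) b = a * coord x b"
  by (simp add: coord_def vs.representation_scale basis)

lemma coord_0 [simp]: "coord 0 b = 0"
  using coord_diff[of 0 0] by simp

lemma coord_sum: "coord (sum f A) b = (\<Sum>i\<in>A. coord (f i) b)"
  by (simp add: coord_def vs.representation_sum basis)

lemma coord_basis: "b \<in> basis \<Longrightarrow> coord b c = (if c = b then 1 else 0)"
  by (simp add: coord_def vs.representation_basis basis)

lemma sum_coord: "(\<Sum>b\<in>basis. \<iota> (coord x b) * b) = x"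
  unfolding coord_def by (rule vs.sum_representation_eq) (auto simp: basis)

lemma coord_sum_basis: "b \<in> basis \<Longrightarrow> coord (\<Sum>c\<in>basis. \<iota> (f c) * c) b = f b"
  by (simp add: coord_sum coord_scale coord_basis basis if_distrib[of "\<lambda>x. _ * x"] cong: if_cong)

lemma basis_nonzero: "b \<in> basis \<Longrightarrow> b \<noteq> 0"
  using basis(2) vs.dependent_zero by blast

text \<open>\<open>p ^ k\<close> times the \<open>\<int>\<^sub>p\<close>-span of the basis. This
  filtration replaces a norm on \<open>K\<close> until the valuation exists. It need not respect
  products or automorphisms, hence the error constants \<open>C\<close> below.\<close>

definition zlattice :: "int \<Rightarrow> 'k set" where
  "zlattice k = {x. \<forall>b\<in>basis. coord x b \<in> padic_ideal k}"

lemma lattice_0 [simp]: "0 \<in> zlattice k"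
  by (simp add: zlattice_def)

lemma lattice_add: "x \<in> zlattice k \<Longrightarrow> y \<in> zlattice k \<Longrightarrow> x + y \<in> zlattice k"
  by (simp add: zlattice_def coord_add padic_ideal_add)

lemma lattice_antimono: "x \<in> zlattice j \<Longrightarrow> k \<le> j \<Longrightarrow> x \<in> zlattice k"
  unfolding zlattice_def using padic_ideal_antimono by blast

lemma lattice_scale: "a \<in> padic_ideal j \<Longrightarrow> x \<in> zlattice k \<Longrightarrow> \<iota> a * x \<in> zlattice (j + k)"
  by (simp add: zlattice_def coord_scale padic_ideal_mult)

lemma lattice_scale_nat: "x \<in> zlattice k \<Longrightarrow> of_nat n * x \<in> zlattice k"
  by (induction n) (auto simp: distrib_right lattice_add)

lemma lattice_uminus: "x \<in> zlattice k \<Longrightarrow> - x \<in> zlattice k"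
  using lattice_scale[of "-1" 0 x k] to_fract_in_padic_ideal[of "-1"]
  by (simp add: emb.hom_uminus)

lemma lattice_diff: "x \<in> zlattice k \<Longrightarrow> y \<in> zlattice k \<Longrightarrow> x - y \<in> zlattice k"
  using lattice_add[of x k "- y"] lattice_uminus[of y k] by simp

lemma lattice_sum: "(\<And>i. i \<in> A \<Longrightarrow> f i \<in> zlattice k) \<Longrightarrow> sum f A \<in> zlattice k"
  by (induction A rule: infinite_finite_induct) (auto intro: lattice_add)

lemma lattice_prime_power:
  "x \<in> zlattice k \<Longrightarrow> of_nat CARD('p) powi j * x \<in> zlattice (j + k)"
  using lattice_scale[of "of_nat CARD('p) powi j" j x k]
  by (simp add: padic_ideal_iff emb_power_int emb.hom_of_nat)

lemma lattice_prime_power_iff: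
  "of_nat CARD('p) powi j * x \<in> zlattice (j + k) \<longleftrightarrow> x \<in> zlattice k"
proof
  assume "of_nat CARD('p) powi j * x \<in> zlattice (j + k)"
  from lattice_prime_power[OF this, of "-j"] show "x \<in> zlattice k"
    by (simp add: power_int_minus mult.assoc[symmetric])
qed (rule lattice_prime_power)

lemma lattice_order:
  assumes "x \<noteq> 0"
  obtains k where "x \<in> zlattice k" "x \<notin> zlattice (k + 1)"
proof -
  define S where "S = {b \<in> basis. coord x b \<noteq> 0}"
  have S: "finite S" unfolding S_def using basis by auto
  have "S \<noteq> {}"
  proof
    assume "S = {}"
    then have "(\<Sum>b\<in>basis. \<iota> (coord x b) * b) = 0" by (intro sum.neutral) (auto simp: S_def)
    then show False using assms sum_coord by simp
  qed
  \<comment> \<open>The level of \<open>x\<close> is the least valuation among its nonzero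
    coordinates.\<close>
  define m where "m = Min ((\<lambda>b. pval (coord x b)) ` S)"
  have m: "m \<le> pval (coord x b)" if "b \<in> S" for b using that S by (simp add: m_def)
  have "m \<in> (\<lambda>b. pval (coord x b)) ` S" unfolding m_def using S \<open>S \<noteq> {}\<close> by (intro Min_in) auto
  then obtain c where c: "c \<in> S" "m = pval (coord x c)" by auto
  show ?thesis
  proof
    show "x \<in> zlattice m" using m by (auto simp: zlattice_def padic_ideal_iff S_def)
    show "x \<notin> zlattice (m + 1)" using c by (auto simp: zlattice_def padic_ideal_iff S_def)
  qed
qed

lemma ex_lattice: "\<exists>k. x \<in> zlattice k"
  by (cases "x = 0") (auto elim: lattice_order)

lemma lattice_order_less: "x \<in> zlattice j \<Longrightarrow> x \<notin> zlattice (k + 1) \<Longrightarrow> j \<le> k"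
  using lattice_antimono[of x j "k + 1"] by force

text \<open>Linear maps are continuous: the finitely many images of basis vectors lie in one common
  \<open>zlattice (- C)\<close>, and this loss carries over to all linear combinations.\<close>

lemma lattice_linear_bound:
  assumes add: "\<And>x y. T (x + y) = T x + T y" and scale: "\<And>a x. T (\<iota> a * x) = \<iota> a * T x"
  obtains C where "\<And>k x. x \<in> zlattice k \<Longrightarrow> T x \<in> zlattice (k - C)"
proof -
  obtain C where C: "\<And>b. b \<in> basis \<Longrightarrow> T b \<in> zlattice (- C)"
  proof (rule finite_uniform_bound[OF basis(1), where P="\<lambda>b C. T b \<in> zlattice (- C)"])
    show "\<exists>C. T b \<in> zlattice (- C)" for b using ex_lattice[of "T b"] by (metis minus_minus)
    show "T b \<in> zlattice (- C) \<Longrightarrow> C \<le> D \<Longrightarrow> T b \<in> zlattice (- D)" for b C D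
      using lattice_antimono by simp
  qed auto
  have T0: "T 0 = 0" using scale[of 0 0] by simp
  have T_sum: "T (sum f A) = (\<Sum>i\<in>A. T (f i))" for f and A :: "'k set"
    by (induction A rule: infinite_finite_induct) (auto simp: add T0)
  show ?thesis
  proof
    fix k x assume x: "x \<in> zlattice k"
    have "T x = T (\<Sum>b\<in>basis. \<iota> (coord x b) * b)" by (simp only: sum_coord)
    also have "\<dots> = (\<Sum>b\<in>basis. \<iota> (coord x b) * T b)" by (simp add: T_sum scale)
    also have "\<dots> \<in> zlattice (k - C)"
      using lattice_scale[of _ k _ "- C"] C x by (intro lattice_sum) (auto simp: zlattice_def)
    finally show "T x \<in> zlattice (k - C)" .
  qed
qed

text \<open>Multiplication by each single basis vector is linear; a common bound for these maps
  bounds the bilinear product.\<close>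

lemma lattice_mult_bound:
  obtains C where "\<And>j k x y. x \<in> zlattice j \<Longrightarrow> y \<in> zlattice k \<Longrightarrow> x * y \<in> zlattice (j + k - C)"
proof -
  let ?P = "\<lambda>b C. \<forall>k. \<forall>y\<in>zlattice k. b * y \<in> zlattice (k - C)"
  obtain C where C: "\<And>b. b \<in> basis \<Longrightarrow> ?P b C"
  proof (rule finite_uniform_bound[OF basis(1), where P="?P"])
    show "\<exists>C. ?P b C" for b
      by (rule lattice_linear_bound[of "\<lambda>y. b * y"]) (auto simp: algebra_simps)
    show "?P b C \<Longrightarrow> C \<le> D \<Longrightarrow> ?P b D" for b C D
      using lattice_antimono by (meson diff_left_mono)
  qed auto
  show ?thesis
  proof
    fix j k x y assume x: "x \<in> zlattice j" and y: "y \<in> zlattice k"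
    have "x * y = (\<Sum>b\<in>basis. \<iota> (coord x b) * b) * y" by (simp only: sum_coord)
    also have "\<dots> = (\<Sum>b\<in>basis. \<iota> (coord x b) * (b * y))"
      by (simp add: sum_distrib_right mult.assoc)
    also have "\<dots> \<in> zlattice (j + k - C)"
    proof (rule lattice_sum)
      fix b assume "b \<in> basis"
      then have "\<iota> (coord x b) * (b * y) \<in> zlattice (j + (k - C))"
        using C x y by (intro lattice_scale) (auto simp: zlattice_def)
      then show "\<iota> (coord x b) * (b * y) \<in> zlattice (j + k - C)" by (simp add: algebra_simps)
    qed
    finally show "x * y \<in> zlattice (j + k - C)" .
  qed
qed

text \<open>Since \<open>\<iota> a = \<iota> a * 1\<close>, everything is read off from the
  coordinates of 1: a nonzero coordinate recovers \<open>a\<close> from \<open>\<iota> a\<close>,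
  and the level of 1 controls the other direction.\<close>

lemma lattice_emb_bound:
  obtains C where "\<And>k a. \<iota> a \<in> zlattice k \<Longrightarrow> a \<in> padic_ideal (k - C)"
    "\<And>k a. a \<in> padic_ideal k \<Longrightarrow> \<iota> a \<in> zlattice (k - C)"
proof -
  obtain m where m: "1 \<in> zlattice m" "1 \<notin> zlattice (m + 1)" using lattice_order[of 1] by auto
  from m(2) obtain c where c: "c \<in> basis" "coord 1 c \<noteq> 0" 
    by (auto simp: zlattice_def padic_ideal_iff)
  define C where "C = max (- m) (pval (coord 1 c))"
  show ?thesis
  proof
    fix k a assume "\<iota> a \<in> zlattice k"
    then have "coord (\<iota> a * 1) c \<in> padic_ideal k" using c(1) by (simp add: zlattice_def)
    then have "a * coord 1 c \<in> padic_ideal k" by (simp only: coord_scale)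
    then show "a \<in> padic_ideal (k - C)"
      using c(2) by (cases "a = 0") (auto simp: padic_ideal_iff pval_mult C_def)
  next
    fix k and a :: "'p padic" assume "a \<in> padic_ideal k"
    then have "\<iota> a * 1 \<in> zlattice (k + m)" using m(1) by (rule lattice_scale)
    then show "\<iota> a \<in> zlattice (k - C)" using lattice_antimono[of "\<iota> a" "k + m" "k - C"] by (simp add: C_def)
  qed
qed

lemma lattice_seq_compact:
  fixes X :: "nat \<Rightarrow> 'k"
  assumes "\<And>n. X n \<in> zlattice 0"
  obtains x r where "strict_mono r" "\<And>k. X (r k) - x \<in> zlattice (int k)"
proof -
  define Y where "Y n b = (SOME a. coord (X n) b = to_fract a)" for n :: nat and b
  have Y: "coord (X n) b = to_fract (Y n b)" if "b \<in> basis" for n b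
    unfolding Y_def using assms[of n] that
    by (intro someI_ex[of "\<lambda>a. coord (X n) b = to_fract a"]) (auto simp: zlattice_def padic_ideal_def)
  obtain r c where r: "strict_mono r"
    "\<And>k b. b \<in> basis \<Longrightarrow> of_nat CARD('p) ^ k dvd Y (r k) b - c b"
    using padic_int_seq_compact[OF basis(1), of Y] by metis
  define x where "x = (\<Sum>b\<in>basis. \<iota> (to_fract (c b)) * b)"
  have "X (r k) - x \<in> zlattice (int k)" for k
    unfolding zlattice_def
  proof (intro CollectI ballI)
    fix b assume b: "b \<in> basis"
    obtain a where a: "Y (r k) b - c b = of_nat CARD('p) ^ k * a" using r(2)[OF b] by (metis dvdE)
    have "coord (X (r k) - x) b = to_fract (Y (r k) b - c b)"
      using b by (simp add: coord_diff Y x_def coord_sum_basis)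
    also have "\<dots> = of_nat CARD('p) powi (int k) * to_fract a"
      unfolding a by (simp add: to_fract_power to_fract_of_nat)
    finally show "coord (X (r k) - x) b \<in> padic_ideal (int k)" unfolding padic_ideal_def by blast
  qed
  then show ?thesis using that r(1) by blast
qed


subsection \<open>The Galois group and the norm\<close>

abbreviation "aut \<equiv> automorphisms_over \<iota>"

lemma autD:
  assumes "\<sigma> \<in> aut"
  shows "field_hom \<sigma>" "bij \<sigma>" "\<sigma> (\<iota> a) = \<iota> a"
  using assms by (auto simp: automorphisms_over_def)

lemma aut_simps:
  assumes "\<sigma> \<in> aut"
  shows "\<sigma> (x + y) = \<sigma> x + \<sigma> y" "\<sigma> (x - y) = \<sigma> x - \<sigma> y" "\<sigma> (x * y) = \<sigma> x * \<sigma> y" "\<sigma> 0 = 0" "\<sigma> 1 = 1"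
    "\<sigma> (x ^ n) = \<sigma> x ^ n" "\<sigma> (sum f A) = (\<Sum>a\<in>A. \<sigma> (f a))" "\<sigma> (prod f A) = (\<Prod>a\<in>A. \<sigma> (f a))"
    "\<sigma> x = 0 \<longleftrightarrow> x = 0"
proof -
  interpret field_hom \<sigma> using assms by (rule autD)
  show "\<sigma> (x + y) = \<sigma> x + \<sigma> y" "\<sigma> (x - y) = \<sigma> x - \<sigma> y" "\<sigma> (x * y) = \<sigma> x * \<sigma> y" "\<sigma> 0 = 0" "\<sigma> 1 = 1"
    "\<sigma> (x ^ n) = \<sigma> x ^ n" "\<sigma> (sum f A) = (\<Sum>a\<in>A. \<sigma> (f a))" "\<sigma> (prod f A) = (\<Prod>a\<in>A. \<sigma> (f a))"
    "\<sigma> x = 0 \<longleftrightarrow> x = 0"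
    by (simp_all add: hom_distribs)
qed

lemma id_in_aut: "id \<in> aut"
proof -
  have "field_hom (id :: 'k \<Rightarrow> 'k)" by unfold_locales simp_all
  then show ?thesis by (simp add: automorphisms_over_def)
qed

lemma comp_in_aut: "\<sigma> \<in> aut \<Longrightarrow> \<tau> \<in> aut \<Longrightarrow> \<sigma> \<circ> \<tau> \<in> aut"
  unfolding automorphisms_over_def
proof (intro CollectI conjI; clarsimp)
  assume "field_hom \<sigma>" "field_hom \<tau>"
  then interpret s: field_hom \<sigma> + t: field_hom \<tau> .
  show "field_hom (\<sigma> \<circ> \<tau>)"
    by unfold_locales (auto simp: hom_distribs)
qed (auto simp: bij_comp)

lemma inv_in_aut: "\<sigma> \<in> aut \<Longrightarrow> inv_into UNIV \<sigma> \<in> aut"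
proof -
  assume s: "\<sigma> \<in> aut"
  then have b: "bij \<sigma>" by (rule autD)
  then have inv1: "\<sigma> (inv_into UNIV \<sigma> x) = x" and inv2: "inv_into UNIV \<sigma> (\<sigma> x) = x" for x
    by (simp_all add: bij_is_surj surj_f_inv_f bij_is_inj)
  have e: "inv_into UNIV \<sigma> x = y \<longleftrightarrow> x = \<sigma> y" for x y using inv1 inv2 by metis
  have "field_hom (inv_into UNIV \<sigma>)"
    by unfold_locales (simp_all add: e aut_simps[OF s] inv1)
  then show ?thesis
    using b autD(3)[OF s] by (auto simp: automorphisms_over_def bij_imp_bij_inv e)
qed

lemma bij_betw_comp_aut: "\<tau> \<in> aut \<Longrightarrow> bij_betw (\<lambda>\<sigma>. \<tau> \<circ> \<sigma>) aut aut"
proof (rule bij_betw_byWitness[where f'="\<lambda>\<sigma>. inv_into UNIV \<tau> \<circ> \<sigma>"])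
  assume t: "\<tau> \<in> aut"
  then have b: "bij \<tau>" by (rule autD)
  show "\<forall>\<sigma>\<in>aut. inv_into UNIV \<tau> \<circ> (\<tau> \<circ> \<sigma>) = \<sigma>" using b by (auto simp: o_assoc[symmetric] bij_is_inj fun_eq_iff)
  show "\<forall>\<sigma>\<in>aut. \<tau> \<circ> (inv_into UNIV \<tau> \<circ> \<sigma>) = \<sigma>" using b by (auto simp: fun_eq_iff bij_is_surj surj_f_inv_f)
qed (auto intro: comp_in_aut inv_in_aut)

text \<open>If no power of \<open>x\<close> lay in the span of the lower ones, the powers would give
  independent sets larger than the basis. The polynomial is the resulting monic relation.\<close>

lemma algebraic:
  obtains f :: "'p padic poly" where "f \<noteq> 0" "poly (map_poly \<iota> f) x = 0"
proof -
  interpret mp: map_poly_comm_ring_hom \<iota> ..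
  define S where "S i = (\<lambda>j. x ^ j) ` {..<i}" for i :: nat
  have "\<exists>i. x ^ i \<in> vs.span (S i)"
  proof (rule ccontr)
    assume *: "\<not> (\<exists>i. x ^ i \<in> vs.span (S i))"
    have S: "vs.independent (S i) \<and> finite (S i) \<and> card (S i) = i" for i
    proof (induction i)
      case 0
      then show ?case by (simp add: S_def vs.independent_empty)
    next
      case (Suc i)
      have "S (Suc i) = insert (x ^ i) (S i)" by (auto simp: S_def lessThan_Suc)
      moreover have "x ^ i \<notin> S i" using * vs.span_base by blast
      ultimately show ?case using Suc * vs.independent_insertI by auto
    qed
    then show False
      using vs.independent_span_bound[OF basis(1), of "S (Suc (card basis))"] basis by auto
  qed
  then obtain i where i: "x ^ i \<in> vs.span (S i)" by blast
  have "\<exists>g. (\<forall>k\<ge>i. coeff g k = 0) \<and> y = poly (map_poly \<iota> g) x" if "y \<in> vs.span (S i)" for y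
    using that
  proof (induction rule: vs.span_induct_alt)
    case base
    then show ?case by (intro exI[of _ 0]) auto
  next
    case (step c z y)
    from step.IH obtain g where g: "\<forall>k\<ge>i. coeff g k = 0" "y = poly (map_poly \<iota> g) x" by blast
    from step.hyps obtain j where j: "j < i" "z = x ^ j" by (auto simp: S_def)
    show ?case
      by (rule exI[of _ "monom c j + g"])
         (use j g in \<open>auto simp: mp.hom_add map_poly_monom poly_monom\<close>)
  qed
  from this[OF i] obtain g where g: "\<forall>k\<ge>i. coeff g k = 0" "x ^ i = poly (map_poly \<iota> g) x" by blast
  show ?thesis
  proof
    have "coeff (monom 1 i - g) i = 1" using g by simp
    then show "monom 1 i - g \<noteq> 0" by (metis coeff_0 zero_neq_one)
    show "poly (map_poly \<iota> (monom 1 i - g)) x = 0"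
      using g by (simp add: mp.hom_minus map_poly_monom poly_monom)
  qed
qed

text \<open>By linearity an automorphism is determined by its values on the basis, and each value is
  one of the finitely many roots of a polynomial over \<open>\<rat>\<^sub>p\<close> that annihilates
  the basis vector.\<close>

lemma finite_aut: "finite aut"
proof -
  interpret mp: map_poly_inj_idom_hom \<iota> ..
  define f where "f x = (SOME f. f \<noteq> 0 \<and> poly (map_poly \<iota> f) x = 0)" for x
  have f: "f x \<noteq> 0" "poly (map_poly \<iota> (f x)) x = 0" for x
  proof -
    have "\<exists>f. f \<noteq> 0 \<and> poly (map_poly \<iota> f) x = 0" by (rule algebraic[of x]) blast
    from someI_ex[OF this] show "f x \<noteq> 0" "poly (map_poly \<iota> (f x)) x = 0" by (auto simp: f_def)
  qed
  have root: "poly (map_poly \<iota> (f x)) (\<sigma> x) = 0" if "\<sigma> \<in> aut" for \<sigma> x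
  proof -
    interpret s: field_hom \<sigma> using that by (rule autD)
    have "map_poly \<sigma> (map_poly \<iota> (f x)) = map_poly \<iota> (f x)"
      using autD(3)[OF that] by (simp add: poly_eq_iff coeff_map_poly)
    then show ?thesis using s.poly_map_poly[of "map_poly \<iota> (f x)" x] f by simp
  qed
  let ?R = "\<lambda>b. {y. poly (map_poly \<iota> (f b)) y = 0}"
  have "finite (?R b)" for b using f(1)[of b] by (intro poly_roots_finite) simp
  then have "finite (\<Pi>\<^sub>E b\<in>basis. ?R b)" using basis(1) by (intro finite_PiE) auto
  moreover have "(\<lambda>\<sigma>. restrict \<sigma> basis) ` aut \<subseteq> (\<Pi>\<^sub>E b\<in>basis. ?R b)" using root by auto
  moreover have "inj_on (\<lambda>\<sigma>. restrict \<sigma> basis) aut"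
  proof (rule inj_onI, rule ext)
    fix \<sigma> \<tau> x assume st: "\<sigma> \<in> aut" "\<tau> \<in> aut" "restrict \<sigma> basis = restrict \<tau> basis"
    then have "\<sigma> b = \<tau> b" if "b \<in> basis" for b using that by (metis restrict_apply')
    moreover have "\<rho> x = (\<Sum>b\<in>basis. \<iota> (coord x b) * \<rho> b)" if "\<rho> \<in> aut" for \<rho>
      using arg_cong[OF sum_coord[of x], of \<rho>] autD(3)[OF that] by (simp add: aut_simps[OF that])
    ultimately show "\<sigma> x = \<tau> x" using st(1,2) by (metis (no_types, lifting) sum.cong)
  qed
  ultimately show ?thesis by (metis finite_imageD finite_subset)
qed

lemma card_aut_pos: "card aut > 0"
  using finite_aut id_in_aut card_gt_0_iff by blast

section \<open>Descent of products and sums of conjugates; the norm\<close>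

lemma aut_fixed: "(\<And>\<sigma>. \<sigma> \<in> aut \<Longrightarrow> \<sigma> x = x) \<Longrightarrow> x \<in> range \<iota>"
  using galois by (auto simp: finite_galois_extension_def)

lemma prod_aut_in_range: "(\<Prod>\<sigma>\<in>aut. \<sigma> x) \<in> range \<iota>"
proof (rule aut_fixed)
  fix \<tau> assume t: "\<tau> \<in> aut"
  have "\<tau> (\<Prod>\<sigma>\<in>aut. \<sigma> x) = (\<Prod>\<sigma>\<in>aut. (\<tau> \<circ> \<sigma>) x)" by (simp add: aut_simps[OF t])
  also have "\<dots> = (\<Prod>\<sigma>\<in>aut. \<sigma> x)"
    by (rule prod.reindex_bij_betw[OF bij_betw_comp_aut[OF t]])
  finally show "\<tau> (\<Prod>\<sigma>\<in>aut. \<sigma> x) = (\<Prod>\<sigma>\<in>aut. \<sigma> x)" .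
qed

lemma sum_aut_in_range: "(\<Sum>\<sigma>\<in>aut. \<sigma> x) \<in> range \<iota>"
proof (rule aut_fixed)
  fix \<tau> assume t: "\<tau> \<in> aut"
  have "\<tau> (\<Sum>\<sigma>\<in>aut. \<sigma> x) = (\<Sum>\<sigma>\<in>aut. (\<tau> \<circ> \<sigma>) x)" by (simp add: aut_simps[OF t])
  also have "\<dots> = (\<Sum>\<sigma>\<in>aut. \<sigma> x)"
    by (rule sum.reindex_bij_betw[OF bij_betw_comp_aut[OF t]])
  finally show "\<tau> (\<Sum>\<sigma>\<in>aut. \<sigma> x) = (\<Sum>\<sigma>\<in>aut. \<sigma> x)" .
qed

text \<open>The valuation of the norm from \<open>K\<close> to \<open>\<rat>\<^sub>p\<close>.
  Pulling back along \<open>\<iota>\<close> is legitimate by \<open>prod_aut_in_range\<close>; the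
  value is meaningful for nonzero \<open>x\<close> only.\<close>

definition norm_val :: "'k \<Rightarrow> int" where
  "norm_val x = pval (inv_into UNIV \<iota> (\<Prod>\<sigma>\<in>aut. \<sigma> x))"

lemma norm_val_eq: "(\<Prod>\<sigma>\<in>aut. \<sigma> x) = \<iota> a \<Longrightarrow> norm_val x = pval a"
  unfolding norm_val_def by (simp add: inj_def inv_f_eq)

lemma norm_obtain:
  obtains a where "(\<Prod>\<sigma>\<in>aut. \<sigma> x) = \<iota> a" "norm_val x = pval a" "a = 0 \<longleftrightarrow> x = 0"
proof -
  obtain a where a: "(\<Prod>\<sigma>\<in>aut. \<sigma> x) = \<iota> a" using prod_aut_in_range by blast
  have "\<iota> a = 0 \<longleftrightarrow> x = 0" unfolding a[symmetric]
    using aut_simps(9) id_in_aut finite_aut by (auto simp: prod_zero_iff)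
  then show ?thesis using a norm_val_eq that by simp
qed

lemma norm_val_mult: "x \<noteq> 0 \<Longrightarrow> y \<noteq> 0 \<Longrightarrow> norm_val (x * y) = norm_val x + norm_val y"
proof -
  assume xy: "x \<noteq> 0" "y \<noteq> 0"
  obtain a where a: "(\<Prod>\<sigma>\<in>aut. \<sigma> x) = \<iota> a" "norm_val x = pval a" "a = 0 \<longleftrightarrow> x = 0" by (rule norm_obtain)
  obtain b where b: "(\<Prod>\<sigma>\<in>aut. \<sigma> y) = \<iota> b" "norm_val y = pval b" "b = 0 \<longleftrightarrow> y = 0" by (rule norm_obtain)
  have "(\<Prod>\<sigma>\<in>aut. \<sigma> (x * y)) = (\<Prod>\<sigma>\<in>aut. \<sigma> x * \<sigma> y)" by (intro prod.cong) (auto simp: aut_simps)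
  also have "\<dots> = \<iota> (a * b)" by (simp add: prod.distrib a b emb.hom_mult)
  finally show ?thesis using norm_val_eq a b xy by (simp add: pval_mult)
qed

lemma norm_val_emb: "a \<noteq> 0 \<Longrightarrow> norm_val (\<iota> a) = int (card aut) * pval a"
proof -
  assume "a \<noteq> 0"
  have "(\<Prod>\<sigma>\<in>aut. \<sigma> (\<iota> a)) = (\<Prod>\<sigma>\<in>aut. \<iota> a)"
    by (intro prod.cong) (auto simp: autD(3))
  also have "\<dots> = \<iota> (a ^ card aut)" by (simp add: emb.hom_power)
  finally have "(\<Prod>\<sigma>\<in>aut. \<sigma> (\<iota> a)) = \<iota> (a ^ card aut)" .
  then show ?thesis using \<open>a \<noteq> 0\<close> norm_val_eq pval_power by metis
qed

section \<open>Comparison of the norm with the lattice filtration\<close>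

lemma lattice_aut_bound:
  obtains C where "\<And>k x \<sigma>. \<sigma> \<in> aut \<Longrightarrow> x \<in> zlattice k \<Longrightarrow> \<sigma> x \<in> zlattice (k - C)"
proof -
  let ?P = "\<lambda>\<sigma> C. \<forall>k. \<forall>x\<in>zlattice k. \<sigma> x \<in> zlattice (k - C)"
  obtain C where "\<And>\<sigma>. \<sigma> \<in> aut \<Longrightarrow> ?P \<sigma> C"
  proof (rule finite_uniform_bound[OF finite_aut, where P="?P"])
    show "\<exists>C. ?P \<sigma> C" if "\<sigma> \<in> aut" for \<sigma>
      by (rule lattice_linear_bound[of \<sigma>]) (auto simp: aut_simps[OF that] autD(3)[OF that])
    show "?P \<sigma> C \<Longrightarrow> C \<le> D \<Longrightarrow> ?P \<sigma> D" for \<sigma> C D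
      using lattice_antimono by (meson diff_left_mono)
  qed auto
  then show ?thesis using that by blast
qed

text \<open>Each conjugate and each multiplication loses a bounded amount. Induction over subsets
  \<open>S\<close> of the group keeps the slope \<open>card S\<close> exact while only the constant
  grows.\<close>

lemma lattice_prod_aut_bound:
  obtains C where "\<And>k x. x \<in> zlattice k \<Longrightarrow> (\<Prod>\<sigma>\<in>aut. \<sigma> x) \<in> zlattice (int (card aut) * k - C)"
proof -
  obtain C1 where C1: "\<And>k x \<sigma>. \<sigma> \<in> aut \<Longrightarrow> x \<in> zlattice k \<Longrightarrow> \<sigma> x \<in> zlattice (k - C1)"
    by (rule lattice_aut_bound) blast
  obtain C2 where C2: "\<And>j k x y. x \<in> zlattice j \<Longrightarrow> y \<in> zlattice k \<Longrightarrow> x * y \<in> zlattice (j + k - C2)"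
    by (rule lattice_mult_bound) blast
  obtain k1 where k1: "1 \<in> zlattice k1" using ex_lattice by blast
  have "\<exists>C. \<forall>k. \<forall>x\<in>zlattice k. (\<Prod>\<sigma>\<in>S. \<sigma> x) \<in> zlattice (int (card S) * k - C)" if "S \<subseteq> aut" for S
    using finite_subset[OF that finite_aut] that
  proof (induction S rule: finite_induct)
    case empty
    then show ?case using k1 by (intro exI[of _ "- k1"]) auto
  next
    case (insert \<tau> S)
    then obtain C where C: "\<And>k x. x \<in> zlattice k \<Longrightarrow> (\<Prod>\<sigma>\<in>S. \<sigma> x) \<in> zlattice (int (card S) * k - C)" by auto
    show ?case
    proof (intro exI[of _ "C1 + C + C2"] allI ballI)
      fix k x assume x: "x \<in> zlattice k"
      have "\<tau> x * (\<Prod>\<sigma>\<in>S. \<sigma> x) \<in> zlattice ((k - C1) + (int (card S) * k - C) - C2)"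
        using C2[OF C1[OF _ x] C[OF x]] insert by auto
      then show "(\<Prod>\<sigma>\<in>insert \<tau> S. \<sigma> x) \<in> zlattice (int (card (insert \<tau> S)) * k - (C1 + C + C2))"
        using insert by (simp add: algebra_simps)
    qed
  qed
  from this[of aut] show ?thesis using that by blast
qed

lemma norm_val_lower:
  obtains C where "\<And>k x. x \<in> zlattice k \<Longrightarrow> x \<noteq> 0 \<Longrightarrow> int (card aut) * k - C \<le> norm_val x"
proof -
  obtain C where C: "\<And>k x. x \<in> zlattice k \<Longrightarrow> (\<Prod>\<sigma>\<in>aut. \<sigma> x) \<in> zlattice (int (card aut) * k - C)"
    by (rule lattice_prod_aut_bound) blast
  obtain D where D: "\<And>k a. \<iota> a \<in> zlattice k \<Longrightarrow> a \<in> padic_ideal (k - D)"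
    by (rule lattice_emb_bound) blast
  show ?thesis
  proof
    fix k x assume x: "x \<in> zlattice k" "x \<noteq> 0"
    obtain a where a: "(\<Prod>\<sigma>\<in>aut. \<sigma> x) = \<iota> a" "norm_val x = pval a" "a = 0 \<longleftrightarrow> x = 0" by (rule norm_obtain)
    have "a \<in> padic_ideal (int (card aut) * k - C - D)" using D C[OF x(1)] a(1) by simp
    then show "int (card aut) * k - (C + D) \<le> norm_val x" using a x by (simp add: padic_ideal_iff)
  qed
qed

text \<open>Telescoping over the group. One term of each step contains the remaining product itself,
  so a bound \<open>D\<close> for that product is carried through the induction next to the constant
  \<open>C\<close>.\<close>

lemma norm_continuous:
  obtains C where "\<And>j x y. x \<in> zlattice 0 \<Longrightarrow> y \<in> zlattice 0 \<Longrightarrow> x - y \<in> zlattice j \<Longrightarrow>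
    (\<Prod>\<sigma>\<in>aut. \<sigma> x) - (\<Prod>\<sigma>\<in>aut. \<sigma> y) \<in> zlattice (j - C)"
proof -
  obtain C1 where C1: "\<And>k x \<sigma>. \<sigma> \<in> aut \<Longrightarrow> x \<in> zlattice k \<Longrightarrow> \<sigma> x \<in> zlattice (k - C1)"
    by (rule lattice_aut_bound) blast
  obtain C2 where C2: "\<And>j k x y. x \<in> zlattice j \<Longrightarrow> y \<in> zlattice k \<Longrightarrow> x * y \<in> zlattice (j + k - C2)"
    by (rule lattice_mult_bound) blast
  have "\<exists>C D. \<forall>j. \<forall>x\<in>zlattice 0. \<forall>y\<in>zlattice 0. x - y \<in> zlattice j \<longrightarrow>
    (\<Prod>\<sigma>\<in>S. \<sigma> x) - (\<Prod>\<sigma>\<in>S. \<sigma> y) \<in> zlattice (j - C) \<and> (\<Prod>\<sigma>\<in>S. \<sigma> y) \<in> zlattice (- D)" if "S \<subseteq> aut" for S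
    using finite_subset[OF that finite_aut] that
  proof (induction S rule: finite_induct)
    case empty
    obtain k1 where "1 \<in> zlattice k1" using ex_lattice by blast
    then show ?case by - (rule exI[of _ 0], rule exI[of _ "- k1"], auto)
  next
    case (insert \<tau> S)
    then obtain C D where C: "\<And>j x y. x \<in> zlattice 0 \<Longrightarrow> y \<in> zlattice 0 \<Longrightarrow> x - y \<in> zlattice j \<Longrightarrow>
      (\<Prod>\<sigma>\<in>S. \<sigma> x) - (\<Prod>\<sigma>\<in>S. \<sigma> y) \<in> zlattice (j - C) \<and> (\<Prod>\<sigma>\<in>S. \<sigma> y) \<in> zlattice (- D)"
      by (metis insert_subset)
    show ?case
    proof (rule exI[of _ "C1 + max C D + C2"], rule exI[of _ "C1 + D + C2"], intro allI ballI impI conjI)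
      fix j x y assume xy: "x \<in> zlattice 0" "y \<in> zlattice 0" "x - y \<in> zlattice j"
      have t: "\<tau> \<in> aut" using insert by auto
      have 1: "\<tau> x * ((\<Prod>\<sigma>\<in>S. \<sigma> x) - (\<Prod>\<sigma>\<in>S. \<sigma> y)) \<in> zlattice ((0 - C1) + (j - C) - C2)"
        using C2 C1[OF t xy(1)] C[OF xy] by blast
      have 2: "\<tau> (x - y) * (\<Prod>\<sigma>\<in>S. \<sigma> y) \<in> zlattice ((j - C1) + (- D) - C2)"
        using C2 C1[OF t xy(3)] C[OF xy] by blast
      have "(\<Prod>\<sigma>\<in>insert \<tau> S. \<sigma> x) - (\<Prod>\<sigma>\<in>insert \<tau> S. \<sigma> y)
          = \<tau> x * ((\<Prod>\<sigma>\<in>S. \<sigma> x) - (\<Prod>\<sigma>\<in>S. \<sigma> y)) + \<tau> (x - y) * (\<Prod>\<sigma>\<in>S. \<sigma> y)"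
        using insert by (simp add: aut_simps[OF t] algebra_simps)
      also have "\<dots> \<in> zlattice (j - (C1 + max C D + C2))"
        using lattice_antimono[OF 1, of "j - (C1 + max C D + C2)"]
          lattice_antimono[OF 2, of "j - (C1 + max C D + C2)"] by (intro lattice_add) auto
      finally show "(\<Prod>\<sigma>\<in>insert \<tau> S. \<sigma> x) - (\<Prod>\<sigma>\<in>insert \<tau> S. \<sigma> y) \<in> zlattice (j - (C1 + max C D + C2))" .
      have "\<tau> y * (\<Prod>\<sigma>\<in>S. \<sigma> y) \<in> zlattice ((0 - C1) + (- D) - C2)"
        using C2 C1[OF t xy(2)] C[OF xy] by blast
      then show "(\<Prod>\<sigma>\<in>insert \<tau> S. \<sigma> y) \<in> zlattice (- (C1 + D + C2))"
        using insert by (simp add: algebra_simps)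
    qed
  qed
  from this[of aut] show ?thesis using that by blast
qed

text \<open>The norm has no zeros on the compact set \<open>zlattice 0 - zlattice 1\<close>; homogeneity extends the
  resulting bound to all of \<open>K\<close>.\<close>

lemma norm_val_upper:
  obtains C where "\<And>k x. x \<notin> zlattice (k + 1) \<Longrightarrow> norm_val x \<le> int (card aut) * k + C"
proof -
  have "\<exists>C. \<forall>x\<in>zlattice 0 - zlattice 1. norm_val x \<le> int C"
  proof (rule ccontr)
    assume "\<not> (\<exists>C. \<forall>x\<in>zlattice 0 - zlattice 1. norm_val x \<le> int C)"
    then have "\<exists>x. x \<in> zlattice 0 \<and> x \<notin> zlattice 1 \<and> int n < norm_val x" for n
      by (metis Diff_iff not_le)
    then obtain X where X: "\<And>n. X n \<in> zlattice 0" "\<And>n. X n \<notin> zlattice 1" "\<And>n. int n < norm_val (X n)"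
      by metis
    obtain y r where r: "strict_mono r" "\<And>k. X (r k) - y \<in> zlattice (int k)"
      by (rule lattice_seq_compact[of X]) (use X(1) in auto)
    have y0: "y \<in> zlattice 0" using lattice_diff[OF X(1)[of "r 0"] r(2)[of 0, simplified]] by simp
    have y1: "y \<notin> zlattice 1"
    proof
      assume "y \<in> zlattice 1"
      then have "X (r 1) - y + y \<in> zlattice 1" using r(2)[of 1] by (intro lattice_add) auto
      then show False using X(2) by simp
    qed
    then have "y \<noteq> 0" by auto
    obtain b where b: "(\<Prod>\<sigma>\<in>aut. \<sigma> y) = \<iota> b" "b = 0 \<longleftrightarrow> y = 0" using norm_obtain by metis
    obtain C where C: "\<And>j x y. x \<in> zlattice 0 \<Longrightarrow> y \<in> zlattice 0 \<Longrightarrow> x - y \<in> zlattice j \<Longrightarrow>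
      (\<Prod>\<sigma>\<in>aut. \<sigma> x) - (\<Prod>\<sigma>\<in>aut. \<sigma> y) \<in> zlattice (j - C)"
      by (rule norm_continuous) blast
    obtain D where D: "\<And>k a. \<iota> a \<in> zlattice k \<Longrightarrow> a \<in> padic_ideal (k - D)"
      "\<And>k a. a \<in> padic_ideal k \<Longrightarrow> \<iota> a \<in> zlattice (k - D)" by (rule lattice_emb_bound) blast
    \<comment> \<open>\<open>b\<close> is a limit of norms of unbounded valuation, so it lies in
      every ideal; this is impossible for a nonzero element.\<close>
    have "b \<in> padic_ideal (int j - max C D - D)" for j
    proof (rule D(1))
      obtain a where a: "(\<Prod>\<sigma>\<in>aut. \<sigma> (X (r j))) = \<iota> a" "norm_val (X (r j)) = pval a"
        by (metis norm_obtain)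
      have "int j \<le> pval a" using X(3)[of "r j"] a(2) seq_suble[OF r(1), of j] by simp
      then have "\<iota> a \<in> zlattice (int j - D)" by (intro D(2)) (simp add: padic_ideal_iff)
      then have 1: "\<iota> a \<in> zlattice (int j - max C D)" by (rule lattice_antimono) simp
      have "\<iota> a - \<iota> b \<in> zlattice (int j - C)" using C[OF X(1) y0 r(2)] a b by metis
      then have 2: "\<iota> a - \<iota> b \<in> zlattice (int j - max C D)" by (rule lattice_antimono) simp
      show "\<iota> b \<in> zlattice (int j - max C D)" using lattice_diff[OF 1 2] by simp
    qed
    from this[of "nat (pval b + 1 + max C D + D)"] show False
      using b(2) \<open>y \<noteq> 0\<close> by (auto simp: padic_ideal_iff split: if_splits)
  qed
  then obtain C where C: "\<And>x. x \<in> zlattice 0 \<Longrightarrow> x \<notin> zlattice 1 \<Longrightarrow> norm_val x \<le> int C" by blast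
  show ?thesis
  proof
    fix k x assume x: "x \<notin> zlattice (k + 1)"
    then have "x \<noteq> 0" by auto
    then obtain m where m: "x \<in> zlattice m" "x \<notin> zlattice (m + 1)" by (rule lattice_order)
    have "m \<le> k" using lattice_order_less[OF m(1) x] .
    define y where "y = of_nat CARD('p) powi (- m) * x"
    have x_eq: "x = of_nat CARD('p) powi m * y" by (simp add: y_def power_int_minus mult.assoc[symmetric])
    have "y \<in> zlattice 0" using m(1) lattice_prime_power[of x m "- m"] by (simp add: y_def)
    moreover have "y \<notin> zlattice 1"
      using m(2) lattice_prime_power_iff[of m y 1] x_eq by simp
    ultimately have "norm_val y \<le> int C" by (rule C)
    moreover have "norm_val x = norm_val (\<iota> (of_nat CARD('p) powi m)) + norm_val y"
      using \<open>x \<noteq> 0\<close> unfolding x_eq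
      by (subst norm_val_mult) (auto simp: emb_power_int emb.hom_of_nat)
    then have "norm_val x = int (card aut) * m + norm_val y"
      by (simp add: norm_val_emb del: emb.hom_of_nat)
    ultimately show "norm_val x \<le> int (card aut) * k + int C"
      using \<open>m \<le> k\<close> mult_left_mono[of m k "int (card aut)"] by simp
  qed
qed

end

subsection \<open>Existence and uniqueness of the extended valuation\<close>

text \<open>Divide by m and let m grow. With m as the exponent of a power, this is what removes
  bounded errors.\<close>

lemma le_if_multiples_le:
  fixes s t E :: real
  assumes "\<And>m::nat. real m * t - E \<le> real m * s"
  shows "t \<le> s"
proof (rule ccontr)
  assume "\<not> t \<le> s"
  then obtain m :: nat where "E < real m * (t - s)"
    using reals_Archimedean3[of "t - s"] by auto
  then show False using assms[of m] by (simp add: algebra_simps)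
qed

context padic_galois_extension
begin

text \<open>\<open>card aut\<close> plays the part of the degree: the norm of
  \<open>\<iota> a\<close> is \<open>a ^ card aut\<close>, so this normalisation extends
  \<open>pval\<close>.\<close>

definition kval :: "'k \<Rightarrow> real" where
  "kval x = real_of_int (norm_val x) / real (card aut)"

lemma kval_mult: "x \<noteq> 0 \<Longrightarrow> y \<noteq> 0 \<Longrightarrow> kval (x * y) = kval x + kval y"
  by (simp add: kval_def norm_val_mult add_divide_distrib)

lemma kval_emb: "a \<noteq> 0 \<Longrightarrow> kval (\<iota> a) = of_int (pval a)"
  using card_aut_pos by (simp add: kval_def norm_val_emb)

lemma kval_1 [simp]: "kval 1 = 0"
  using kval_emb[of 1] by simp

lemma kval_power: "x \<noteq> 0 \<Longrightarrow> kval (x ^ m) = real m * kval x"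
  by (induction m) (simp_all add: kval_mult algebra_simps)

lemma kval_bounds:
  obtains C where "\<And>k x. x \<in> zlattice k \<Longrightarrow> x \<noteq> 0 \<Longrightarrow> of_int k - C \<le> kval x"
    "\<And>k x. x \<notin> zlattice (k + 1) \<Longrightarrow> kval x \<le> of_int k + C"
proof -
  obtain C1 where C1: "\<And>k x. x \<in> zlattice k \<Longrightarrow> x \<noteq> 0 \<Longrightarrow> int (card aut) * k - C1 \<le> norm_val x"
    by (rule norm_val_lower) blast
  obtain C2 where C2: "\<And>k x. x \<notin> zlattice (k + 1) \<Longrightarrow> norm_val x \<le> int (card aut) * k + C2"
    by (rule norm_val_upper) blast
  define C where "C = real_of_int (max C1 C2) / real (card aut)"
  have n: "real (card aut) > 0" using card_aut_pos by simp
  show ?thesis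
  proof
    fix k x assume "x \<in> zlattice k" "x \<noteq> 0"
    then have "int (card aut) * k - max C1 C2 \<le> norm_val x" using C1[of x k] by linarith
    then have "real_of_int (int (card aut) * k - max C1 C2) \<le> real_of_int (norm_val x)"
      by (simp only: of_int_le_iff)
    then have "of_int k * real (card aut) - of_int (max C1 C2) \<le> real_of_int (norm_val x)"
      by (simp add: mult.commute)
    then show "of_int k - C \<le> kval x"
      using n unfolding kval_def C_def pos_le_divide_eq[OF n] left_diff_distrib
      by simp
  next
    fix k x assume "x \<notin> zlattice (k + 1)"
    then have "norm_val x \<le> int (card aut) * k + max C1 C2" using C2[of x k] by linarith
    then have "real_of_int (norm_val x) \<le> real_of_int (int (card aut) * k + max C1 C2)"
      by (simp only: of_int_le_iff)
    then have "real_of_int (norm_val x) \<le> of_int k * real (card aut) + of_int (max C1 C2)"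
      by (simp add: mult.commute)
    then show "kval x \<le> of_int k + C"
      using n unfolding kval_def C_def pos_divide_le_eq[OF n] distrib_right
      by simp
  qed
qed

text \<open>Comparison with the lattices gives the ultrametric inequality up to a bounded error;
  applying this to the powers of \<open>x + y\<close> removes the error.\<close>

lemma kval_add:
  assumes "x \<noteq> 0" "y \<noteq> 0" "x + y \<noteq> 0"
  shows "min (kval x) (kval y) \<le> kval (x + y)"
proof -
  define t where "t = min (kval x) (kval y)"
  obtain C where C: "\<And>k x. x \<in> zlattice k \<Longrightarrow> x \<noteq> 0 \<Longrightarrow> of_int k - C \<le> kval x"
    "\<And>k x. x \<notin> zlattice (k + 1) \<Longrightarrow> kval x \<le> of_int k + C"
    by (rule kval_bounds) blast
  have "real m * t - (2 * C + 1) \<le> real m * kval (x + y)" for m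
  proof -
    \<comment> \<open>Outside \<open>zlattice (k + 1)\<close> values are below \<open>m * t\<close>,
      so every binomial term is inside. Going to the lattice and back costs \<open>C\<close> twice
      and the rounding at most 1, which explains \<open>2 * C + 1\<close>.\<close>
    define k where "k = \<lfloor>real m * t - C\<rfloor> - 1"
    have k: "of_int k + C < real m * t" "real m * t - C - 1 \<le> of_int (k + 1)"
      unfolding k_def by linarith+
    have zl: "x ^ i * y ^ (m - i) \<in> zlattice (k + 1)" if "i \<le> m" for i
    proof (rule ccontr)
      assume "x ^ i * y ^ (m - i) \<notin> zlattice (k + 1)"
      then have "kval (x ^ i * y ^ (m - i)) < real m * t" using C(2) k(1) by fastforce
      moreover have "kval (x ^ i * y ^ (m - i)) = real i * kval x + real (m - i) * kval y"
        using assms by (simp add: kval_mult kval_power)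
      moreover have "real i * t + real (m - i) * t \<le> real i * kval x + real (m - i) * kval y"
        by (intro add_mono mult_left_mono) (auto simp: t_def)
      moreover have "real i * t + real (m - i) * t = real m * t"
        using that by (simp add: distrib_right[symmetric] of_nat_diff)
      ultimately show False by linarith
    qed
    have "(x + y) ^ m = (\<Sum>i\<le>m. of_nat (m choose i) * (x ^ i * y ^ (m - i)))"
      by (simp add: binomial_ring mult.assoc)
    also have "\<dots> \<in> zlattice (k + 1)" using zl by (intro lattice_sum lattice_scale_nat) auto
    finally have "of_int (k + 1) - C \<le> kval ((x + y) ^ m)" using assms(3) by (intro C(1)) auto
    then show ?thesis using k(2) assms(3) by (simp add: kval_power)
  qed
  then show ?thesis unfolding t_def[symmetric] by (rule le_if_multiples_le)
qed

definition kval_ereal :: "'k \<Rightarrow> ereal" where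
  "kval_ereal x = (if x = 0 then \<infinity> else ereal (kval x))"

lemma valuation_kval_ereal: "valuation kval_ereal"
  unfolding valuation_def
proof (intro conjI allI)
  fix x y
  show "kval_ereal (x * y) = kval_ereal x + kval_ereal y"
    by (auto simp: kval_ereal_def kval_mult)
  show "min (kval_ereal x) (kval_ereal y) \<le> kval_ereal (x + y)"
    using kval_add[of x y] by (auto simp: kval_ereal_def min_def split: if_splits)
qed (auto simp: kval_ereal_def)

lemma kval_ereal_emb: "kval_ereal (\<iota> a) = padic_val a"
proof (cases "a = 0")
  case True
  then show ?thesis by (simp add: kval_ereal_def padic_val_def)
next
  case False
  then show ?thesis by (simp add: kval_ereal_def kval_emb padic_val_eq)
qed

text \<open>Any extension has fixed finite values on the basis, so it is bounded below by the
  lattice level, and thus by \<open>kval\<close>, up to a constant. Powers remove the constant, and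
  the same inequality at the inverse gives equality.\<close>

lemma extended_valuation_unique:
  assumes v: "valuation v" and ext: "\<And>a. v (\<iota> a) = padic_val a"
  shows "v = kval_ereal"
proof -
  have v0: "v x = \<infinity> \<longleftrightarrow> x = 0" and v_minf: "v x \<noteq> -\<infinity>" and v_mult: "v (x * y) = v x + v y"
    and v_add: "min (v x) (v y) \<le> v (x + y)" for x y
    using v by (auto simp: valuation_def)
  define r where "r x = real_of_ereal (v x)" for x
  have r: "v x = ereal (r x)" if "x \<noteq> 0" for x
    using that v0[of x] v_minf[of x] unfolding r_def by (cases "v x") auto
  have r_mult: "r (x * y) = r x + r y" if "x \<noteq> 0" "y \<noteq> 0" for x y
    using v_mult[of x y] r[of x] r[of y] r[of "x * y"] that by simp
  have r1: "r 1 = 0" using r_mult[of 1 1] by simp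
  have r_power: "r (x ^ m) = real m * r x" if "x \<noteq> 0" for x m
    by (induction m) (use that in \<open>simp_all add: r1 r_mult algebra_simps\<close>)
  have v_sum: "t \<le> v (sum f A)" if "\<And>i. i \<in> A \<Longrightarrow> t \<le> v (f i)" for t f and A :: "'k set"
    using that
  proof (induction A rule: infinite_finite_induct)
    case (insert a A)
    then have "t \<le> min (v (f a)) (v (sum f A))" by simp
    also have "\<dots> \<le> v (sum f (insert a A))" using v_add[of "f a" "sum f A"] insert by simp
    finally show ?case .
  qed (use v0[of 0] in auto)
  \<comment> \<open>Crude bound for the absolute value of every \<open>r b\<close> at once.\<close>
  define D where "D = (\<Sum>b\<in>basis. \<bar>r b\<bar>)"
  have lower: "of_int k - D \<le> r x" if "x \<in> zlattice k" "x \<noteq> 0" for x k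
  proof -
    have "ereal (of_int k - D) \<le> v (\<Sum>b\<in>basis. \<iota> (coord x b) * b)"
    proof (rule v_sum)
      fix b assume b: "b \<in> basis"
      show "ereal (of_int k - D) \<le> v (\<iota> (coord x b) * b)"
      proof (cases "coord x b = 0")
        case True
        then show ?thesis using v0[of 0] by simp
      next
        case False
        then have "v (\<iota> (coord x b) * b) = ereal (of_int (pval (coord x b)) + r b)"
          using r[OF basis_nonzero[OF b]] by (simp add: v_mult ext padic_val_eq)
        moreover have "\<bar>r b\<bar> \<le> D" unfolding D_def using b basis(1) by (intro member_le_sum) auto
        moreover have "k \<le> pval (coord x b)"
          using that(1) False b by (auto simp: zlattice_def padic_ideal_iff)
        ultimately show ?thesis by simp
      qed
    qed
    then show ?thesis using r[OF that(2)] by (simp add: sum_coord)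
  qed
  obtain C where C: "\<And>k x. x \<in> zlattice k \<Longrightarrow> x \<noteq> 0 \<Longrightarrow> of_int k - C \<le> kval x"
    "\<And>k x. x \<notin> zlattice (k + 1) \<Longrightarrow> kval x \<le> of_int k + C"
    by (rule kval_bounds) blast
  have close: "kval x - (C + D) \<le> r x" if x: "x \<noteq> 0" for x
  proof -
    obtain k where "x \<in> zlattice k" "x \<notin> zlattice (k + 1)" using lattice_order[OF x] .
    then show ?thesis using lower[of x k] C(2)[of x k] x by linarith
  qed
  have le: "kval x \<le> r x" if x: "x \<noteq> 0" for x
  proof (rule le_if_multiples_le)
    show "real m * kval x - (C + D) \<le> real m * r x" for m
      using close[of "x ^ m"] x by (simp add: kval_power r_power)
  qed
  have "r x = kval x" if x: "x \<noteq> 0" for x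
  proof -
    have "r x + r (inverse x) = 0" "kval x + kval (inverse x) = 0"
      using r_mult[of x "inverse x"] kval_mult[of x "inverse x"] x r1 by simp_all
    then show ?thesis using le[of x] le[of "inverse x"] x by simp
  qed
  then have "v x = kval_ereal x" for x
    using r[of x] v0[of x] by (cases "x = 0") (simp_all add: kval_ereal_def)
  then show ?thesis by (simp add: fun_eq_iff)
qed

lemma ext_val_eq: "ext_val \<iota> = kval_ereal"
  unfolding ext_val_def
proof (rule the_equality)
  show "valuation kval_ereal \<and> (\<forall>a. kval_ereal (\<iota> a) = padic_val a)"
    by (simp add: valuation_kval_ereal kval_ereal_emb)
  fix v assume "valuation v \<and> (\<forall>a. v (\<iota> a) = padic_val a)"
  then show "v = kval_ereal" by (intro extended_valuation_unique) simp_all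
qed

end

subsection \<open>Ramification index and residue field\<close>

text \<open>Division with remainder by the least positive element; closure under subtraction already
  yields negatives, sums and multiples.\<close>

lemma int_subgroup_principal:
  fixes S :: "int set"
  assumes diff: "\<And>x y. x \<in> S \<Longrightarrow> y \<in> S \<Longrightarrow> x - y \<in> S" and m: "m \<in> S" "m > 0"
  obtains d where "d > 0" "S = range (\<lambda>j. d * j)"
proof -
  define d where "d = (LEAST n. n > 0 \<and> int n \<in> S)"
  have ex: "nat m > 0 \<and> int (nat m) \<in> S" using m by simp
  have d: "d > 0" "int d \<in> S" using LeastI[of "\<lambda>n. n > 0 \<and> int n \<in> S", OF ex] by (auto simp: d_def)
  have least: "d \<le> n" if "n > 0" "int n \<in> S" for n
    unfolding d_def using that by (intro Least_le) auto
  have S0: "0 \<in> S" using diff[OF m(1) m(1)] by simp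
  have neg: "- x \<in> S" if "x \<in> S" for x using diff[OF S0 that] by simp
  have add: "x + y \<in> S" if "x \<in> S" "y \<in> S" for x y using diff[OF that(1) neg[OF that(2)]] by simp
  have nat_mult: "x * int n \<in> S" if "x \<in> S" for x n
    by (induction n) (use S0 add that in \<open>auto simp: algebra_simps\<close>)
  have mult: "int d * j \<in> S" for j
    using nat_mult[OF d(2), of "nat j"] neg[OF nat_mult[OF d(2), of "nat (- j)"]] by (cases "j \<ge> 0") auto
  show ?thesis
  proof
    show "int d > 0" using d by simp
    show "S = range (\<lambda>j. int d * j)"
    proof (intro equalityI subsetI)
      fix x assume x: "x \<in> S"
      have "x - int d * (x div int d) \<in> S" using diff[OF x mult] .
      then have "x mod int d \<in> S" by (simp add: minus_mult_div_eq_mod)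
      moreover have "0 \<le> x mod int d" "x mod int d < int d" using d by auto
      moreover have "int d \<le> x mod int d" if "x mod int d > 0"
        using least[of "nat (x mod int d)"] that \<open>x mod int d \<in> S\<close> by simp
      ultimately have "x mod int d = 0" by linarith
      then show "x \<in> range (\<lambda>j. int d * j)" by (metis dvd_eq_mod_eq_0 dvdE rangeI)
    qed (use mult in auto)
  qed
qed

text \<open>The classes are represented by \<open>j / m\<close> with \<open>0 \<le> j < m\<close>.
  Infinite extended reals never enter a class, as their difference from a finite number is not
  finite.\<close>

lemma card_cosets_fractions_mod_integers:
  assumes "m > 0"
  shows "card (range (\<lambda>j::int. ereal (of_int j / real m)) //
    {(a, b). a - b \<in> range (\<lambda>j::int. ereal (of_int j))}) = m"
proof -
  let ?A = "range (\<lambda>j::int. ereal (of_int j / real m))"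
  let ?r = "{(a, b). a - b \<in> range (\<lambda>j::int. ereal (of_int j))}"
  define f where "f j = ?r `` {ereal (of_int j / real m)}" for j :: int
  have mem: "ereal t \<in> f j \<longleftrightarrow> (\<exists>i::int. of_int j / real m - t = of_int i)" for j t
    by (auto simp: f_def image_iff)
  have fin: "b \<in> f j \<Longrightarrow> \<exists>t. b = ereal t" for b j
    by (cases b) (auto simp: f_def)
  have eq: "f j = f (j mod int m)" for j
  proof -
    have "real_of_int j = of_int (j mod int m) + real m * of_int (j div int m)"
      using mod_mult_div_eq[of j "int m"] by (metis of_int_add of_int_mult of_int_of_nat_eq)
    then have q: "real_of_int j / real m = of_int (j mod int m) / real m + of_int (j div int m)"
      using assms by (simp add: field_simps)
    have "ereal t \<in> f j \<longleftrightarrow> ereal t \<in> f (j mod int m)" for t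
    proof
      assume "ereal t \<in> f j"
      then obtain i :: int where "of_int j / real m - t = of_int i" by (auto simp: mem)
      then have "of_int (j mod int m) / real m - t = of_int (i - j div int m)" using q by simp
      then show "ereal t \<in> f (j mod int m)" unfolding mem by blast
    next
      assume "ereal t \<in> f (j mod int m)"
      then obtain i :: int where "of_int (j mod int m) / real m - t = of_int i" by (auto simp: mem)
      then have "of_int j / real m - t = of_int (i + j div int m)" using q by simp
      then show "ereal t \<in> f j" unfolding mem by blast
    qed
    then show ?thesis using fin by blast
  qed
  have "?A // ?r = f ` {0..<int m}"
  proof -
    have "?A // ?r = range f" by (auto simp: quotient_def f_def)
    also have "\<dots> = f ` {0..<int m}"
    proof
      show "range f \<subseteq> f ` {0..<int m}"
      proof
        fix c assume "c \<in> range f"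
        then obtain j where "c = f (j mod int m)" using eq by blast
        then show "c \<in> f ` {0..<int m}" using assms by auto
      qed
    qed auto
    finally show ?thesis .
  qed
  moreover have "inj_on f {0..<int m}"
  proof (rule inj_onI)
    fix j k assume jk: "j \<in> {0..<int m}" "k \<in> {0..<int m}" "f j = f k"
    have "ereal (of_int j / real m) \<in> f j" by (auto simp: mem intro: exI[of _ 0])
    then obtain i :: int where "of_int k / real m - of_int j / real m = of_int i" using jk by (auto simp: mem)
    then have "real_of_int k - of_int j = of_int i * real m" using assms by (simp add: field_simps)
    then have "real_of_int (k - j) = real_of_int (i * int m)" by simp
    then have "k - j = i * int m" by (simp only: of_int_eq_iff)
    then have "int m dvd k - j" by simp
    then have "k mod int m = j mod int m" by (simp add: mod_eq_dvd_iff)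
    then show "j = k" using jk by simp
  qed
  ultimately show ?thesis by (simp add: card_image)
qed

context padic_galois_extension
begin

abbreviation "e \<equiv> ramification_index \<iota>"

text \<open>The values of \<open>norm_val\<close> form a subgroup \<open>d\<close> \<int> containing
  \<open>card aut = d * m\<close>, so the values of \<open>kval\<close> are exactly the multiples of
  \<open>1 / m\<close>. Counting cosets identifies \<open>m\<close> with \<open>e\<close>.\<close>

lemma value_group:
  shows ramification_index_pos: "e > 0"
    and value_group_mem: "x \<noteq> 0 \<Longrightarrow> \<exists>j::int. kval x = of_int j / real e"
    and value_group_onto: "\<exists>x. x \<noteq> 0 \<and> kval x = of_int j / real e"
proof -
  define S where "S = norm_val ` (- {0})"
  have npos: "int (card aut) > 0" using card_aut_pos by simp
  have nS: "int (card aut) \<in> S"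
  proof -
    have "norm_val (\<iota> (of_nat CARD('p) powi 1)) = int (card aut) * 1"
      using norm_val_emb[of "of_nat CARD('p) powi 1"] pval_power_int_prime[of 1, where 'p='p] by simp
    moreover have "\<iota> (of_nat CARD('p) powi 1) \<in> - {0}" by simp
    ultimately show ?thesis unfolding S_def by (metis image_eqI mult_1_right)
  qed
  have norm_val_div: "norm_val (x / y) = norm_val x - norm_val y" if "x \<noteq> 0" "y \<noteq> 0" for x y
    using norm_val_mult[of "x / y" y] that by simp
  obtain d where d: "d > 0" "S = range (\<lambda>j. d * j)"
  proof (rule int_subgroup_principal[OF _ nS npos])
    fix x y assume "x \<in> S" "y \<in> S"
    then obtain a b where "x = norm_val a" "a \<noteq> 0" "y = norm_val b" "b \<noteq> 0" by (auto simp: S_def)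
    then have "x - y = norm_val (a / b)" "a / b \<noteq> 0" by (auto simp: norm_val_div)
    then show "x - y \<in> S" unfolding S_def by blast
  qed auto
  obtain m' where m': "int (card aut) = d * m'" using nS unfolding d(2) by blast
  then have m'_pos: "m' > 0" using npos d by (simp add: zero_less_mult_iff)
  define m where "m = nat m'"
  have m: "m > 0" "int (card aut) = d * int m" using m' m'_pos by (auto simp: m_def)
  have card_eq: "real (card aut) = of_int d * real m"
    using arg_cong[OF m(2), of real_of_int] by simp
  have quot: "of_int (d * j) / real (card aut) = of_int j / real m" for j
    using d m by (simp add: card_eq)
  have mem: "\<exists>j::int. kval x = of_int j / real m" if "x \<noteq> 0" for x
  proof -
    have "norm_val x \<in> S" using that by (auto simp: S_def)
    then obtain j where "norm_val x = d * j" unfolding d(2) by blast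
    then show ?thesis using quot by (auto simp: kval_def)
  qed
  have onto: "\<exists>x. x \<noteq> 0 \<and> kval x = of_int j / real m" for j
  proof -
    have "d * j \<in> S" unfolding d(2) by blast
    then obtain x where x: "x \<in> - {0}" "d * j = norm_val x" unfolding S_def by blast
    then have "x \<noteq> 0" "norm_val x = d * j" by simp_all
    then show ?thesis using quot by (auto simp: kval_def)
  qed
  have A: "ext_val \<iota> ` (- {0}) = range (\<lambda>j::int. ereal (of_int j / real m))"
  proof (intro equalityI subsetI)
    fix t assume "t \<in> ext_val \<iota> ` (- {0})"
    then obtain x where "x \<noteq> 0" "t = ereal (kval x)" by (auto simp: ext_val_eq kval_ereal_def)
    then show "t \<in> range (\<lambda>j::int. ereal (of_int j / real m))" using mem[of x] by auto
  next
    fix t assume "t \<in> range (\<lambda>j::int. ereal (of_int j / real m))"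
    then obtain j :: int where "t = ereal (of_int j / real m)" by auto
    then show "t \<in> ext_val \<iota> ` (- {0})"
      using onto[of j] by (auto simp: ext_val_eq kval_ereal_def image_iff intro!: bexI)
  qed
  have B: "(padic_val :: 'p padic \<Rightarrow> ereal) ` (- {0}) = range (\<lambda>j::int. ereal (of_int j))"
  proof (intro equalityI subsetI)
    fix t assume "t \<in> (padic_val :: 'p padic \<Rightarrow> ereal) ` (- {0})"
    then show "t \<in> range (\<lambda>j::int. ereal (of_int j))" by (auto simp: padic_val_eq)
  next
    fix t assume "t \<in> range (\<lambda>j::int. ereal (of_int j))"
    then obtain j :: int where "t = ereal (of_int j)" by auto
    then have "t = padic_val (of_nat CARD('p) powi j :: 'p padic)" by (simp add: padic_val_eq)
    then show "t \<in> (padic_val :: 'p padic \<Rightarrow> ereal) ` (- {0})" by (rule image_eqI) simp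
  qed
  have "e = m"
    unfolding ramification_index_def A B by (rule card_cosets_fractions_mod_integers[OF m(1)])
  then show "e > 0" "x \<noteq> 0 \<Longrightarrow> \<exists>j::int. kval x = of_int j / real e"
    "\<exists>x. x \<noteq> 0 \<and> kval x = of_int j / real e"
    using m mem onto by auto
qed

text \<open>The valuation rescaled to value group \<int>. On nonzero elements the floor only changes
  the type, as the product is already an integer.\<close>

definition ord :: "'k \<Rightarrow> int" where
  "ord x = \<lfloor>real e * kval x\<rfloor>"

lemma ord_eq: "x \<noteq> 0 \<Longrightarrow> of_int (ord x) = real e * kval x"
  using value_group_mem[of x] ramification_index_pos by (auto simp: ord_def)

lemma ord_eqI: "x \<noteq> 0 \<Longrightarrow> real e * kval x = of_int j \<Longrightarrow> ord x = j"
  by (simp add: ord_def)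

lemma ord_mult: "x \<noteq> 0 \<Longrightarrow> y \<noteq> 0 \<Longrightarrow> ord (x * y) = ord x + ord y"
  by (rule ord_eqI) (simp_all add: kval_mult distrib_left ord_eq)

lemma ord_emb: "a \<noteq> 0 \<Longrightarrow> ord (\<iota> a) = int e * pval a"
  by (rule ord_eqI) (simp_all add: kval_emb)

lemma ord_1 [simp]: "ord 1 = 0"
  by (simp add: ord_def)

lemma ord_power: "x \<noteq> 0 \<Longrightarrow> ord (x ^ n) = int n * ord x"
  by (induction n) (simp_all add: ord_mult algebra_simps)

lemma ord_inverse: "x \<noteq> 0 \<Longrightarrow> ord (inverse x) = - ord x"
  using ord_mult[of x "inverse x"] by simp

lemma ord_power_int: "x \<noteq> 0 \<Longrightarrow> ord (x powi k) = k * ord x"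
  by (cases "k \<ge> 0") (simp_all add: power_int_def ord_power ord_inverse)

lemma ord_prime_power: "ord (of_nat CARD('p) powi k) = int e * k"
  using ord_emb[of "of_nat CARD('p) powi k"] by (simp add: emb_power_int emb.hom_of_nat)

lemma ord_add: "x \<noteq> 0 \<Longrightarrow> y \<noteq> 0 \<Longrightarrow> x + y \<noteq> 0 \<Longrightarrow> min (ord x) (ord y) \<le> ord (x + y)"
proof -
  assume xy: "x \<noteq> 0" "y \<noteq> 0" "x + y \<noteq> 0"
  have "kval x \<le> kval (x + y) \<or> kval y \<le> kval (x + y)"
    using kval_add[OF xy] by linarith
  then have "real e * kval x \<le> real e * kval (x + y) \<or> real e * kval y \<le> real e * kval (x + y)"
    by (meson mult_left_mono of_nat_0_le_iff)
  then have "ord x \<le> ord (x + y) \<or> ord y \<le> ord (x + y)"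
    using ord_eq[OF xy(1)] ord_eq[OF xy(2)] ord_eq[OF xy(3)] by (metis of_int_le_iff)
  then show ?thesis by linarith
qed

lemma ex_uniformizer: "\<exists>\<pi>. \<pi> \<noteq> 0 \<and> ord \<pi> = 1"
proof -
  obtain x where "x \<noteq> 0" "kval x = of_int 1 / real e" using value_group_onto by blast
  then show ?thesis using ramification_index_pos by (intro exI[of _ x]) (simp add: ord_def)
qed

text \<open>The k-th power of the maximal ideal, with fractional ideals for negative
  \<open>k\<close>.\<close>

definition mideal :: "int \<Rightarrow> 'k set" where
  "mideal k = {x. x = 0 \<or> k \<le> ord x}"

lemma mideal_iff: "x \<in> mideal k \<longleftrightarrow> x = 0 \<or> k \<le> ord x"
  by (simp add: mideal_def)

lemma mideal_0 [simp]: "0 \<in> mideal k"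
  by (simp add: mideal_iff)

lemma mideal_1 [simp]: "1 \<in> mideal 0"
  by (simp add: mideal_iff)

lemma mideal_antimono: "x \<in> mideal k \<Longrightarrow> j \<le> k \<Longrightarrow> x \<in> mideal j"
  by (auto simp: mideal_iff)

lemma mideal_add: "x \<in> mideal k \<Longrightarrow> y \<in> mideal k \<Longrightarrow> x + y \<in> mideal k"
  using ord_add[of x y] by (cases "x = 0 \<or> y = 0 \<or> x + y = 0") (auto simp: mideal_iff)

lemma mideal_mult: "x \<in> mideal j \<Longrightarrow> y \<in> mideal k \<Longrightarrow> x * y \<in> mideal (j + k)"
  by (cases "x = 0 \<or> y = 0") (auto simp: mideal_iff ord_mult)

lemma mideal_mult_left: "x \<in> mideal 0 \<Longrightarrow> y \<in> mideal k \<Longrightarrow> x * y \<in> mideal k"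
  using mideal_mult[of x 0 y k] by simp

lemma mideal_mult_right: "x \<in> mideal k \<Longrightarrow> y \<in> mideal 0 \<Longrightarrow> x * y \<in> mideal k"
  using mideal_mult[of x k y 0] by simp

lemma mideal_uminus: "x \<in> mideal k \<Longrightarrow> - x \<in> mideal k"
proof -
  have "ord (-1) = 0"
    using ord_mult[of "-1" "-1"] by simp
  then have "-1 \<in> mideal 0" by (simp add: mideal_iff)
  then show "x \<in> mideal k \<Longrightarrow> - x \<in> mideal k" using mideal_mult_left[of "-1" x k] by simp
qed

lemma mideal_diff: "x \<in> mideal k \<Longrightarrow> y \<in> mideal k \<Longrightarrow> x - y \<in> mideal k"
  using mideal_add[of x k "- y"] mideal_uminus[of y k] by simp

lemma mideal_diff_commute: "x - y \<in> mideal k \<longleftrightarrow> y - x \<in> mideal k"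
  using mideal_uminus[of "x - y" k] mideal_uminus[of "y - x" k] by auto

lemma mideal_diff_trans: "x - y \<in> mideal k \<Longrightarrow> y - z \<in> mideal k \<Longrightarrow> x - z \<in> mideal k"
  using mideal_add[of "x - y" k "y - z"] by simp

lemma mideal_sum: "(\<And>i. i \<in> A \<Longrightarrow> f i \<in> mideal k) \<Longrightarrow> sum f A \<in> mideal k"
  by (induction A rule: infinite_finite_induct) (auto intro: mideal_add)

lemma mideal_prod: "(\<And>i. i \<in> A \<Longrightarrow> f i \<in> mideal 0) \<Longrightarrow> prod f A \<in> mideal 0"
  by (induction A rule: infinite_finite_induct) (auto intro: mideal_mult_left)

lemma mideal_power: "x \<in> mideal 0 \<Longrightarrow> x ^ n \<in> mideal 0"
  by (induction n) (auto intro: mideal_mult_left)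

lemma of_nat_mideal: "of_nat n \<in> mideal 0"
  by (induction n) (auto intro: mideal_add)

lemma prime_mideal: "of_nat CARD('p) \<in> mideal 1"
  using ord_prime_power[of 1] ramification_index_pos by (simp add: mideal_iff)

lemma mideal_prime: "x \<in> mideal 0 \<Longrightarrow> y \<in> mideal 0 \<Longrightarrow> x * y \<in> mideal 1 \<Longrightarrow> x \<in> mideal 1 \<or> y \<in> mideal 1"
  by (cases "x = 0 \<or> y = 0") (auto simp: mideal_iff ord_mult)

lemma one_notin_mideal: "1 \<notin> mideal 1"
  by (simp add: mideal_iff)

lemma valuation_ring_eq: "valuation_ring \<iota> = mideal 0"
proof -
  have "0 \<le> kval x \<longleftrightarrow> 0 \<le> ord x" if "x \<noteq> 0" for x
    using ord_eq[OF that] ramification_index_pos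
    by (metis of_int_0_le_iff of_nat_0_less_iff zero_le_mult_iff order.asym order_less_le)
  then show ?thesis by (auto simp: valuation_ring_def ext_val_eq kval_ereal_def mideal_iff split: if_splits)
qed

lemma maximal_ideal_eq: "maximal_ideal \<iota> = mideal 1"
proof -
  have "0 < kval x \<longleftrightarrow> 1 \<le> ord x" if "x \<noteq> 0" for x
  proof -
    have "0 < kval x \<longleftrightarrow> 0 < real_of_int (ord x)"
      unfolding ord_eq[OF that] using ramification_index_pos by (simp add: zero_less_mult_iff)
    then show ?thesis by auto
  qed
  then show ?thesis by (auto simp: maximal_ideal_def ext_val_eq kval_ereal_def mideal_iff split: if_splits)
qed

text \<open>Composition with \<sigma> on the right permutes the group, so conjugate elements have
  the same norm.\<close>

lemma ord_aut: "\<sigma> \<in> aut \<Longrightarrow> ord (\<sigma> x) = ord x"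
proof -
  assume s: "\<sigma> \<in> aut"
  define f where "f \<tau> = \<tau> \<circ> \<sigma>" for \<tau> :: "'k \<Rightarrow> 'k"
  define g where "g \<tau> = \<tau> \<circ> inv_into UNIV \<sigma>" for \<tau> :: "'k \<Rightarrow> 'k"
  have b: "bij \<sigma>" using s by (rule autD)
  have "bij_betw f aut aut"
  proof (rule bij_betw_byWitness[where f'=g])
    show "\<forall>\<tau>\<in>aut. g (f \<tau>) = \<tau>" "\<forall>\<tau>\<in>aut. f (g \<tau>) = \<tau>"
      using b by (auto simp: f_def g_def fun_eq_iff bij_is_surj surj_f_inv_f bij_is_inj)
  qed (use s in \<open>auto simp: f_def g_def intro: comp_in_aut inv_in_aut\<close>)
  from prod.reindex_bij_betw[OF this, of "\<lambda>\<tau>. \<tau> x"]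
  have "(\<Prod>\<tau>\<in>aut. \<tau> (\<sigma> x)) = (\<Prod>\<tau>\<in>aut. \<tau> x)" by (simp add: f_def)
  then show ?thesis by (simp add: ord_def kval_def norm_val_def)
qed

lemma mideal_aut: "\<sigma> \<in> aut \<Longrightarrow> x \<in> mideal k \<Longrightarrow> \<sigma> x \<in> mideal k"
  by (auto simp: mideal_iff ord_aut aut_simps)

text \<open>A sequence of pairwise incongruent integral elements would, after scaling into
  \<open>zlattice 0\<close>, have a convergent subsequence.\<close>

lemma finite_residue_field: "finite (residue_field \<iota>)"
proof (rule ccontr)
  let ?r = "{(x, y). x - y \<in> maximal_ideal \<iota>}"
  assume "infinite (residue_field \<iota>)"
  then obtain c :: "nat \<Rightarrow> 'k set" where c: "inj c" "range c \<subseteq> residue_field \<iota>"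
    by (metis infinite_countable_subset)
  have "\<exists>y. y \<in> mideal 0 \<and> c n = ?r `` {y}" for n
    using c(2) by (auto simp: residue_field_def quotient_def valuation_ring_eq)
  then obtain Y where Y: "\<And>n. Y n \<in> mideal 0" "\<And>n. c n = ?r `` {Y n}" by metis
  have Y_neq: "Y m - Y n \<notin> mideal 1" if "m \<noteq> n" for m n
  proof
    assume *: "Y m - Y n \<in> mideal 1"
    have "Y m - z \<in> mideal 1 \<longleftrightarrow> Y n - z \<in> mideal 1" for z
      using * mideal_diff_trans mideal_diff_commute by metis
    then have "c m = c n" by (auto simp: Y maximal_ideal_eq)
    then show False using c(1) that by (auto dest: injD)
  qed
  obtain C where C: "\<And>k x. x \<in> zlattice k \<Longrightarrow> x \<noteq> 0 \<Longrightarrow> of_int k - C \<le> kval x"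
    "\<And>k x. x \<notin> zlattice (k + 1) \<Longrightarrow> kval x \<le> of_int k + C"
    by (rule kval_bounds) blast
  \<comment> \<open>Large enough that integral elements lie in \<open>zlattice (- N)\<close> and
    elements of \<open>zlattice N\<close> lie in the maximal ideal. Scaling up by \<open>N\<close>
    explains the precision \<open>2 * N\<close> used below.\<close>
  define N where "N = \<lfloor>\<bar>C\<bar>\<rfloor> + 2"
  have N: "\<bar>C\<bar> + 1 < of_int N" unfolding N_def by linarith
  have Y_lat: "Y n \<in> zlattice (- N)" for n
  proof (rule ccontr)
    assume "Y n \<notin> zlattice (- N)"
    then have "Y n \<noteq> 0" "kval (Y n) \<le> of_int (- N - 1) + C"
      using C(2)[of "Y n" "- N - 1"] by auto
    moreover have "0 \<le> kval (Y n)"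
    proof -
      have "0 \<le> ord (Y n)" using Y(1)[of n] \<open>Y n \<noteq> 0\<close> by (simp add: mideal_iff)
      then have "0 \<le> real e * kval (Y n)" using ord_eq[OF \<open>Y n \<noteq> 0\<close>] by (metis of_int_0_le_iff)
      then show ?thesis using ramification_index_pos by (simp add: zero_le_mult_iff)
    qed
    ultimately show False using N by simp
  qed
  define X where "X n = of_nat CARD('p) powi N * Y n" for n
  have "X n \<in> zlattice 0" for n using lattice_prime_power[OF Y_lat, of N n] by (simp add: X_def)
  then obtain x r where r: "strict_mono r" "\<And>k. X (r k) - x \<in> zlattice (int k)"
    by (rule lattice_seq_compact[of X]) auto
  define k where "k = nat (2 * N)"
  have "X (r k) - X (r (Suc k)) \<in> zlattice (2 * N)"
  proof -
    have "X (r k) - x \<in> zlattice (2 * N)" "X (r (Suc k)) - x \<in> zlattice (2 * N)"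
      using r(2)[of k] r(2)[of "Suc k"] lattice_antimono[of _ "int (Suc k)" "2 * N"]
        lattice_antimono[of _ "int k" "2 * N"] by (auto simp: k_def)
    from lattice_diff[OF this] show ?thesis by simp
  qed
  moreover have "X (r k) - X (r (Suc k)) = of_nat CARD('p) powi N * (Y (r k) - Y (r (Suc k)))"
    by (simp add: X_def right_diff_distrib)
  ultimately have D: "Y (r k) - Y (r (Suc k)) \<in> zlattice N"
    using lattice_prime_power_iff[of N _ N] by simp
  have "r k \<noteq> r (Suc k)" using strict_monoD[OF r(1), of k "Suc k"] by simp
  then have nz: "Y (r k) - Y (r (Suc k)) \<notin> mideal 1" by (rule Y_neq)
  then have nz': "Y (r k) - Y (r (Suc k)) \<noteq> 0" by auto
  have "0 < kval (Y (r k) - Y (r (Suc k)))" using C(1)[OF D nz'] N by simp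
  then have "Y (r k) - Y (r (Suc k)) \<in> maximal_ideal \<iota>"
    by (simp add: maximal_ideal_def ext_val_eq kval_ereal_def)
  then show False using nz by (simp add: maximal_ideal_eq)
qed

section \<open>Representatives of the residue classes\<close>

abbreviation "q \<equiv> card (residue_field \<iota>)"

lemma residue_system:
  obtains r :: "nat \<Rightarrow> 'k" where "\<And>i. i < q \<Longrightarrow> r i \<in> mideal 0"
    "\<And>x. x \<in> mideal 0 \<Longrightarrow> \<exists>i<q. x - r i \<in> mideal 1"
    "\<And>i j. i < q \<Longrightarrow> j < q \<Longrightarrow> r i - r j \<in> mideal 1 \<Longrightarrow> i = j"
proof -
  let ?r = "{(x, y). x - y \<in> maximal_ideal \<iota>}"
  obtain c where "bij_betw c {0..<q} (residue_field \<iota>)"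
    using ex_bij_betw_nat_finite[OF finite_residue_field] by blast
  then have c: "inj_on c {0..<q}" "c ` {0..<q} = residue_field \<iota>" by (auto simp: bij_betw_def)
  have "\<exists>y. y \<in> mideal 0 \<and> c i = ?r `` {y}" if "i < q" for i
  proof -
    have "c i \<in> residue_field \<iota>" using c(2) that by auto
    then show ?thesis by (auto simp: residue_field_def quotient_def valuation_ring_eq)
  qed
  then obtain r where r: "\<And>i. i < q \<Longrightarrow> r i \<in> mideal 0" "\<And>i. i < q \<Longrightarrow> c i = ?r `` {r i}" by metis
  show ?thesis
  proof (rule that[of r])
    fix x assume "x \<in> mideal 0"
    then have "?r `` {x} \<in> residue_field \<iota>" 
      unfolding residue_field_def valuation_ring_eq by (rule quotientI)
    then have "?r `` {x} \<in> c ` {0..<q}" by (simp only: c(2))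
    then obtain i where i: "i < q" "c i = ?r `` {x}" unfolding image_iff by fastforce
    have "r i \<in> ?r `` {r i}" by (simp add: maximal_ideal_eq)
    then have "r i \<in> ?r `` {x}" using r(2)[OF i(1)] i(2) by simp
    then show "\<exists>i<q. x - r i \<in> mideal 1" using i(1) by (auto simp: maximal_ideal_eq)
  next
    fix i j assume ij: "i < q" "j < q" "r i - r j \<in> mideal 1"
    have "r i - z \<in> mideal 1 \<longleftrightarrow> r j - z \<in> mideal 1" for z
      using ij(3) mideal_diff_trans mideal_diff_commute by metis
    then have "c i = c j" using r(2) ij by (auto simp: maximal_ideal_eq)
    then show "i = j" using c(1) ij by (auto dest: inj_onD)
  qed (use r in auto)
qed

lemma q_ge_2: "q \<ge> 2"
proof -
  obtain r :: "nat \<Rightarrow> 'k" where r: "\<And>x. x \<in> mideal 0 \<Longrightarrow> \<exists>i<q. x - r i \<in> mideal 1"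
    by (rule residue_system) blast
  obtain i j where ij: "i < q" "0 - r i \<in> mideal 1" "j < q" "1 - r j \<in> mideal 1"
    using r[of 0] r[of 1] by auto
  have "i \<noteq> j"
  proof
    assume "i = j"
    then have "1 - 0 \<in> mideal 1" using ij mideal_diff_trans mideal_diff_commute by metis
    then show False using one_notin_mideal by simp
  qed
  then show ?thesis using ij by linarith
qed

end

subsection \<open>Well-distributed sequences\<close>

text \<open>The lowest \<open>N\<close> digits of \<open>i\<close> in base \<open>b\<close> are
  replaced by the elements \<open>r\<close> of the digits and evaluated as a polynomial at
  \<open>t\<close>. With \<open>t\<close> a uniformiser and \<open>r\<close> a residue system,
  integers congruent modulo powers of \<open>q\<close> correspond to congruent field
  elements.\<close>

primrec digit_seq :: "'a::comm_ring_1 \<Rightarrow> (nat \<Rightarrow> 'a) \<Rightarrow> nat \<Rightarrow> nat \<Rightarrow> nat \<Rightarrow> 'a" where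
  "digit_seq t r b 0 i = 0"
| "digit_seq t r b (Suc N) i = r (i mod b) + t * digit_seq t r b N (i div b)"

text \<open>Splits off the lowest digit, in step with the recursion of
  \<open>digit_seq\<close>.\<close>

lemma mod_power_Suc_eq_iff:
  fixes b i j k :: nat
  assumes "b > 0"
  shows "i mod b ^ Suc k = j mod b ^ Suc k \<longleftrightarrow>
    i mod b = j mod b \<and> (i div b) mod b ^ k = (j div b) mod b ^ k"
proof
  assume *: "i mod b ^ Suc k = j mod b ^ Suc k"
  have "i mod b ^ Suc k mod b = i mod b" "j mod b ^ Suc k mod b = j mod b"
    by (simp_all add: mod_mod_cancel)
  then have "i mod b = j mod b" using * by simp
  then show "i mod b = j mod b \<and> (i div b) mod b ^ k = (j div b) mod b ^ k"
    using * assms by (simp add: mod_mult2_eq)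
qed (simp add: mod_mult2_eq)

text \<open>Each complete block of \<open>b\<close> consecutive indices meets the residue class
  once.\<close>

lemma card_congruent_ge:
  assumes "b > (0::nat)"
  shows "n div b \<le> card ({..<n} \<inter> {i. i mod b = c mod b})"
proof -
  have "(\<lambda>t. c mod b + b * t) ` {..<n div b} \<subseteq> {..<n} \<inter> {i. i mod b = c mod b}"
  proof (intro image_subsetI)
    fix t assume "t \<in> {..<n div b}"
    then have "Suc t \<le> n div b" by simp
    then have "Suc t * b \<le> n" by (simp only: less_eq_div_iff_mult_less_eq[OF assms])
    moreover have "c mod b < b" using assms by simp
    ultimately have "c mod b + b * t < n" by (simp add: mult.commute)
    then show "c mod b + b * t \<in> {..<n} \<inter> {i. i mod b = c mod b}" by simp
  qed
  then have "card ((\<lambda>t. c mod b + b * t) ` {..<n div b}) \<le> card ({..<n} \<inter> {i. i mod b = c mod b})"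
    by (intro card_mono) auto
  moreover have "inj_on (\<lambda>t. c mod b + b * t) {..<n div b}" using assms by (auto simp: inj_on_def)
  ultimately show ?thesis by (simp add: card_image)
qed

text \<open>Division by \<open>b\<close> is injective on a residue class and has at most
  \<open>n div b + 1\<close> values below; removing \<open>i\<close> itself saves the extra
  one.\<close>

lemma card_congruent_le:
  assumes "b > (0::nat)" "i \<le> n"
  shows "card (({..n} - {i}) \<inter> {j. i mod b = j mod b}) \<le> n div b"
proof -
  let ?S = "{..n} \<inter> {j. i mod b = j mod b}"
  have "inj_on (\<lambda>j. j div b) ?S"
  proof (rule inj_onI)
    fix x y assume "x \<in> ?S" "y \<in> ?S" "x div b = y div b"
    then show "x = y" by (metis IntD2 mem_Collect_eq mult_div_mod_eq)
  qed
  moreover have "(\<lambda>j. j div b) ` ?S \<subseteq> {..n div b}" by (auto intro: div_le_mono)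
  ultimately have "card ?S \<le> card {..n div b}" by (intro card_inj_on_le) auto
  moreover have "({..n} - {i}) \<inter> {j. i mod b = j mod b} = ?S - {i}" by auto
  moreover have "i \<in> ?S" using assms by auto
  ultimately show ?thesis by (simp add: card_Diff_singleton)
qed

lemma wq_eq_sum:
  assumes "n < b ^ N"
  shows "wq b n = (\<Sum>j<N. n div b ^ Suc j)"
proof -
  have "b > 0 \<or> N = 0" using assms by (cases "b = 0") (auto simp: power_0_left split: if_splits)
  have "n div b ^ Suc j = 0" if "j \<notin> {..<N}" for j
  proof (cases "b = 0")
    case False
    then have "b ^ N \<le> b ^ Suc j" using that by (intro power_increasing) auto
    then show ?thesis using assms by simp
  qed auto
  then show ?thesis unfolding wq_def by (intro suminf_finite) auto
qed

context padic_galois_extension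
begin

text \<open>For integral \<open>y\<close> the order is the number of levels \<open>j\<close> with
  \<open>y\<close> in the power \<open>j + 1\<close> of the maximal ideal. Truncation at
  \<open>N\<close> loses nothing when \<open>y\<close> is outside \<open>mideal N\<close>.\<close>

lemma ord_eq_count:
  assumes "y \<in> mideal 0" "y \<noteq> 0"
  shows "int (card ({..<N} \<inter> {j. y \<in> mideal (int (Suc j))})) \<le> ord y"
    and "y \<notin> mideal (int N) \<Longrightarrow> int (card ({..<N} \<inter> {j. y \<in> mideal (int (Suc j))})) = ord y"
proof -
  have "{..<N} \<inter> {j. y \<in> mideal (int (Suc j))} = {..<min N (nat (ord y))}"
    using assms by (auto simp: mideal_iff)
  then have c: "int (card ({..<N} \<inter> {j. y \<in> mideal (int (Suc j))})) = int (min N (nat (ord y)))"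
    by (simp only: card_lessThan)
  have "int (nat (ord y)) = ord y" using assms by (simp add: mideal_iff)
  then show "int (card ({..<N} \<inter> {j. y \<in> mideal (int (Suc j))})) \<le> ord y"
    unfolding c by linarith
  show "int (card ({..<N} \<inter> {j. y \<in> mideal (int (Suc j))})) = ord y" if "y \<notin> mideal (int N)"
  proof -
    have "ord y < int N" using that by (simp add: mideal_iff)
    then show ?thesis unfolding c using \<open>int (nat (ord y)) = ord y\<close> by linarith
  qed
qed

lemma ord_prod: "finite A \<Longrightarrow> (\<And>i. i \<in> A \<Longrightarrow> f i \<noteq> 0) \<Longrightarrow> ord (prod f A) = (\<Sum>i\<in>A. ord (f i))"
  by (induction A rule: finite_induct) (auto simp: ord_mult)

text \<open>Double counting, to pass from orders of single factors to counts per level.\<close>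

lemma sum_card_swap:
  assumes "finite A" "finite B"
  shows "(\<Sum>i\<in>A. card (B \<inter> {j. P i j})) = (\<Sum>j\<in>B. card (A \<inter> {i. P i j}))"
  using sum.swap[of "\<lambda>i j. of_bool (P i j) :: nat" B A] assms by simp

lemma digit_seq_exists:
  obtains a :: "nat \<Rightarrow> 'k" where "\<And>i. a i \<in> mideal 0"
    "\<And>i j k. k \<le> N \<Longrightarrow> a i - a j \<in> mideal (int k) \<longleftrightarrow> i mod q ^ k = j mod q ^ k"
    "\<And>x. x \<in> mideal 0 \<Longrightarrow> \<exists>c. x - a c \<in> mideal (int N)"
proof -
  obtain r :: "nat \<Rightarrow> 'k" where r: "\<And>i. i < q \<Longrightarrow> r i \<in> mideal 0"
    "\<And>x. x \<in> mideal 0 \<Longrightarrow> \<exists>i<q. x - r i \<in> mideal 1"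
    "\<And>i j. i < q \<Longrightarrow> j < q \<Longrightarrow> r i - r j \<in> mideal 1 \<Longrightarrow> i = j"
    by (rule residue_system) blast
  obtain \<pi> where pi: "\<pi> \<noteq> 0" "ord \<pi> = 1" using ex_uniformizer by blast
  have pi_iff: "\<pi> * y \<in> mideal (int (Suc k)) \<longleftrightarrow> y \<in> mideal (int k)" for y k
    using pi by (cases "y = 0") (auto simp: mideal_iff ord_mult)
  have q0: "q > 0" using q_ge_2 by simp
  let ?a = "digit_seq \<pi> r q"
  have a0: "?a N i \<in> mideal 0" for N i
  proof (induction N arbitrary: i)
    case (Suc N)
    have "\<pi> \<in> mideal 0" using pi by (simp add: mideal_iff)
    then show ?case using r(1) q0 Suc by (auto intro!: mideal_add mideal_mult_left)
  qed auto
  have a1: "?a N i - ?a N j \<in> mideal (int k) \<longleftrightarrow> i mod q ^ k = j mod q ^ k" if "k \<le> N" for N i j k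
    using that
  proof (induction N arbitrary: i j k)
    case (Suc N)
    show ?case
    proof (cases k)
      case 0
      then show ?thesis using mideal_diff[OF a0[of "Suc N" i] a0[of "Suc N" j]] by simp
    next
      case (Suc k')
      let ?D = "?a N (i div q) - ?a N (j div q)"
      have eq: "?a (Suc N) i - ?a (Suc N) j = (r (i mod q) - r (j mod q)) + \<pi> * ?D"
        by (simp add: algebra_simps)
      show ?thesis
      proof (cases "i mod q = j mod q")
        case True
        then show ?thesis unfolding Suc eq mod_power_Suc_eq_iff[OF q0]
          using pi_iff[of ?D k'] Suc.IH[of k' "i div q" "j div q"] Suc.prems Suc by simp
      next
        case False
        \<comment> \<open>Different lowest digits are visible already modulo the maximal ideal,
          which contains the \<pi>-multiple of the remaining digits.\<close>
        have "?a (Suc N) i - ?a (Suc N) j \<notin> mideal (int k)"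
        proof
          assume "?a (Suc N) i - ?a (Suc N) j \<in> mideal (int k)"
          then have "?a (Suc N) i - ?a (Suc N) j \<in> mideal 1" by (rule mideal_antimono) (simp add: Suc)
          moreover have "\<pi> * ?D \<in> mideal 1"
            using pi_iff[of ?D 0] mideal_diff[OF a0 a0] by simp
          ultimately have "r (i mod q) - r (j mod q) \<in> mideal 1"
            using mideal_diff[of "?a (Suc N) i - ?a (Suc N) j" 1 "\<pi> * ?D"]
            unfolding eq add_diff_cancel_right' by blast
          then show False using r(3) q0 False by simp
        qed
        then show ?thesis using False mod_power_Suc_eq_iff[OF q0, of i k' j] Suc by simp
      qed
    qed
  qed auto
  have a2: "\<exists>c. x - ?a N c \<in> mideal (int N)" if "x \<in> mideal 0" for x N
    using that
  proof (induction N arbitrary: x)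
    case (Suc N)
    obtain d where d: "d < q" "x - r d \<in> mideal 1" using r(2)[OF Suc.prems] by blast
    \<comment> \<open>Digit extraction: \<open>y\<close> is integral again, and the index
      \<open>d + q * c\<close> puts the digit \<open>d\<close> in front of the digits of
      \<open>c\<close>.\<close>
    define y where "y = (x - r d) / \<pi>"
    have x: "x = r d + \<pi> * y" using pi by (simp add: y_def)
    have "y \<in> mideal 0" using d(2) pi_iff[of y 0] x by simp
    then obtain c where c: "y - ?a N c \<in> mideal (int N)" using Suc.IH by blast
    have "x - ?a (Suc N) (d + q * c) = \<pi> * (y - ?a N c)"
      using d(1) x by (simp add: algebra_simps)
    then show ?case using c pi_iff by metis
  qed auto
  show ?thesis by (rule that[of "?a N"]) (use a0 a1 a2 in auto)
qed

text \<open>The order of a product is counted level by level, as in Legendre's formula for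
  factorials. On level j at least \<open>n div q ^ Suc j\<close> of the points \<open>a i\<close>,
  \<open>i < n\<close>, are close to a given \<open>x\<close>, and at most that many of the other
  points are close to one of the \<open>a i\<close>, \<open>i \<le> n\<close>.\<close>

lemma well_distributed_sequence:
  obtains a :: "nat \<Rightarrow> 'k" where "\<And>i. a i \<in> mideal 0" "inj_on a {..n}"
    "\<And>x. x \<in> mideal 0 \<Longrightarrow> (\<Prod>i<n. x - a i) \<in> mideal (int (wq q n))"
    "\<And>i. i \<le> n \<Longrightarrow> ord (\<Prod>j\<in>{..n} - {i}. a i - a j) \<le> int (wq q n)"
proof -
  define N where "N = n"
  have "n < 2 ^ n" by simp
  also have "2 ^ n \<le> q ^ N" unfolding N_def using q_ge_2 by (intro power_mono) auto
  finally have N: "n < q ^ N" .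
  have q0: "q ^ k > 0" for k using q_ge_2 by simp
  obtain a :: "nat \<Rightarrow> 'k" where a: "\<And>i. a i \<in> mideal 0"
    "\<And>i j k. k \<le> N \<Longrightarrow> a i - a j \<in> mideal (int k) \<longleftrightarrow> i mod q ^ k = j mod q ^ k"
    "\<And>x. x \<in> mideal 0 \<Longrightarrow> \<exists>c. x - a c \<in> mideal (int N)"
    by (rule digit_seq_exists[of N]) blast
  have small: "a i - a j \<notin> mideal (int N)" if "i \<le> n" "j \<le> n" "i \<noteq> j" for i j
    using a(2)[of N i j] that N by simp
  show ?thesis
  proof (rule that[of a])
    show "inj_on a {..n}"
    proof (rule inj_onI, rule ccontr)
      fix i j assume "i \<in> {..n}" "j \<in> {..n}" "a i = a j" "i \<noteq> j"
      then show False using small[of i j] by simp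
    qed
    show "(\<Prod>i<n. x - a i) \<in> mideal (int (wq q n))" if x: "x \<in> mideal 0" for x
    proof (cases "\<exists>i<n. x = a i")
      case True
      then have "(\<Prod>i<n. x - a i) = 0" by (intro prod_zero) auto
      then show ?thesis by (simp only: mideal_0)
    next
      case False
      \<comment> \<open>Up to the precision \<open>N\<close> that is counted, \<open>x\<close> may
        be replaced by a member of the sequence, so closeness becomes congruence of indices.\<close>
      obtain c where c: "x - a c \<in> mideal (int N)" using a(3)[OF x] by blast
      have "n div q ^ Suc j \<le> card ({..<n} \<inter> {i. x - a i \<in> mideal (int (Suc j))})" if "j < N" for j
      proof -
        have "x - a i \<in> mideal (int (Suc j))" if i: "i mod q ^ Suc j = c mod q ^ Suc j" for i
        proof -
          have "x - a c \<in> mideal (int (Suc j))" using c by (rule mideal_antimono) (use \<open>j < N\<close> in simp)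
          moreover have "a c - a i \<in> mideal (int (Suc j))" using a(2)[of "Suc j" c i] \<open>j < N\<close> i by simp
          ultimately show ?thesis by (rule mideal_diff_trans)
        qed
        then have "card ({..<n} \<inter> {i. i mod q ^ Suc j = c mod q ^ Suc j})
            \<le> card ({..<n} \<inter> {i. x - a i \<in> mideal (int (Suc j))})" by (intro card_mono) auto
        then show ?thesis using card_congruent_ge[OF q0[of "Suc j"], of n c] by linarith
      qed
      then have "wq q n \<le> (\<Sum>j<N. card ({..<n} \<inter> {i. x - a i \<in> mideal (int (Suc j))}))"
        unfolding wq_eq_sum[OF N] by (intro sum_mono) auto
      also have "\<dots> = (\<Sum>i<n. card ({..<N} \<inter> {j. x - a i \<in> mideal (int (Suc j))}))"
        by (rule sum_card_swap[symmetric]) auto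
      finally have "int (wq q n) \<le> (\<Sum>i<n. int (card ({..<N} \<inter> {j. x - a i \<in> mideal (int (Suc j))})))"
        unfolding of_nat_sum[symmetric] of_nat_le_iff .
      also have "\<dots> \<le> (\<Sum>i<n. ord (x - a i))"
        using False mideal_diff[OF x a(1)] by (intro sum_mono ord_eq_count(1)) auto
      also have "\<dots> = ord (\<Prod>i<n. x - a i)" using False by (intro ord_prod[symmetric]) auto
      finally show ?thesis by (simp add: mideal_iff)
    qed
    show "ord (\<Prod>j\<in>{..n} - {i}. a i - a j) \<le> int (wq q n)" if i: "i \<le> n" for i
    proof -
      have nz: "a i - a j \<noteq> 0" "a i - a j \<notin> mideal (int N)" if "j \<in> {..n} - {i}" for j
        using small[of i j] that i by auto
      have "ord (\<Prod>j\<in>{..n} - {i}. a i - a j) = (\<Sum>j\<in>{..n} - {i}. ord (a i - a j))"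
        using nz by (intro ord_prod) auto
      also have "\<dots> = (\<Sum>j\<in>{..n} - {i}. int (card ({..<N} \<inter> {k. a i - a j \<in> mideal (int (Suc k))})))"
        using nz mideal_diff[OF a(1) a(1)] by (intro sum.cong refl ord_eq_count(2)[symmetric]) auto
      also have "\<dots> = int (\<Sum>k<N. card (({..n} - {i}) \<inter> {j. a i - a j \<in> mideal (int (Suc k))}))"
        unfolding of_nat_sum[symmetric] by (subst sum_card_swap) auto
      also have "(\<Sum>k<N. card (({..n} - {i}) \<inter> {j. a i - a j \<in> mideal (int (Suc k))}))
          = (\<Sum>k<N. card (({..n} - {i}) \<inter> {j. i mod q ^ Suc k = j mod q ^ Suc k}))"
      proof (intro sum.cong refl)
        fix k assume "k \<in> {..<N}"
        then have "Suc k \<le> N" by simp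
        from a(2)[OF this]
        show "card (({..n} - {i}) \<inter> {j. a i - a j \<in> mideal (int (Suc k))})
            = card (({..n} - {i}) \<inter> {j. i mod q ^ Suc k = j mod q ^ Suc k})" by (simp only:)
      qed
      also have "\<dots> \<le> wq q n"
        unfolding wq_eq_sum[OF N] by (intro sum_mono card_congruent_le q0 i)
      finally show ?thesis by simp
    qed
  qed (use a in auto)
qed

end

subsection \<open>Leading coefficients of integer-valued polynomials\<close>

text \<open>The coefficient of degree n in Lagrange's formula, whose basis polynomials have monic
  numerators of degree n. The formula reproduces \<open>f\<close> because the difference has degree
  at most n but n + 1 roots.\<close>

lemma leading_coeff_Lagrange:
  fixes f :: "'a::field poly"
  assumes deg: "degree f \<le> n" and inj: "inj_on x {..n}"
  shows "coeff f n = (\<Sum>i\<le>n. poly f (x i) / (\<Prod>j\<in>{..n} - {i}. x i - x j))"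
proof -
  define D where "D i = (\<Prod>j\<in>{..n} - {i}. x i - x j)" for i
  define M where "M i = (\<Prod>j\<in>{..n} - {i}. [:- x j, 1:])" for i
  define L where "L = (\<Sum>i\<le>n. smult (poly f (x i) / D i) (M i))"
  have D: "D i \<noteq> 0" if "i \<le> n" for i
    using inj that by (auto simp: D_def inj_on_def)
  have M_eval: "poly (M i) (x m) = (if i = m then D m else 0)" if "m \<le> n" for i m
  proof (cases "i = m")
    case True
    then show ?thesis by (simp add: M_def D_def poly_prod)
  next
    case False
    then have "(\<Prod>j\<in>{..n} - {i}. poly [:- x j, 1:] (x m)) = 0"
      using that by (intro prod_zero) auto
    then show ?thesis using False by (simp add: M_def poly_prod)
  qed
  have M_deg: "degree (M i) = n" if "i \<le> n" for i
    unfolding M_def using that by (subst degree_prod_eq_sum_degree) auto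
  have M_coeff: "coeff (M i) n = 1" if "i \<le> n" for i
  proof -
    have "lead_coeff (M i) = 1" unfolding M_def by (simp add: lead_coeff_prod)
    then show ?thesis using M_deg[OF that] by simp
  qed
  have L_deg: "degree L \<le> n"
    unfolding L_def using M_deg by (intro degree_sum_le) (auto intro: order.trans[OF degree_smult_le])
  have L_eval: "poly L (x m) = poly f (x m)" if "m \<le> n" for m
  proof -
    have "poly L (x m) = (\<Sum>i\<le>n. if i = m then poly f (x m) else 0)"
      unfolding L_def poly_sum using that D[of m] by (intro sum.cong) (auto simp: M_eval)
    then show ?thesis using that by simp
  qed
  have "f = L"
  proof (rule ccontr)
    assume "f \<noteq> L"
    then have nz: "f - L \<noteq> 0" by simp
    have "x ` {..n} \<subseteq> {y. poly (f - L) y = 0}" using L_eval by auto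
    then have "card (x ` {..n}) \<le> card {y. poly (f - L) y = 0}"
      by (intro card_mono poly_roots_finite nz)
    also have "\<dots> \<le> degree (f - L)" by (rule card_poly_roots_bound[OF nz])
    also have "\<dots> \<le> n" using deg L_deg by (rule degree_diff_le)
    finally show False using inj by (simp add: card_image)
  qed
  then have "coeff f n = coeff L n" by simp
  then show ?thesis unfolding L_def D_def[symmetric] by (simp add: coeff_sum M_coeff)
qed

context padic_galois_extension
begin

lemma mideal_divide: "x \<in> mideal 0 \<Longrightarrow> y \<noteq> 0 \<Longrightarrow> ord y \<le> m \<Longrightarrow> x / y \<in> mideal (- m)"
  using mideal_mult[of x 0 "inverse y" "- m"] by (simp add: mideal_iff ord_inverse divide_inverse)

lemma lead_coeff_integer_valued:
  assumes "f \<in> int_valued_polys \<iota>"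
  shows "lead_coeff f \<in> padic_ideal (- int (wq q (degree f) div e))"
proof -
  let ?n = "degree f"
  obtain a :: "nat \<Rightarrow> 'k" where a: "\<And>i. a i \<in> mideal 0" "inj_on a {..?n}"
    "\<And>i. i \<le> ?n \<Longrightarrow> ord (\<Prod>j\<in>{..?n} - {i}. a i - a j) \<le> int (wq q ?n)"
    by (rule well_distributed_sequence[of ?n]) blast
  let ?F = "map_poly \<iota> f"
  have "\<iota> (lead_coeff f) = coeff ?F ?n" by (simp add: coeff_map_poly)
  also have "\<dots> = (\<Sum>i\<le>?n. poly ?F (a i) / (\<Prod>j\<in>{..?n} - {i}. a i - a j))"
    by (rule leading_coeff_Lagrange[OF _ a(2)]) (rule degree_map_poly_le)
  also have "\<dots> \<in> mideal (- int (wq q ?n))"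
  proof (intro mideal_sum mideal_divide)
    fix i assume i: "i \<in> {..?n}"
    show "poly ?F (a i) \<in> mideal 0"
      using assms a(1)[of i] by (auto simp: int_valued_polys_def valuation_ring_eq)
    show "(\<Prod>j\<in>{..?n} - {i}. a i - a j) \<noteq> 0" using a(2) i by (auto simp: inj_on_def)
    show "ord (\<Prod>j\<in>{..?n} - {i}. a i - a j) \<le> int (wq q ?n)" using a(3) i by simp
  qed
  finally have l: "\<iota> (lead_coeff f) \<in> mideal (- int (wq q ?n))" .
  show ?thesis
  proof (cases "lead_coeff f = 0")
    case False
    then have "- int (wq q ?n) \<le> int e * pval (lead_coeff f)"
      using l by (simp add: mideal_iff ord_emb)
    \<comment> \<open>The order of an element of the base field is \<open>e\<close> times an
      integer, so the bound \<open>wq q n\<close> can be rounded down after division by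
      \<open>e\<close>.\<close>
    then have "- pval (lead_coeff f) * int e \<le> int (wq q ?n)" by (simp add: mult.commute)
    then have "- pval (lead_coeff f) * int e div int e \<le> int (wq q ?n) div int e"
      using ramification_index_pos by (intro zdiv_mono1) auto
    then have "- pval (lead_coeff f) \<le> int (wq q ?n) div int e"
      using ramification_index_pos by (subst (asm) nonzero_mult_div_cancel_right) auto
    then show ?thesis by (simp add: padic_ideal_iff zdiv_int)
  qed simp
qed

subsection \<open>Tame ramification and the trace\<close>

text \<open>Dedekind's argument: subtracting \<open>\<tau> y\<close> times the relation at \<open>x\<close> from the relation at \<open>x * y\<close>
  eliminates \<open>\<tau>\<close>.\<close>

lemma independence_mod_mideal:
  assumes "finite S" "S \<subseteq> aut" "\<And>\<sigma>. \<sigma> \<in> S \<Longrightarrow> c \<sigma> \<in> mideal 0"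
    and distinct: "\<And>\<sigma> \<tau>. \<sigma> \<in> S \<Longrightarrow> \<tau> \<in> S \<Longrightarrow> \<sigma> \<noteq> \<tau> \<Longrightarrow> \<exists>x\<in>mideal 0. \<sigma> x - \<tau> x \<notin> mideal 1"
    and "\<And>x. x \<in> mideal 0 \<Longrightarrow> (\<Sum>\<sigma>\<in>S. c \<sigma> * \<sigma> x) \<in> mideal 1"
  shows "\<forall>\<sigma>\<in>S. c \<sigma> \<in> mideal 1"
  using assms
proof (induction S arbitrary: c rule: finite_induct)
  case (insert \<tau> S)
  have aut: "\<sigma> \<in> aut" if "\<sigma> \<in> insert \<tau> S" for \<sigma> using insert.prems(1) that by auto
  have int: "\<sigma> y \<in> mideal 0" if "\<sigma> \<in> insert \<tau> S" "y \<in> mideal 0" for \<sigma> y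
    using mideal_aut[OF aut[OF that(1)] that(2)] .
  have S: "c \<sigma> \<in> mideal 1" if s: "\<sigma> \<in> S" for \<sigma>
  proof -
    obtain y where y: "y \<in> mideal 0" "\<sigma> y - \<tau> y \<notin> mideal 1"
      using insert.prems(3)[of \<sigma> \<tau>] s insert.hyps by auto
    have "\<forall>\<rho>\<in>S. c \<rho> * (\<rho> y - \<tau> y) \<in> mideal 1"
    proof (rule insert.IH)
      show "c \<rho> * (\<rho> y - \<tau> y) \<in> mideal 0" if "\<rho> \<in> S" for \<rho>
        using insert.prems(2) int y(1) that by (intro mideal_mult_left mideal_diff) auto
      fix x assume x: "x \<in> mideal 0"
      have "(\<Sum>\<rho>\<in>insert \<tau> S. c \<rho> * \<rho> (x * y)) - \<tau> y * (\<Sum>\<rho>\<in>insert \<tau> S. c \<rho> * \<rho> x)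
          = (\<Sum>\<rho>\<in>insert \<tau> S. c \<rho> * (\<rho> x * \<rho> y) - \<tau> y * (c \<rho> * \<rho> x))"
        using aut_simps(3)[OF aut] by (simp add: sum_subtractf sum_distrib_left del: sum.insert insert_iff cong: sum.cong)
      also have "\<dots> = (\<Sum>\<rho>\<in>S. c \<rho> * (\<rho> y - \<tau> y) * \<rho> x)"
        using insert.hyps by (simp add: algebra_simps)
      finally have "(\<Sum>\<rho>\<in>S. c \<rho> * (\<rho> y - \<tau> y) * \<rho> x)
          = (\<Sum>\<rho>\<in>insert \<tau> S. c \<rho> * \<rho> (x * y)) - \<tau> y * (\<Sum>\<rho>\<in>insert \<tau> S. c \<rho> * \<rho> x)" by (rule sym)
      also have "\<dots> \<in> mideal 1"
        using insert.prems(4)[of "x * y"] insert.prems(4)[of x] x y(1) int[of \<tau> y]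
        by (intro mideal_diff mideal_mult_left) (auto intro: mideal_mult_left simp del: sum.insert)
      finally show "(\<Sum>\<rho>\<in>S. c \<rho> * (\<rho> y - \<tau> y) * \<rho> x) \<in> mideal 1" .
    qed (use insert.prems in auto)
    then have "c \<sigma> * (\<sigma> y - \<tau> y) \<in> mideal 1" using s by blast
    moreover have "\<sigma> y - \<tau> y \<in> mideal 0" using s y(1) int by (intro mideal_diff) auto
    ultimately show ?thesis using mideal_prime y(2) insert.prems(2) s by blast
  qed
  \<comment> \<open>The eliminated coefficient is recovered from the relation at 1, once all others
    are known to be in the maximal ideal.\<close>
  have "c \<tau> * \<tau> 1 = (\<Sum>\<sigma>\<in>insert \<tau> S. c \<sigma> * \<sigma> 1) - (\<Sum>\<sigma>\<in>S. c \<sigma> * \<sigma> 1)"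
    using insert.hyps by simp
  also have "\<dots> \<in> mideal 1"
  proof (rule mideal_diff)
    show "(\<Sum>\<sigma>\<in>insert \<tau> S. c \<sigma> * \<sigma> 1) \<in> mideal 1" by (rule insert.prems(4)) simp
    show "(\<Sum>\<sigma>\<in>S. c \<sigma> * \<sigma> 1) \<in> mideal 1"
      using S int[of _ 1] by (intro mideal_sum mideal_mult_right) auto
  qed
  finally have "c \<tau> \<in> mideal 1" using aut_simps(5)[OF aut[of \<tau>]] by simp
  then show ?case using S by blast
qed simp

definition inertia :: "('k \<Rightarrow> 'k) set" where
  "inertia = {\<sigma> \<in> aut. \<forall>x\<in>mideal 0. \<sigma> x - x \<in> mideal 1}"

text \<open>Otherwise a Bezout relation between p and n would put 1 into the maximal ideal.\<close>

lemma of_nat_in_maximal_ideal_imp: "of_nat n \<in> mideal 1 \<Longrightarrow> CARD('p) dvd n"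
proof (rule ccontr)
  assume n: "of_nat n \<in> mideal 1" and "\<not> CARD('p) dvd n"
  then have "coprime (int CARD('p)) (int n)"
    using prime_card[where 'a='p] prime_imp_coprime by auto
  then obtain u v where "u * int CARD('p) + v * int n = 1"
    by (metis bezout_int coprime_iff_gcd_eq_1)
  then have "(of_int u * of_nat CARD('p) + of_int v * of_nat n :: 'k) = 1"
    by (metis of_int_1 of_int_add of_int_mult of_int_of_nat_eq)
  moreover have "of_int w \<in> mideal 0" for w
  proof (cases "w \<ge> 0")
    case True
    then show ?thesis using of_nat_mideal[of "nat w"] by simp
  next
    case False
    then show ?thesis using mideal_uminus[OF of_nat_mideal[of "nat (- w)"]] by simp
  qed
  then have "of_int u * of_nat CARD('p) + of_int v * of_nat n \<in> mideal 1"
    using n prime_mideal by (intro mideal_add mideal_mult_left)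
  ultimately show False using one_notin_mideal by simp
qed

text \<open>Automorphisms inducing the same map on the residue field are grouped together. Modulo
  the maximal ideal the trace becomes a combination of pairwise distinct maps with the class sizes
  as coefficients; by independence all of these vanish modulo p, in particular for the class of
  \<open>id\<close>.\<close>

lemma prime_dvd_card_inertia:
  assumes "\<And>x. x \<in> mideal 0 \<Longrightarrow> (\<Sum>\<sigma>\<in>aut. \<sigma> x) \<in> mideal 1"
  shows "CARD('p) dvd card inertia"
proof -
  define R where "R = {(\<sigma>, \<tau>). \<sigma> \<in> aut \<and> \<tau> \<in> aut \<and> (\<forall>x\<in>mideal 0. \<sigma> x - \<tau> x \<in> mideal 1)}"
  have equiv: "equiv aut R"
  proof (rule equivI)
    show "R \<subseteq> aut \<times> aut" "refl_on aut R" by (auto simp: R_def refl_on_def)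
    show "sym R" unfolding R_def sym_def using mideal_diff_commute by blast
    show "trans R" unfolding R_def trans_def using mideal_diff_trans by blast
  qed
  \<comment> \<open>\<open>id\<close> represents its own class, so that its coefficient is literally
    the order of the inertia group.\<close>
  define rep where "rep c = (if id \<in> c then id else (SOME \<sigma>. \<sigma> \<in> c))" for c :: "('k \<Rightarrow> 'k) set"
  have rep: "rep c \<in> c" if "c \<in> aut // R" for c
    using in_quotient_imp_non_empty[OF equiv that] some_in_eq[of c] by (simp add: rep_def)
  have sub: "c \<subseteq> aut" if "c \<in> aut // R" for c using in_quotient_imp_subset[OF equiv that] .
  have fin: "finite (aut // R)" "\<And>c. c \<in> aut // R \<Longrightarrow> finite c"
  proof -
    show "finite (aut // R)" by (rule finite_quotient[OF finite_aut]) (auto simp: R_def)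
    show "finite c" if "c \<in> aut // R" for c using finite_subset[OF sub[OF that] finite_aut] .
  qed
  have inj: "inj_on rep (aut // R)"
    using rep quotient_disj[OF equiv] by (fastforce intro!: inj_onI)
  have cls: "(rep c, \<sigma>) \<in> R" if "c \<in> aut // R" "\<sigma> \<in> c" for c \<sigma>
    using quotient_eq_iff[OF equiv that(1) that(1) rep[OF that(1)] that(2)] by simp
  have "\<forall>\<tau>\<in>rep ` (aut // R). of_nat (card (R `` {\<tau>})) \<in> mideal 1"
  proof (rule independence_mod_mideal)
    show "finite (rep ` (aut // R))" using fin by simp
    show "rep ` (aut // R) \<subseteq> aut" using rep sub by blast
    show "of_nat (card (R `` {\<tau>})) \<in> mideal 0" for \<tau> by (rule of_nat_mideal)
    show "\<exists>x\<in>mideal 0. \<sigma> x - \<tau> x \<notin> mideal 1"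
      if st: "\<sigma> \<in> rep ` (aut // R)" "\<tau> \<in> rep ` (aut // R)" "\<sigma> \<noteq> \<tau>" for \<sigma> \<tau>
    proof (rule ccontr)
      assume *: "\<not> (\<exists>x\<in>mideal 0. \<sigma> x - \<tau> x \<notin> mideal 1)"
      obtain c d where cd: "c \<in> aut // R" "\<sigma> = rep c" "d \<in> aut // R" "\<tau> = rep d" using st by auto
      have "(\<sigma>, \<tau>) \<in> R" unfolding R_def using * rep sub cd by auto
      then have "c = d" using quotient_eq_iff[OF equiv cd(1) cd(3)] rep cd by blast
      then show False using st cd by simp
    qed
    fix x assume x: "x \<in> mideal 0"
    have Rc: "R `` {rep c} = c" if "c \<in> aut // R" for c
      using that rep[OF that] equiv by (metis Image_singleton_iff equiv_class_eq_iff quotientE subsetI)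
    have "(\<Sum>\<sigma>\<in>aut. \<sigma> x) = (\<Sum>c\<in>aut // R. \<Sum>\<sigma>\<in>c. \<sigma> x)"
      using fin quotient_disj[OF equiv] Union_quotient[OF equiv]
      by (subst Union_quotient[OF equiv, symmetric], subst sum.Union_disjoint) auto
    moreover have "(\<Sum>\<tau>\<in>rep ` (aut // R). of_nat (card (R `` {\<tau>})) * \<tau> x)
        = (\<Sum>c\<in>aut // R. \<Sum>\<sigma>\<in>c. rep c x)"
      using Rc by (simp add: sum.reindex[OF inj])
    ultimately have "(\<Sum>\<sigma>\<in>aut. \<sigma> x) - (\<Sum>\<tau>\<in>rep ` (aut // R). of_nat (card (R `` {\<tau>})) * \<tau> x)
        = (\<Sum>c\<in>aut // R. \<Sum>\<sigma>\<in>c. \<sigma> x - rep c x)" by (simp add: sum_subtractf)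
    also have "\<dots> \<in> mideal 1"
      using cls x mideal_diff_commute unfolding R_def by (intro mideal_sum) blast
    finally show "(\<Sum>\<tau>\<in>rep ` (aut // R). of_nat (card (R `` {\<tau>})) * \<tau> x) \<in> mideal 1"
      using mideal_diff[OF assms[OF x]] by fastforce
  qed
  moreover have "id \<in> rep ` (aut // R)"
  proof -
    have "R `` {id} \<in> aut // R" using id_in_aut by (rule quotientI)
    moreover have "rep (R `` {id}) = id" using id_in_aut by (auto simp: rep_def R_def)
    ultimately show ?thesis by force
  qed
  moreover have "R `` {id} = inertia"
    using id_in_aut mideal_diff_commute by (auto simp: R_def inertia_def)
  ultimately show ?thesis using of_nat_in_maximal_ideal_imp by metis
qed


section \<open>Frobenius on the residue field and norms from the fixed field\<close>

lemma of_nat_dvd_mideal: "CARD('p) dvd n \<Longrightarrow> of_nat n \<in> mideal 1"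
  using mideal_mult_right[OF prime_mideal of_nat_mideal] by (auto elim!: dvdE)

text \<open>Expand \<open>a = b + c\<close>: the inner binomial coefficients are divisible by p, so
  \<open>c ^ p\<close> is in the maximal ideal, and then so is \<open>c\<close>.\<close>

lemma frobenius_inj_mod_mideal:
  assumes "a \<in> mideal 0" "b \<in> mideal 0" "a ^ CARD('p) - b ^ CARD('p) \<in> mideal 1"
  shows "a - b \<in> mideal 1"
proof -
  let ?p = "CARD('p)"
  have p: "prime ?p" by (rule prime_card)
  define c where "c = a - b"
  have c: "c \<in> mideal 0" unfolding c_def using assms by (intro mideal_diff)
  have p1: "?p > 1" using p prime_gt_1_nat by blast
  have split: "{..?p} = insert 0 (insert ?p {0<..<?p})" using p1 by auto
  have "a ^ ?p = (b + c) ^ ?p" by (simp add: c_def)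
  also have "\<dots> = (\<Sum>k\<le>?p. of_nat (?p choose k) * b ^ k * c ^ (?p - k))" by (rule binomial_ring)
  also have "\<dots> = c ^ ?p + b ^ ?p + (\<Sum>k\<in>{0<..<?p}. of_nat (?p choose k) * b ^ k * c ^ (?p - k))"
    unfolding split using p1 by simp
  finally have "c ^ ?p = (a ^ ?p - b ^ ?p) - (\<Sum>k\<in>{0<..<?p}. of_nat (?p choose k) * b ^ k * c ^ (?p - k))"
    by (simp add: algebra_simps)
  also have "\<dots> \<in> mideal 1"
  proof (rule mideal_diff[OF assms(3)])
    show "(\<Sum>k\<in>{0<..<?p}. of_nat (?p choose k) * b ^ k * c ^ (?p - k)) \<in> mideal 1"
      using assms c dvd_choose_prime[OF _ _ _ p]
      by (intro mideal_sum mideal_mult_right of_nat_dvd_mideal mideal_power) auto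
  qed
  finally have "c ^ ?p \<in> mideal 1" .
  then have "c = 0 \<or> 1 \<le> int ?p * ord c"
    by (cases "c = 0") (simp_all add: mideal_iff ord_power)
  then have "c = 0 \<or> 0 < ord c" by (smt (verit) mult_nonneg_nonpos of_nat_0_le_iff)
  then show ?thesis unfolding c_def[symmetric] by (auto simp: mideal_iff)
qed

lemma frobenius_power_inj_mod_mideal:
  assumes "a \<in> mideal 0" "b \<in> mideal 0" "a ^ (CARD('p) ^ i) - b ^ (CARD('p) ^ i) \<in> mideal 1"
  shows "a - b \<in> mideal 1"
  using assms(3)
proof (induction i)
  case (Suc i)
  have "(a ^ (CARD('p) ^ i)) ^ CARD('p) - (b ^ (CARD('p) ^ i)) ^ CARD('p) \<in> mideal 1"
    using Suc.prems by (simp only: power_Suc2 power_mult)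
  then have "a ^ (CARD('p) ^ i) - b ^ (CARD('p) ^ i) \<in> mideal 1"
    by (rule frobenius_inj_mod_mideal[OF mideal_power[OF assms(1)] mideal_power[OF assms(2)]])
  then show ?case by (rule Suc.IH)
qed simp

text \<open>Two of the powers \<open>u ^ (p ^ i)\<close> agree by the pigeonhole principle;
  injectivity of Frobenius cancels the smaller exponent. The form \<open>Suc f\<close> leaves one
  p-th power to be supplied by a norm.\<close>

lemma residue_power_eq_self:
  assumes u: "u \<in> mideal 0"
  obtains f where "u ^ (CARD('p) ^ Suc f) - u \<in> mideal 1"
proof -
  obtain r :: "nat \<Rightarrow> 'k" where r: "\<And>x. x \<in> mideal 0 \<Longrightarrow> \<exists>i<q. x - r i \<in> mideal 1"
    by (rule residue_system) blast
  have "\<exists>d. \<forall>i. d i < q \<and> u ^ (CARD('p) ^ i) - r (d i) \<in> mideal 1"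
    using r[OF mideal_power[OF u]] by (intro choice) blast
  then obtain d where d: "\<And>i. d i < q" "\<And>i. u ^ (CARD('p) ^ i) - r (d i) \<in> mideal 1" by blast
  have "range d \<subseteq> {..<q}" using d by auto
  then have "\<not> inj d" using finite_subset[OF _ finite_lessThan] infinite_UNIV_nat finite_imageD by blast
  then obtain i0 j0 where "d i0 = d j0" "i0 \<noteq> j0" by (auto simp: inj_def)
  then obtain i j where ij: "d i = d j" "i < j" by (metis linorder_neqE_nat)
  obtain f where f: "j = i + Suc f" using ij(2) less_iff_Suc_add by auto
  have "u ^ (CARD('p) ^ j) - u ^ (CARD('p) ^ i) \<in> mideal 1"
    using d(2)[of i] d(2)[of j] ij(1) mideal_diff_commute mideal_diff_trans by metis
  then have "(u ^ (CARD('p) ^ Suc f)) ^ (CARD('p) ^ i) - u ^ (CARD('p) ^ i) \<in> mideal 1"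
    unfolding f power_add[of _ i] by (simp only: power_mult[symmetric] mult.commute)
  then show ?thesis using that u by (blast intro: frobenius_power_inj_mod_mideal mideal_power)
qed

lemma mideal_prod_cong:
  assumes "\<And>i. i \<in> A \<Longrightarrow> f i \<in> mideal 0" "\<And>i. i \<in> A \<Longrightarrow> g i \<in> mideal 0"
    "\<And>i. i \<in> A \<Longrightarrow> f i - g i \<in> mideal 1"
  shows "prod f A - prod g A \<in> mideal 1"
  using assms
proof (induction A rule: infinite_finite_induct)
  case (insert a A)
  have "prod f (insert a A) - prod g (insert a A) = f a * (prod f A - prod g A) + (f a - g a) * prod g A"
    using insert.hyps by (simp add: algebra_simps)
  also have "\<dots> \<in> mideal 1"
    using insert by (intro mideal_add mideal_mult_left mideal_mult_right[of _ 1] mideal_prod) auto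
  finally show ?case .
qed auto

lemma mideal_power_cong:
  assumes "a \<in> mideal 0" "b \<in> mideal 0" "a - b \<in> mideal 1"
  shows "a ^ n - b ^ n \<in> mideal 1"
  using mideal_prod_cong[of "{..<n}" "\<lambda>_. a" "\<lambda>_. b"] assms by simp

lemma aut_power_int: "\<sigma> \<in> aut \<Longrightarrow> \<sigma> (x powi k) = \<sigma> x powi k"
proof -
  assume "\<sigma> \<in> aut"
  then interpret field_hom \<sigma> by (rule autD)
  show ?thesis by (cases "k \<ge> 0") (simp_all add: power_int_def hom_power hom_inverse)
qed

lemma aut_of_nat: "\<sigma> \<in> aut \<Longrightarrow> \<sigma> (of_nat n) = of_nat n"
  by (induction n) (simp_all add: aut_simps)

text \<open>If \<open>p\<close> does not divide \<open>e\<close>, norms from \<open>K\<close> to the fixed field of \<open>P\<close> realise every value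
  (with the help of powers of \<open>p\<close>) and, as \<open>P\<close> acts trivially on the residue field, every residue
  class. Hence elements of the fixed field approximate every \<open>x\<close> arbitrarily well.\<close>

lemma inertia_subgroup_trivial:
  assumes P: "P \<subseteq> inertia" "finite P" "card P = CARD('p)"
    and comp: "\<And>\<sigma>. \<sigma> \<in> P \<Longrightarrow> bij_betw (\<lambda>\<tau>. \<sigma> \<circ> \<tau>) P P"
    and tame: "\<not> CARD('p) dvd e"
    and s: "\<sigma> \<in> P"
  shows "\<sigma> x = x"
proof -
  define F where "F = {y. \<forall>\<tau>\<in>P. \<tau> y = y}"
  have aut: "\<tau> \<in> aut" if "\<tau> \<in> P" for \<tau> using that P(1) by (auto simp: inertia_def)
  have inert: "\<tau> y - y \<in> mideal 1" if "\<tau> \<in> P" "y \<in> mideal 0" for \<tau> y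
    using that P(1) by (auto simp: inertia_def)
  have F_I: "y \<in> F" if "\<And>\<tau>. \<tau> \<in> P \<Longrightarrow> \<tau> \<in> aut \<Longrightarrow> \<tau> y = y" for y
    using that aut by (simp add: F_def)
  have F_D: "\<tau> y = y" if "y \<in> F" "\<tau> \<in> P" for \<tau> y
    using that by (simp add: F_def)
  have F_mult: "y * z \<in> F" if "y \<in> F" "z \<in> F" for y z
    using F_D[OF that(1)] F_D[OF that(2)] by (intro F_I) (metis aut_simps(3))
  have F_add: "y + z \<in> F" if "y \<in> F" "z \<in> F" for y z
    using F_D[OF that(1)] F_D[OF that(2)] by (intro F_I) (metis aut_simps(1))
  have F_power: "y ^ n \<in> F" if "y \<in> F" for y n
    using F_D[OF that] by (intro F_I) (metis aut_simps(6))
  have F_powi: "y powi k \<in> F" if "y \<in> F" for y k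
    using F_D[OF that] by (intro F_I) (metis aut_power_int)
  have F_nat: "of_nat n \<in> F" for n by (intro F_I) (rule aut_of_nat)
  define N where "N y = (\<Prod>\<tau>\<in>P. \<tau> y)" for y
  have N_F: "N y \<in> F" for y
  proof -
    have "\<sigma> (N y) = N y" if t: "\<sigma> \<in> P" for \<sigma>
      using prod.reindex_bij_betw[OF comp[OF t], of "\<lambda>\<tau>. \<tau> y"]
      by (simp add: N_def aut_simps(8)[OF aut[OF t]])
    then show ?thesis by (simp add: F_def)
  qed
  have N_nz: "N y \<noteq> 0" if "y \<noteq> 0" for y
    using that aut_simps(9)[OF aut] P(2) by (auto simp: N_def)
  have N_ord: "ord (N y) = int CARD('p) * ord y" if "y \<noteq> 0" for y
  proof -
    have "ord (N y) = (\<Sum>\<tau>\<in>P. ord (\<tau> y))"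
      unfolding N_def using that P(2) aut_simps(9)[OF aut] by (intro ord_prod) auto
    also have "\<dots> = (\<Sum>\<tau>\<in>P. ord y)" using ord_aut[OF aut] by (intro sum.cong) auto
    finally show ?thesis using P(3) by simp
  qed
  have N_cong: "N u - u ^ CARD('p) \<in> mideal 1" if "u \<in> mideal 0" for u
    using mideal_prod_cong[of P "\<lambda>\<tau>. \<tau> u" "\<lambda>_. u"] that mideal_aut[OF aut] inert P(3)
    by (simp add: N_def)
  have "coprime (int CARD('p)) (int e)"
    using tame prime_card[where 'a='p] prime_imp_coprime by auto
  then obtain c d where cd: "c * int CARD('p) + d * int e = 1"
    by (metis bezout_int coprime_iff_gcd_eq_1)
  have approx: "\<exists>y\<in>F. z - y \<in> mideal (ord z + 1)" if z: "z \<noteq> 0" for z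
  proof -
    \<comment> \<open>The Bezout coefficients combine the order \<open>p * ord z\<close> of the norm
      with the order \<open>e\<close> of p, so that \<open>y\<close> in the fixed field has exactly
      the order of \<open>z\<close>.\<close>
    define y where "y = N z powi c * of_nat CARD('p) powi (d * ord z)"
    have y: "y \<in> F" "y \<noteq> 0" using N_F F_powi F_nat F_mult N_nz[OF z] by (auto simp: y_def)
    have "ord y = c * (int CARD('p) * ord z) + int e * (d * ord z)"
      using N_nz[OF z] by (simp add: y_def ord_mult ord_power_int N_ord[OF z] ord_prime_power del: of_nat_mult)
    also have "\<dots> = (c * int CARD('p) + d * int e) * ord z" by (simp add: algebra_simps)
    finally have ord_y: "ord y = ord z" using cd by simp
    define u where "u = z / y"
    have zu: "z = y * u" using y by (simp add: u_def)
    then have "u \<noteq> 0" using z by auto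
    then have u0: "u \<in> mideal 0" using zu ord_mult[of y u] y ord_y by (simp add: mideal_iff)
    obtain f where f: "u ^ (CARD('p) ^ Suc f) - u \<in> mideal 1" using residue_power_eq_self[OF u0] .
    have N0: "N u \<in> mideal 0" unfolding N_def using mideal_aut[OF aut u0] by (intro mideal_prod)
    \<comment> \<open>Since \<open>N u\<close> is congruent to \<open>u ^ p\<close>, raising it to
      the power \<open>p ^ f\<close> closes the Frobenius cycle and returns the residue of
      \<open>u\<close>.\<close>
    have "N u ^ (CARD('p) ^ f) - (u ^ CARD('p)) ^ (CARD('p) ^ f) \<in> mideal 1"
      using N0 u0 N_cong by (intro mideal_power_cong mideal_power)
    then have "N u ^ (CARD('p) ^ f) - u ^ (CARD('p) ^ Suc f) \<in> mideal 1"
      by (simp add: power_mult[symmetric])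
    then have *: "u - N u ^ (CARD('p) ^ f) \<in> mideal 1"
      using f mideal_diff_trans mideal_diff_commute by blast
    have "z - y * N u ^ (CARD('p) ^ f) = y * (u - N u ^ (CARD('p) ^ f))"
      by (simp add: zu algebra_simps)
    also have "\<dots> \<in> mideal (ord z + 1)"
      using * by (intro mideal_mult) (simp_all add: mideal_iff ord_y)
    finally show ?thesis using F_mult[OF y(1) F_power[OF N_F]] by blast
  qed
  have approx_n: "\<exists>y\<in>F. x - y \<in> mideal (ord x + int k)" for k
  proof (induction k)
    case 0
    have "0 \<in> F" using F_nat[of 0] by simp
    then show ?case by (intro bexI[of _ 0]) (simp_all add: mideal_iff)
  next
    case (Suc k)
    then obtain y where y: "y \<in> F" "x - y \<in> mideal (ord x + int k)" by blast
    show ?case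
    proof (cases "x - y \<in> mideal (ord x + int (Suc k))")
      case False
      then have nz: "x - y \<noteq> 0" and eq: "ord (x - y) + 1 = ord x + int (Suc k)"
        using y(2) by (auto simp: mideal_iff)
      obtain w where "w \<in> F" "x - y - w \<in> mideal (ord x + int (Suc k))"
        using approx[OF nz] unfolding eq by blast
      then show ?thesis using F_add[OF y(1)] by (metis diff_diff_add)
    qed (use y in blast)
  qed
  \<comment> \<open>The approximation \<open>y\<close> is fixed by \<sigma>, which also preserves
    orders, so only the approximation error contributes.\<close>
  have "\<sigma> x - x \<in> mideal (ord x + int k)" for k
  proof -
    obtain y where y: "y \<in> F" "x - y \<in> mideal (ord x + int k)" using approx_n by blast
    have "\<sigma> x - x = \<sigma> (x - y) - (x - y)"
      using F_D[OF y(1) s] by (simp add: aut_simps(2)[OF aut[OF s]])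
    also have "\<dots> \<in> mideal (ord x + int k)" by (rule mideal_diff[OF mideal_aut[OF aut[OF s] y(2)] y(2)])
    finally show ?thesis .
  qed
  from this[of "nat (ord (\<sigma> x - x) - ord x + 1)"] show ?thesis
    by (auto simp: mideal_iff split: if_splits)
qed

section \<open>The inertia group has order prime to p\<close>

lemma inertia_comp: "\<sigma> \<in> inertia \<Longrightarrow> \<tau> \<in> inertia \<Longrightarrow> \<sigma> \<circ> \<tau> \<in> inertia"
  unfolding inertia_def
proof (clarsimp simp: comp_in_aut)
  fix x assume *: "\<sigma> \<in> aut" "\<tau> \<in> aut" "\<forall>x\<in>mideal 0. \<sigma> x - x \<in> mideal 1"
    "\<forall>x\<in>mideal 0. \<tau> x - x \<in> mideal 1" "x \<in> mideal 0"
  then have "\<sigma> (\<tau> x) - \<tau> x \<in> mideal 1" using mideal_aut by blast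
  then show "\<sigma> (\<tau> x) - x \<in> mideal 1" using * mideal_diff_trans by blast
qed

lemma inertia_inv: "\<sigma> \<in> inertia \<Longrightarrow> inv_into UNIV \<sigma> \<in> inertia"
proof -
  assume s: "\<sigma> \<in> inertia"
  then have a: "\<sigma> \<in> aut" by (simp add: inertia_def)
  let ?t = "inv_into UNIV \<sigma>"
  have t: "?t \<in> aut" using a by (rule inv_in_aut)
  have "?t x - x \<in> mideal 1" if "x \<in> mideal 0" for x
  proof -
    have "\<sigma> (?t x) - ?t x \<in> mideal 1" using s mideal_aut[OF t that] by (simp add: inertia_def)
    then show ?thesis
      using mideal_diff_commute autD(2)[OF a] by (simp add: bij_is_surj surj_f_inv_f)
  qed
  then show ?thesis using t by (simp add: inertia_def)
qed

lemma not_dvd_card_inertia: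
  assumes tame: "\<not> CARD('p) dvd e"
  shows "\<not> CARD('p) dvd card inertia"
proof
  assume "CARD('p) dvd card inertia"
  \<comment> \<open>Sylow's theorem is applied with exponent 1, where \<open>m\<close> may still be
    divisible by p: a subgroup of order exactly p is wanted, not a full Sylow subgroup.\<close>
  then obtain m where m: "card inertia = CARD('p) ^ 1 * m" by auto
  define G :: "('k \<Rightarrow> 'k) monoid" where "G = \<lparr>carrier = inertia, monoid.mult = (\<circ>), monoid.one = id\<rparr>"
  have id: "id \<in> inertia" using id_in_aut by (simp add: inertia_def)
  have "group G"
  proof (rule groupI)
    fix \<sigma> assume s: "\<sigma> \<in> carrier G"
    then have "bij \<sigma>" by (auto simp: G_def inertia_def autD(2))
    then have "inv_into UNIV \<sigma> \<otimes>\<^bsub>G\<^esub> \<sigma> = \<one>\<^bsub>G\<^esub>" by (simp add: G_def bij_is_inj)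
    then show "\<exists>\<tau>\<in>carrier G. \<tau> \<otimes>\<^bsub>G\<^esub> \<sigma> = \<one>\<^bsub>G\<^esub>" using s inertia_inv by (auto simp: G_def)
  qed (auto simp: G_def inertia_comp id o_assoc)
  moreover have fin: "finite inertia" using finite_aut by (simp add: inertia_def)
  ultimately obtain P where P: "subgroup P G" "card P = CARD('p) ^ 1"
    using sylow_thm[of "CARD('p)" G 1 m] m prime_card[where 'a='p] by (auto simp: Coset.order_def G_def)
  interpret G: group G by fact
  have sub: "P \<subseteq> inertia" using subgroup.subset[OF P(1)] by (simp add: G_def)
  have comp: "bij_betw (\<lambda>\<tau>. \<sigma> \<circ> \<tau>) P P" if s: "\<sigma> \<in> P" for \<sigma>
  proof -
    have inj: "inj_on (\<lambda>\<tau>. \<sigma> \<circ> \<tau>) P"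
    proof (rule inj_onI)
      fix \<tau> \<rho> assume "\<sigma> \<circ> \<tau> = \<sigma> \<circ> \<rho>"
      moreover have "inj \<sigma>" using s sub autD(2)[of \<sigma>] by (auto simp: inertia_def bij_is_inj)
      ultimately show "\<tau> = \<rho>" by (simp add: fun.inj_map_strong inj_eq fun_eq_iff)
    qed
    have "(\<lambda>\<tau>. \<sigma> \<circ> \<tau>) ` P \<subseteq> P"
      using subgroup.m_closed[OF P(1) s] by (auto simp: G_def)
    then show ?thesis
      using inj finite_subset[OF sub fin] endo_inj_surj by (metis bij_betw_imageI)
  qed
  have "P \<subseteq> {id}"
  proof
    fix \<sigma> assume "\<sigma> \<in> P"
    then have "\<sigma> x = x" for x
      using inertia_subgroup_trivial[OF sub finite_subset[OF sub fin] _ comp tame] P(2) by simp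
    then show "\<sigma> \<in> {id}" by (simp add: fun_eq_iff)
  qed
  then have "card P \<le> 1" using card_mono[of "{id}" P] by simp
  then show False using P(2) prime_card[where 'a='p] prime_gt_1_nat[of "CARD('p)"] by simp
qed

text \<open>The trace of \<alpha> has order 0 in \<open>K\<close> and lies in the base field, where
  the order is \<open>e\<close> times \<open>pval\<close>.\<close>

lemma trace_unit:
  assumes "\<not> CARD('p) dvd e"
  obtains \<alpha> t where "\<alpha> \<in> mideal 0" "(\<Sum>\<sigma>\<in>aut. \<sigma> \<alpha>) = \<iota> t" "t \<noteq> 0" "pval t = 0"
proof -
  obtain \<alpha> where a: "\<alpha> \<in> mideal 0" "(\<Sum>\<sigma>\<in>aut. \<sigma> \<alpha>) \<notin> mideal 1"
    using prime_dvd_card_inertia not_dvd_card_inertia[OF assms] by blast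
  obtain t where t: "(\<Sum>\<sigma>\<in>aut. \<sigma> \<alpha>) = \<iota> t" using sum_aut_in_range by blast
  have "\<iota> t \<in> mideal 0" unfolding t[symmetric] using mideal_aut a(1) by (intro mideal_sum)
  then have nz: "t \<noteq> 0" and "0 \<le> int e * pval t" "int e * pval t < 1"
    using a(2) ord_emb[of t] unfolding t by (auto simp: mideal_iff)
  then have "int e * pval t = 0" by linarith
  then have "pval t = 0" using ramification_index_pos by simp
  then show ?thesis using that a(1) t nz by blast
qed

end

subsection \<open>The characteristic ideals\<close>

context padic_galois_extension
begin

text \<open>Coefficientwise trace. The second equation shows that it preserves integrality on
  \<open>\<O>\<^sub>K\<close>: the conjugate of \<open>h\<close> at \<open>x\<close> is the
  conjugate of a value of \<open>h\<close> at another integral point.\<close>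

lemma trace_poly:
  obtains f :: "'p padic poly" where "\<And>k. \<iota> (coeff f k) = (\<Sum>\<sigma>\<in>aut. \<sigma> (coeff h k))"
    "\<And>x. poly (map_poly \<iota> f) x = (\<Sum>\<sigma>\<in>aut. \<sigma> (poly h (inv_into UNIV \<sigma> x)))"
proof -
  define T where "T = (\<Sum>\<sigma>\<in>aut. map_poly \<sigma> h)"
  have T_coeff: "coeff T k = (\<Sum>\<sigma>\<in>aut. \<sigma> (coeff h k))" for k
    unfolding T_def coeff_sum by (intro sum.cong) (auto simp: coeff_map_poly aut_simps(4))
  define f where "f = map_poly (inv_into UNIV \<iota>) T"
  have inv0: "inv_into UNIV \<iota> 0 = 0"
    using inv_f_f[of \<iota> 0] by (simp add: inj_def)
  have f_coeff: "\<iota> (coeff f k) = coeff T k" for k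
    unfolding f_def coeff_map_poly[of "inv_into UNIV \<iota>", OF inv0]
    by (rule f_inv_into_f) (simp add: T_coeff sum_aut_in_range)
  have f_map: "map_poly \<iota> f = T"
    by (simp add: poly_eq_iff coeff_map_poly f_coeff)
  show ?thesis
  proof
    show "\<iota> (coeff f k) = (\<Sum>\<sigma>\<in>aut. \<sigma> (coeff h k))" for k by (simp add: f_coeff T_coeff)
    fix x
    have "poly (map_poly \<sigma> h) x = \<sigma> (poly h (inv_into UNIV \<sigma> x))" if s: "\<sigma> \<in> aut" for \<sigma>
    proof -
      interpret field_hom \<sigma> using s by (rule autD)
      have "\<sigma> (inv_into UNIV \<sigma> x) = x" using autD(2)[OF s] by (simp add: bij_is_surj surj_f_inv_f)
      then show ?thesis using poly_map_poly[of h "inv_into UNIV \<sigma> x"] by simp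
    qed
    then show "poly (map_poly \<iota> f) x = (\<Sum>\<sigma>\<in>aut. \<sigma> (poly h (inv_into UNIV \<sigma> x)))"
      unfolding f_map T_def poly_sum by (intro sum.cong) auto
  qed
qed

lemma integer_valued_poly_exists:
  assumes tame: "\<not> CARD('p) dvd e"
  obtains f where "f \<in> int_valued_polys \<iota>" "f \<noteq> 0" "degree f = n"
    "pval (lead_coeff f) = - int (wq q n div e)"
proof -
  let ?m = "int (wq q n div e)"
  obtain \<alpha> t where t: "\<alpha> \<in> mideal 0" "(\<Sum>\<sigma>\<in>aut. \<sigma> \<alpha>) = \<iota> t" "t \<noteq> 0" "pval t = 0"
    using trace_unit[OF tame] by blast
  obtain a :: "nat \<Rightarrow> 'k" where a: "\<And>x. x \<in> mideal 0 \<Longrightarrow> (\<Prod>i<n. x - a i) \<in> mideal (int (wq q n))"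
    by (rule well_distributed_sequence[of n]) blast
  define pm where "pm = (of_nat CARD('p) powi (- ?m) :: 'p padic)"
  have pm: "pm \<noteq> 0" "pval pm = - ?m" by (simp_all add: pm_def)
  define g where "g = (\<Prod>i<n. [:- a i, 1:])"
  have g_deg: "degree g = n" unfolding g_def by (subst degree_prod_eq_sum_degree) auto
  have "lead_coeff g = 1" unfolding g_def by (simp add: lead_coeff_prod)
  then have g_coeff: "coeff g n = 1" by (simp add: g_deg)
  define h where "h = smult (\<alpha> * \<iota> pm) g"
  have h_int: "poly h x \<in> mideal 0" if "x \<in> mideal 0" for x
  proof -
    have "poly g x = (\<Prod>i<n. x - a i)" by (simp add: g_def poly_prod)
    \<comment> \<open>Rounding down leaves \<open>e * m\<close> within the order that the product
      over the well-distributed points guarantees.\<close>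
    moreover have "int e * ?m \<le> int (wq q n)"
      by (metis of_nat_le_iff of_nat_mult times_div_less_eq_dividend)
    ultimately have "poly g x \<in> mideal (int e * ?m)" using a[OF that] mideal_antimono by metis
    moreover have "\<iota> pm \<in> mideal (- (int e * ?m))" using pm by (simp add: mideal_iff ord_emb)
    ultimately have "\<iota> pm * poly g x \<in> mideal 0" using mideal_mult by fastforce
    then show ?thesis using mideal_mult_left[OF t(1)] by (simp add: h_def mult.assoc)
  qed
  obtain f :: "'p padic poly" where f: "\<And>k. \<iota> (coeff f k) = (\<Sum>\<sigma>\<in>aut. \<sigma> (coeff h k))"
    "\<And>x. poly (map_poly \<iota> f) x = (\<Sum>\<sigma>\<in>aut. \<sigma> (poly h (inv_into UNIV \<sigma> x)))"
    by (rule trace_poly[of h]) blast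
  have "\<iota> (coeff f n) = (\<Sum>\<sigma>\<in>aut. \<sigma> \<alpha> * \<iota> pm)"
    unfolding f(1) by (intro sum.cong) (auto simp: h_def g_coeff aut_simps(3) autD(3))
  also have "\<dots> = \<iota> (t * pm)" by (simp add: sum_distrib_right[symmetric] t(2) emb.hom_mult)
  finally have fn: "coeff f n = t * pm" by (simp only: emb_eq_iff)
  have "coeff f k = 0" if "k > n" for k
  proof -
    have "coeff h k = 0" using that by (simp add: h_def coeff_eq_0 g_deg)
    then have "\<iota> (coeff f k) = 0" unfolding f(1) by (intro sum.neutral) (auto simp: aut_simps(4))
    then show ?thesis by simp
  qed
  then have "degree f \<le> n" by (intro degree_le) auto
  moreover have "n \<le> degree f" using fn t(3) pm(1) by (intro le_degree) simp
  ultimately have deg: "degree f = n" by simp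
  show ?thesis
  proof (rule that)
    show "f \<in> int_valued_polys \<iota>"
      unfolding int_valued_polys_def valuation_ring_eq
    proof (intro CollectI image_subsetI)
      fix x assume x: "x \<in> mideal 0"
      show "poly (map_poly \<iota> f) x \<in> mideal 0"
        unfolding f(2)
      proof (rule mideal_sum)
        fix \<sigma> assume s: "\<sigma> \<in> aut"
        show "\<sigma> (poly h (inv_into UNIV \<sigma> x)) \<in> mideal 0"
          by (rule mideal_aut[OF s h_int[OF mideal_aut[OF inv_in_aut[OF s] x]]])
      qed
    qed
    show "degree f = n" by (rule deg)
    show "f \<noteq> 0"
    proof
      assume "f = 0"
      then have "t * pm = 0" using fn by simp
      then show False using t(3) pm(1) by simp
    qed
    show "pval (lead_coeff f) = - int (wq q n div e)"
      unfolding deg fn pval_mult[OF t(3) pm(1)] t(4) pm(2) by simp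
  qed
qed

text \<open>The bound on leading coefficients gives one inclusion. For the other, a single leading
  coefficient attaining the bound generates the ideal, as it differs from the power of p by a
  unit.\<close>

lemma characteristic_ideal_eq:
  assumes tame: "\<not> CARD('p) dvd e"
  shows "characteristic_ideal \<iota> n = padic_ideal (- int (wq q n div e))"
proof -
  interpret m: Modules.module "\<lambda>(a :: 'p padic_int) (x :: 'p padic). to_fract a * x"
    by unfold_locales (simp_all add: algebra_simps)
  let ?k = "- int (wq q n div e)"
  let ?L = "{lead_coeff f | f. f \<in> int_valued_polys \<iota> \<and> f \<noteq> 0 \<and> degree f = n}"
  have "m.span ?L = padic_ideal ?k"
  proof
    have "m.subspace (padic_ideal ?k)"
      unfolding m.subspace_def
      using padic_ideal_add padic_ideal_mult[OF to_fract_in_padic_ideal] by fastforce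
    moreover have "?L \<subseteq> padic_ideal ?k" using lead_coeff_integer_valued by auto
    ultimately show "m.span ?L \<subseteq> padic_ideal ?k" by (intro m.span_minimal)
    show "padic_ideal ?k \<subseteq> m.span ?L"
    proof
      fix x :: "'p padic" assume "x \<in> padic_ideal ?k"
      then obtain b where b: "x = of_nat CARD('p) powi ?k * to_fract b" by (auto simp: padic_ideal_def)
      obtain f where f: "f \<in> int_valued_polys \<iota>" "f \<noteq> 0" "degree f = n" "pval (lead_coeff f) = ?k"
        by (rule integer_valued_poly_exists[OF tame]) blast
      have "lead_coeff f \<noteq> 0" using f(2) by simp
      then obtain u where u: "u dvd 1" "lead_coeff f = of_nat CARD('p) powi ?k * to_fract u"
        using f(4) by (metis pval_decompose)
      obtain u' where "1 = u * u'" using u(1) by (auto elim: dvdE)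
      then have u': "to_fract u' * to_fract u = 1" by (metis to_fract_1 to_fract_mult mult.commute)
      have "to_fract (b * u') * lead_coeff f
          = of_nat CARD('p) powi ?k * to_fract b * (to_fract u' * to_fract u)"
        unfolding u(2) to_fract_mult by (simp only: mult_ac)
      then have "x = to_fract (b * u') * lead_coeff f" by (simp only: u' b mult_1_right)
      moreover have "lead_coeff f \<in> m.span ?L" by (rule m.span_base) (use f in blast)
      ultimately show "x \<in> m.span ?L" using m.span_scale[of "lead_coeff f" ?L "b * u'"] by (simp only:)
    qed
  qed
  then show ?thesis unfolding characteristic_ideal_def .
qed

lemma w_ext_eq:
  assumes "tamely_ramified \<iota>"
  shows "w_ext \<iota> n = int (wq q n div e)"
proof -
  have "\<not> CARD('p) dvd e" using assms by (simp add: tamely_ramified_def)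
  then show ?thesis
    by (simp add: w_ext_def characteristic_ideal_eq fractional_ideal_val_padic_ideal)
qed

end

text \<open>Dependence on n, q and e alone is expressed by comparison with a second extension
  \<kappa> having the same invariants, possibly for another prime \<open>'r\<close> and another
  field \<open>'l\<close>; both sides are then given by the same formula.\<close>

theorem theorem3p2:
  fixes \<iota> :: "'p::prime_card padic \<Rightarrow> 'k::field" and q e :: nat
  assumes "finite_galois_extension \<iota>"
    and "tamely_ramified \<iota>"
    and "e = ramification_index \<iota>"
    and "q = card (residue_field \<iota>)"
  shows "(\<forall>n. w_ext \<iota> n = \<lfloor>real (wq q n) / real e\<rfloor>) \<and>
    (\<forall>\<kappa> :: 'r::prime_card padic \<Rightarrow> 'l::field.
       finite_galois_extension \<kappa> \<and> tamely_ramified \<kappa> \<and>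
       ramification_index \<kappa> = e \<and> card (residue_field \<kappa>) = q \<longrightarrow>
       (\<forall>n. w_ext \<kappa> n = w_ext \<iota> n))"
proof (intro conjI allI impI)
  have w: "w_ext \<iota> n = int (wq q n div e)" for n
    using padic_galois_extension.w_ext_eq[OF padic_galois_extension.intro[OF assms(1)] assms(2)] assms(3,4)
    by simp
  then show "w_ext \<iota> n = \<lfloor>real (wq q n) / real e\<rfloor>" for n
    by (simp add: floor_divide_of_nat_eq)
  fix \<kappa> :: "'r padic \<Rightarrow> 'l" and n
  assume k: "finite_galois_extension \<kappa> \<and> tamely_ramified \<kappa> \<and>
    ramification_index \<kappa> = e \<and> card (residue_field \<kappa>) = q"
  then have "padic_galois_extension \<kappa>" by (simp add: padic_galois_extension.intro)
  from padic_galois_extension.w_ext_eq[OF this] k have "w_ext \<kappa> n = int (wq q n div e)" by simp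
  then show "w_ext \<kappa> n = w_ext \<iota> n" by (simp add: w)
qed

end
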